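(* Let $N\ge1$ and $\gamma>1$. The energy functional $E:\Sigma(\mathbb{R}^N)\to\mathbb{R}$, $$E(u)=\frac12\int_{\mathbb{R}^N}|\nabla u|^2dx+\frac{\gamma(\gamma-1)}{2}\int_{\mathbb{R}^N}|x|^2|u|^2dx-\frac12\int_{\mathbb{R}^N}|u|^2\mathrm{Log}|u|^2dx,$$ is of class $C^1$, and for $u\in\Sigma(\mathbb{R}^N)$ the Fréchet derivative of $E$ at $u$ exists and is given by $$E'(u)=-\Delta u+\gamma(\gamma-1)|x|^2u-u\,\mathrm{Log}|u|^2-u.$$
   Context: All functions are complex valued. $\mathrm{Log}$ is the natural logarithm, with $z\,\mathrm{Log}|z|^2=0$ and $|z|^2\mathrm{Log}|z|^2=0$ at $z=0$. $\Sigma(\mathbb{R}^N)=\{u\in H^1(\mathbb{R}^N): |x|u\in L^2(\mathbb{R}^N)\}$, with norm $\|u\|_\Sigma^2=\int_{\mathbb{R}^N}(|\nabla u|^2+|x|^2|u|^2)\,dx$, regarded as a real Hilbert space for the purpose of differentiation; $\Sigma'(\mathbb{R}^N)$ is its dual. The expression for $E'(u)$ is an element of $\Sigma'(\mathbb{R}^N)$ through the real pairing: $\langle E'(u),v\rangle=\mathrm{Re}\int_{\mathbb{R}^N}\big(\nabla u\cdot\overline{\nabla v}+\gamma(\gamma-1)|x|^2u\bar v-u\,\mathrm{Log}|u|^2\,\bar v-u\bar v\big)dx$ for $v\in\Sigma(\mathbb{R}^N)$. *)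

theory Defs
  imports "HOL-Analysis.Analysis"
begin

section \<open>Test functions and weak gradients\<close>

definition partial_deriv :: "'n::finite \<Rightarrow> (real^'n \<Rightarrow> real) \<Rightarrow> real^'n \<Rightarrow> real" where
  "partial_deriv i f x = frechet_derivative f (at x) (axis i 1)"

primrec Ck :: "nat \<Rightarrow> (real^'n::finite \<Rightarrow> real) \<Rightarrow> bool" where
  "Ck 0 f \<longleftrightarrow> continuous_on UNIV f"
| "Ck (Suc k) f \<longleftrightarrow> f differentiable_on UNIV \<and> (\<forall>i. Ck k (partial_deriv i f))"

definition test_function :: "(real^'n::finite \<Rightarrow> real) \<Rightarrow> bool" where
  "test_function \<phi> \<longleftrightarrow> (\<forall>k. Ck k \<phi>) \<and> compact (closure {x. \<phi> x \<noteq> 0})"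

definition square_integrable :: "(real^'n::finite \<Rightarrow> 'b::real_normed_vector) \<Rightarrow> bool" where
  "square_integrable f \<longleftrightarrow>
     f \<in> borel_measurable lborel \<and> integrable lborel (\<lambda>x. (norm (f x))\<^sup>2)"

text \<open>Only used for square integrable \<open>u\<close> and \<open>g\<close>, for which both integrands are integrable.
  Real-valued test functions suffice, by linearity.\<close>

definition weak_gradient :: "(real^'n::finite \<Rightarrow> complex) \<Rightarrow> (real^'n \<Rightarrow> complex^'n) \<Rightarrow> bool" where
  "weak_gradient u g \<longleftrightarrow> (\<forall>\<phi> i. test_function \<phi> \<longrightarrow>
     (LINT x|lborel. partial_deriv i \<phi> x *\<^sub>R u x) = - (LINT x|lborel. \<phi> x *\<^sub>R (g x $ i)))"

definition H1 :: "(real^'n::finite \<Rightarrow> complex) \<Rightarrow> bool" where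
  "H1 u \<longleftrightarrow> square_integrable u \<and> (\<exists>g. square_integrable g \<and> weak_gradient u g)"

definition in_Sigma :: "(real^'n::finite \<Rightarrow> complex) \<Rightarrow> bool" where
  "in_Sigma u \<longleftrightarrow> H1 u \<and> square_integrable (\<lambda>x. norm x *\<^sub>R u x)"

subsection \<open>Elementary facts on square integrable functions\<close>

lemma square_integrableD:
  assumes "square_integrable f"
  shows "f \<in> borel_measurable lborel" "integrable lborel (\<lambda>x. (norm (f x))\<^sup>2)"
  using assms by (auto simp: square_integrable_def)

lemma square_integrable_zero: "square_integrable (\<lambda>x. 0)"
  by (simp add: square_integrable_def)

lemma square_integrable_scaleR:
  fixes f :: "real^'n::finite \<Rightarrow> 'b::{real_normed_vector,second_countable_topology}"
  assumes "square_integrable f"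
  shows "square_integrable (\<lambda>x. c *\<^sub>R f x)"
  using assms by (auto simp: square_integrable_def power_mult_distrib)

lemma square_integrable_add:
  fixes f g :: "real^'n::finite \<Rightarrow> 'b::{real_normed_vector,second_countable_topology}"
  assumes "square_integrable f" "square_integrable g"
  shows "square_integrable (\<lambda>x. f x + g x)"
  unfolding square_integrable_def
proof
  note [measurable] = square_integrableD(1)[OF assms(1)] square_integrableD(1)[OF assms(2)]
  show "(\<lambda>x. f x + g x) \<in> borel_measurable lborel" by measurable
  show "integrable lborel (\<lambda>x. (norm (f x + g x))\<^sup>2)"
  proof (rule Bochner_Integration.integrable_bound)
    show "integrable lborel (\<lambda>x. 2 * (norm (f x))\<^sup>2 + 2 * (norm (g x))\<^sup>2)"
      using assms by (auto simp: square_integrable_def)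
    show "AE x in lborel. norm ((norm (f x + g x))\<^sup>2)
        \<le> norm (2 * (norm (f x))\<^sup>2 + 2 * (norm (g x))\<^sup>2)"
    proof (intro AE_I2)
      fix x
      have "(norm (f x + g x))\<^sup>2 \<le> (norm (f x) + norm (g x))\<^sup>2"
        by (simp add: norm_triangle_ineq power_mono)
      also have "\<dots> \<le> 2 * (norm (f x))\<^sup>2 + 2 * (norm (g x))\<^sup>2"
        using sum_squares_ge_zero[of "norm (f x) - norm (g x)" 0]
        by (simp add: power2_eq_square algebra_simps)
      finally show "norm ((norm (f x + g x))\<^sup>2) \<le> norm (2 * (norm (f x))\<^sup>2 + 2 * (norm (g x))\<^sup>2)"
        by simp
    qed
  qed measurable
qed

lemma square_integrable_bilinear:
  fixes f :: "real^'n::finite \<Rightarrow> 'b::{real_normed_vector,second_countable_topology}"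
    and g :: "real^'n \<Rightarrow> 'c::{real_normed_vector,second_countable_topology}"
    and p :: "real^'n \<Rightarrow> 'd::{banach,second_countable_topology}"
  assumes "square_integrable f" "square_integrable g"
    and "p \<in> borel_measurable lborel"
    and "\<And>x. norm (p x) \<le> norm (f x) * norm (g x)"
  shows "integrable lborel p"
proof (rule Bochner_Integration.integrable_bound)
  show "integrable lborel (\<lambda>x. (norm (f x))\<^sup>2 + (norm (g x))\<^sup>2)"
    using assms by (auto simp: square_integrable_def)
  show "AE x in lborel. norm (p x) \<le> norm ((norm (f x))\<^sup>2 + (norm (g x))\<^sup>2)"
  proof (intro AE_I2)
    fix x
    have "norm (f x) * norm (g x) \<le> (norm (f x))\<^sup>2 + (norm (g x))\<^sup>2"
      using sum_squares_bound[of "norm (f x)" "norm (g x)"] mult_nonneg_nonneg[OF norm_ge_zero[of "f x"] norm_ge_zero[of "g x"]]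
      by linarith
    then show "norm (p x) \<le> norm ((norm (f x))\<^sup>2 + (norm (g x))\<^sup>2)"
      using assms(4)[of x] by simp
  qed
qed (use assms in auto)

lemma square_integrable_component:
  fixes g :: "real^'n::finite \<Rightarrow> complex^'n"
  assumes "square_integrable g"
  shows "square_integrable (\<lambda>x. g x $ i)"
  unfolding square_integrable_def
proof
  have 1: "g \<in> borel_measurable lborel" using assms by (simp add: square_integrable_def)
  have "(\<lambda>v::complex^'n. v $ i) \<in> borel_measurable borel"
    by (intro borel_measurable_continuous_onI continuous_intros)
  then show m: "(\<lambda>x. g x $ i) \<in> borel_measurable lborel"
    using measurable_compose[OF 1] by simp
  show "integrable lborel (\<lambda>x. (norm (g x $ i))\<^sup>2)"
    using square_integrableD(2)[OF assms]
    by (rule Bochner_Integration.integrable_bound)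
       (use m in \<open>auto intro!: power_mono Finite_Cartesian_Product.norm_nth_le\<close>)
qed

lemma square_integrable_bounded_support:
  fixes f :: "real^'n::finite \<Rightarrow> real"
  assumes "continuous_on UNIV f" "compact K" "\<And>x. x \<notin> K \<Longrightarrow> f x = 0"
  shows "square_integrable f"
  unfolding square_integrable_def
proof
  show m: "f \<in> borel_measurable lborel"
    using borel_measurable_continuous_onI[OF assms(1)] by simp
  have "integrable lborel (\<lambda>x. indicator K x *\<^sub>R (norm (f x))\<^sup>2)"
    by (intro borel_integrable_compact assms continuous_intros continuous_on_subset[OF assms(1)]) auto
  moreover have "(\<lambda>x. indicator K x *\<^sub>R (norm (f x))\<^sup>2) = (\<lambda>x. (norm (f x))\<^sup>2)"
    using assms(3) by (auto simp: indicator_def fun_eq_iff)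
  ultimately show "integrable lborel (\<lambda>x. (norm (f x))\<^sup>2)" by simp
qed

lemma Ck_continuous: "Ck k f \<Longrightarrow> continuous_on UNIV f"
  by (cases k) (auto intro: differentiable_imp_continuous_on)

lemma partial_derivI: "(f has_derivative f') (at x) \<Longrightarrow> partial_deriv i f x = f' (axis i 1)"
  by (simp add: partial_deriv_def frechet_derivative_at[symmetric])

lemma test_function_square_integrable:
  assumes "test_function \<phi>"
  shows "square_integrable \<phi>" "square_integrable (partial_deriv i \<phi>)"
proof -
  let ?K = "closure {x. \<phi> x \<noteq> 0}"
  have K: "compact ?K" using assms by (simp add: test_function_def)
  have "Ck (Suc 0) \<phi>" using assms unfolding test_function_def by blast
  then have c: "continuous_on UNIV \<phi>" "continuous_on UNIV (partial_deriv i \<phi>)"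
    by (simp_all add: differentiable_imp_continuous_on)
  have z: "\<phi> x = 0" if "x \<notin> ?K" for x
    using that closure_subset[of "{x. \<phi> x \<noteq> 0}"] by auto
  have "partial_deriv i \<phi> x = 0" if "x \<notin> ?K" for x
  proof -
    have "open (- ?K)" "x \<in> - ?K" using that by (simp_all only: open_Compl closed_closure Compl_iff not_False_eq_True)
    then have "(\<phi> has_derivative (\<lambda>_. 0)) (at x)"
      by (rule has_derivative_transform_within_open[OF has_derivative_const[of 0]])
         (rule z[symmetric], simp only: Compl_iff not_False_eq_True)
    then show ?thesis by (rule partial_derivI)
  qed
  then show "square_integrable \<phi>" "square_integrable (partial_deriv i \<phi>)"
    by (blast intro: square_integrable_bounded_support[OF c(1) K] square_integrable_bounded_support[OF c(2) K] z)+
qed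

lemma test_integrable:
  fixes u :: "real^'n::finite \<Rightarrow> complex"
  assumes "test_function \<phi>" "square_integrable u"
  shows "integrable lborel (\<lambda>x. \<phi> x *\<^sub>R u x)" "integrable lborel (\<lambda>x. partial_deriv i \<phi> x *\<^sub>R u x)"
proof -
  note s = test_function_square_integrable[OF assms(1)]
  show "integrable lborel (\<lambda>x. \<phi> x *\<^sub>R u x)"
    by (rule square_integrable_bilinear[OF s(1) assms(2)
          borel_measurable_scaleR[OF square_integrableD(1)[OF s(1)] square_integrableD(1)[OF assms(2)]]])
       (rule eq_refl, rule norm_scaleR[THEN trans], simp only: real_norm_def)
  show "integrable lborel (\<lambda>x. partial_deriv i \<phi> x *\<^sub>R u x)"
    by (rule square_integrable_bilinear[OF s(2)[of i] assms(2)
          borel_measurable_scaleR[OF square_integrableD(1)[OF s(2)[of i]] square_integrableD(1)[OF assms(2)]]])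
       (rule eq_refl, rule norm_scaleR[THEN trans], simp only: real_norm_def)
qed

subsection \<open>Smooth bump functions\<close>

definition bump :: "nat \<Rightarrow> real \<Rightarrow> real" where
  "bump m t = (if t > 0 then (1 / t) ^ m * exp (- (1 / t)) else 0)"

lemma bump_lim: "((\<lambda>t. (1 / t) ^ m * exp (- (1 / t))) \<longlongrightarrow> (0::real)) (at_right 0)"
proof -
  have "((\<lambda>s. s ^ m / exp s) \<longlongrightarrow> (0::real)) at_top"
    by (rule tendsto_power_div_exp_0)
  then have "(((\<lambda>s. s ^ m / exp s) \<circ> inverse) \<longlongrightarrow> (0::real)) (at_right 0)"
    unfolding comp_def
    by (rule filterlim_compose[OF _ filterlim_inverse_at_top_right])
  then show ?thesis
    by (simp add: comp_def exp_minus divide_inverse)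
qed

lemma bump_deriv:
  "(bump m has_real_derivative (bump (m + 2) t - m * bump (m + 1) t)) (at t)"
proof -
  consider "t > 0" | "t < 0" | "t = 0" by linarith
  then show ?thesis
  proof cases
    case 1
    have "((\<lambda>t. (1 / t) ^ m * exp (- (1 / t))) has_real_derivative
        (bump (m + 2) t - m * bump (m + 1) t)) (at t)"
    proof -
      have s: "((\<lambda>t. 1 / t) has_real_derivative - ((1 / t)\<^sup>2)) (at t)"
        using 1 by (auto intro!: derivative_eq_intros simp: power2_eq_square)
      show ?thesis
        by (rule DERIV_cong[OF DERIV_mult[OF DERIV_power[OF s, of m] DERIV_chain2[OF DERIV_exp DERIV_minus[OF s]]]])
           (use 1 in \<open>cases m; simp add: bump_def power2_eq_square algebra_simps\<close>)
    qed
    then show ?thesis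
      by (rule has_field_derivative_transform_within_open[where S = "{0<..}"])
         (use 1 in \<open>auto simp: bump_def\<close>)
  next
    case 2
    have "(bump m has_real_derivative 0) (at t)"
      by (rule has_field_derivative_transform_within_open[OF DERIV_const[of 0], where S = "{..<0}"])
         (use 2 in \<open>auto simp: bump_def\<close>)
    then show ?thesis using 2 by (simp add: bump_def)
  next
    case 3
    have "((\<lambda>h. bump m h / h) \<longlongrightarrow> 0) (at_right 0)"
    proof (rule Lim_transform_eventually[OF bump_lim[of "Suc m"]])
      show "\<forall>\<^sub>F h in at_right 0. (1 / h) ^ Suc m * exp (- (1 / h)) = bump m h / h"
        by (auto simp: eventually_at_filter bump_def field_simps)
    qed
    moreover have "((\<lambda>h. bump m h / h) \<longlongrightarrow> 0) (at_left 0)"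
      by (rule Lim_transform_eventually[OF tendsto_const])
         (auto simp: eventually_at_filter bump_def)
    ultimately have "((\<lambda>h. bump m h / h) \<longlongrightarrow> 0) (at 0)"
      by (simp add: filterlim_split_at)
    then show ?thesis using 3 by (simp add: DERIV_def bump_def)
  qed
qed

lemma bump0_bounds: "0 \<le> bump 0 t" "bump 0 t \<le> 1"
  by (auto simp: bump_def)

lemma bump0_lim: "(\<lambda>n. bump 0 (real (Suc n) * t)) \<longlonglongrightarrow> (if t > 0 then 1 else 0)"
proof (cases "t > 0")
  case True
  have "(\<lambda>n. exp (- ((1 / t) * inverse (real (Suc n))))) \<longlonglongrightarrow> exp (- ((1 / t) * 0))"
    by (intro tendsto_intros LIMSEQ_inverse_real_of_nat)
  moreover have "bump 0 (real (Suc n) * t) = exp (- ((1 / t) * inverse (real (Suc n))))" for n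
    using True unfolding bump_def by (subst if_P) (simp_all add: divide_inverse mult_ac del: of_nat_Suc)
  ultimately show ?thesis using True by simp
next
  case False
  then have "\<not> real (Suc n) * t > 0" for n
    by (simp add: zero_less_mult_iff)
  then show ?thesis using False by (simp add: bump_def)
qed

lemma differentiable_has_derivative:
  "f differentiable_on UNIV \<Longrightarrow> (f has_derivative frechet_derivative f (at x)) (at x)"
  by (simp add: differentiable_on_def frechet_derivative_works[symmetric])

lemma Ck_const: "Ck k (\<lambda>x. c)"
proof (induction k arbitrary: c)
  case (Suc k)
  have "partial_deriv i (\<lambda>x. c) = (\<lambda>x. 0)" for i :: 'a
    by (auto intro!: ext partial_derivI[where f' = "\<lambda>_. 0", simplified])
  with Suc show ?case by simp
qed simp

lemma Ck_Suc_imp: "Ck (Suc k) f \<Longrightarrow> Ck k f"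
proof (induction k arbitrary: f)
  case 0
  then show ?case by (auto intro: differentiable_imp_continuous_on)
next
  case (Suc k)
  then show ?case by (metis Ck.simps(2))
qed

lemma Ck_add: "Ck k f \<Longrightarrow> Ck k g \<Longrightarrow> Ck k (\<lambda>x. f x + g x)"
proof (induction k arbitrary: f g)
  case (Suc k)
  then have d: "f differentiable_on UNIV" "g differentiable_on UNIV" by auto
  have "partial_deriv i (\<lambda>x. f x + g x) = (\<lambda>x. partial_deriv i f x + partial_deriv i g x)" for i
    by (intro ext partial_derivI[OF has_derivative_add[OF differentiable_has_derivative[OF d(1)]
          differentiable_has_derivative[OF d(2)]], folded partial_deriv_def])
  with Suc d show ?case by auto
qed (auto intro: continuous_intros)

lemma Ck_mult: "Ck k f \<Longrightarrow> Ck k g \<Longrightarrow> Ck k (\<lambda>x. f x * g x)"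
proof (induction k arbitrary: f g)
  case (Suc k)
  then have d: "f differentiable_on UNIV" "g differentiable_on UNIV" by auto
  have "partial_deriv i (\<lambda>x. f x * g x) = (\<lambda>x. f x * partial_deriv i g x + partial_deriv i f x * g x)" for i
    by (intro ext partial_derivI[OF has_derivative_mult[OF differentiable_has_derivative[OF d(1)]
          differentiable_has_derivative[OF d(2)]], folded partial_deriv_def])
  moreover have "Ck k f" "Ck k g" using Suc.prems Ck_Suc_imp by blast+
  ultimately show ?case using Suc d by (auto intro!: Ck_add)
qed (auto intro: continuous_intros)

lemma Ck_prod: "finite A \<Longrightarrow> (\<And>j. j \<in> A \<Longrightarrow> Ck k (f j)) \<Longrightarrow> Ck k (\<lambda>x. \<Prod>j\<in>A. f j x)"
  by (induction A rule: finite_induct) (auto intro: Ck_const Ck_mult)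

lemma has_derivative_bump:
  "((\<lambda>x. bump m (c * (x $ j) + d)) has_derivative
    (\<lambda>h. (c * (h $ j)) * (bump (m + 2) (c * (x $ j) + d) - m * bump (m + 1) (c * (x $ j) + d)))) (at x)"
proof -
  have "((\<lambda>x. c * (x $ j) + d) has_derivative (\<lambda>h. c * (h $ j) + 0)) (at x)"
    by (intro has_derivative_add has_derivative_mult_right has_derivative_const
          bounded_linear_imp_has_derivative bounded_linear_vec_nth)
  note * = has_derivative_compose[OF this bump_deriv[of m, unfolded has_field_derivative_def]]
  show ?thesis by (rule has_derivative_eq_rhs[OF *]) (rule ext, simp)
qed

lemma differentiable_bump: "(\<lambda>x. bump m (c * (x $ j) + d)) differentiable_on UNIV"
  unfolding differentiable_on_def
proof
  fix x :: "real^'a"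
  show "(\<lambda>x. bump m (c * (x $ j) + d)) differentiable at x"
    by (rule differentiableI[OF has_derivative_bump])
qed

lemma partial_deriv_bump:
  "partial_deriv i (\<lambda>x. bump m (c * (x $ j) + d)) = (\<lambda>x. (c * (axis i 1 $ j)) *
      (bump (m + 2) (c * (x $ j) + d) + (- real m) * bump (m + 1) (c * (x $ j) + d)))"
proof
  fix x :: "real^'a"
  show "partial_deriv i (\<lambda>x. bump m (c * (x $ j) + d)) x = (c * (axis i 1 $ j)) *
      (bump (m + 2) (c * (x $ j) + d) + (- real m) * bump (m + 1) (c * (x $ j) + d))"
    unfolding partial_derivI[OF has_derivative_bump[of m c j d x], of i] by simp
qed

lemma Ck_bump: "Ck k (\<lambda>x. bump m (c * (x $ j) + d))"
proof (induction k arbitrary: m)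
  case 0
  show ?case unfolding Ck.simps by (rule differentiable_imp_continuous_on[OF differentiable_bump])
next
  case (Suc k)
  show ?case unfolding Ck.simps(2) partial_deriv_bump
    by (intro conjI allI Ck_mult Ck_add Ck_const Suc.IH differentiable_bump)
qed

definition box_bump :: "real^'n::finite \<Rightarrow> real^'n \<Rightarrow> nat \<Rightarrow> real^'n \<Rightarrow> real" where
  "box_bump a b n x = (\<Prod>j\<in>UNIV. bump 0 (real (Suc n) * (x $ j - a $ j)) *
                                  bump 0 (real (Suc n) * (b $ j - x $ j)))"

lemma box_bump_outside: 
  assumes "x \<notin> box a b" 
  shows "box_bump a b n x = 0"
proof -
  obtain j where "x $ j \<le> a $ j \<or> b $ j \<le> x $ j"
    using assms by (auto simp: mem_box_cart not_less)
  then have "\<not> 0 < real (Suc n) * (x $ j - a $ j) \<or> \<not> 0 < real (Suc n) * (b $ j - x $ j)"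
    by (auto simp: zero_less_mult_iff)
  then have "bump 0 (real (Suc n) * (x $ j - a $ j)) * bump 0 (real (Suc n) * (b $ j - x $ j)) = 0"
    by (auto simp: bump_def)
  then show ?thesis unfolding box_bump_def by (meson UNIV_I finite prod_zero)
qed

lemma box_bump_bounds: "0 \<le> box_bump a b n x" "box_bump a b n x \<le> 1"
  unfolding box_bump_def
  by (auto intro!: prod_nonneg prod_le_1 mult_le_one bump0_bounds mult_nonneg_nonneg)

lemma box_bump_test: "test_function (box_bump a b n)"
  unfolding test_function_def
proof
  have "Ck k (\<lambda>x. bump 0 (real (Suc n) * (x $ j) + (- real (Suc n) * a $ j)) *
                  bump 0 (- real (Suc n) * (x $ j) + real (Suc n) * b $ j))" for k and j :: 'a
    by (intro Ck_mult Ck_bump)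
  then show "\<forall>k. Ck k (box_bump a b n)"
    unfolding box_bump_def[abs_def]
    by (intro allI Ck_prod) (auto simp: algebra_simps)
  have "{x. box_bump a b n x \<noteq> 0} \<subseteq> box a b"
  proof
    fix x assume "x \<in> {x. box_bump a b n x \<noteq> 0}"
    then show "x \<in> box a b" using box_bump_outside[of x a b n] by (cases "x \<in> box a b") simp_all
  qed
  then show "compact (closure {x. box_bump a b n x \<noteq> 0})"
    unfolding compact_closure by (rule bounded_subset[OF bounded_box])
qed

lemma box_bump_lim: "(\<lambda>n. box_bump a b n x) \<longlonglongrightarrow> indicator (box a b) x"
proof -
  have "(\<lambda>n. box_bump a b n x) \<longlonglongrightarrow>
     (\<Prod>j\<in>UNIV. (if x $ j - a $ j > 0 then 1 else 0) * (if b $ j - x $ j > 0 then 1 else 0))"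
    unfolding box_bump_def by (intro tendsto_intros bump0_lim)
  also have "(\<Prod>j\<in>UNIV. (if x $ j - a $ j > 0 then 1 else 0) * (if b $ j - x $ j > 0 then 1 else 0))
      = (indicator (box a b) x :: real)"
    by (auto simp: indicator_def mem_box_cart intro!: prod.neutral)
  finally show ?thesis .
qed

subsection \<open>Uniqueness of weak gradients\<close>

lemma AE_zero_real:
  fixes h :: "real^'n::finite \<Rightarrow> real"
  assumes h: "square_integrable h"
    and z: "\<And>\<phi>. test_function \<phi> \<Longrightarrow> (LINT x|lborel. \<phi> x * h x) = 0"
  shows "AE x in lborel. h x = 0"
proof -
  have m[measurable]: "h \<in> borel_measurable lborel" using square_integrableD[OF h] by auto
  have ind: "square_integrable (indicator (box a b) :: real^'n \<Rightarrow> real)" for a b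
    unfolding square_integrable_def
  proof
    have "(\<lambda>x. (norm (indicator (box a b) x :: real))\<^sup>2) = (indicator (box a b) :: real^'n \<Rightarrow> real)"
      by (auto simp: indicator_def)
    then show "integrable lborel (\<lambda>x. (norm (indicator (box a b) x :: real))\<^sup>2)"
      by (simp add: integrable_indicator_iff emeasure_lborel_box_finite[unfolded infinity_ennreal_def])
  qed simp
  have I: "integrable lborel (\<lambda>x. indicator (box a b) x * h x)" for a b
    using ind h by (rule square_integrable_bilinear) (auto simp: abs_mult)
  have Z: "(LINT x|lborel. indicator (box a b) x * h x) = 0" for a b
  proof -
    have [measurable]: "box_bump a b n \<in> borel_measurable lborel" for n
      using test_function_square_integrable(1)[OF box_bump_test] square_integrableD by blast
    have "(\<lambda>n. LINT x|lborel. box_bump a b n x * h x) \<longlonglongrightarrow> (LINT x|lborel. indicator (box a b) x * h x)"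
    proof (rule integral_dominated_convergence[where w = "\<lambda>x. norm (indicator (box a b) x * h x)"])
      show "integrable lborel (\<lambda>x. norm (indicator (box a b) x * h x))" using I by (rule integrable_norm)
      show "AE x in lborel. (\<lambda>n. box_bump a b n x * h x) \<longlonglongrightarrow> indicator (box a b) x * h x"
        by (intro AE_I2 tendsto_intros box_bump_lim)
      show "AE x in lborel. norm (box_bump a b n x * h x) \<le> norm (indicator (box a b) x * h x)" for n
      proof (intro AE_I2)
        fix x
        show "norm (box_bump a b n x * h x) \<le> norm (indicator (box a b) x * h x)"
        proof (cases "x \<in> box a b")
          case True
          then show ?thesis using box_bump_bounds[of a b n x]
            by (simp add: abs_mult mult_left_le_one_le)
        next
          case False
          then show ?thesis by (simp add: box_bump_outside)
        qed
      qed
    qed measurable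
    then show ?thesis using z[OF box_bump_test] by (simp add: LIMSEQ_const_iff)
  qed
  let ?p = "\<lambda>x. ennreal (max 0 (h x))" and ?q = "\<lambda>x. ennreal (max 0 (- h x))"
  have P: "emeasure (density lborel (\<lambda>x. ennreal (max 0 (s * h x)))) (box a b) =
      ennreal (LINT x|lborel. max 0 (s * (indicator (box a b) x * h x)))" for a b s
  proof -
    have "emeasure (density lborel (\<lambda>x. ennreal (max 0 (s * h x)))) (box a b) =
        (\<integral>\<^sup>+x. ennreal (max 0 (s * h x)) * indicator (box a b) x \<partial>lborel)"
      by (intro emeasure_density) measurable
    also have "\<dots> = (\<integral>\<^sup>+x. ennreal (max 0 (s * (indicator (box a b) x * h x))) \<partial>lborel)"
      by (intro nn_integral_cong) (auto simp: indicator_def)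
    also have "\<dots> = ennreal (LINT x|lborel. max 0 (s * (indicator (box a b) x * h x)))"
      using I by (intro nn_integral_eq_integral integrable_max integrable_mult_right) auto
    finally show ?thesis .
  qed
  have E: "emeasure (density lborel ?p) (box a b) = emeasure (density lborel ?q) (box a b)" for a b
  proof -
    have i1: "integrable lborel (\<lambda>x. max 0 (indicator (box a b) x * h x))"
      and i2: "integrable lborel (\<lambda>x. max 0 (- (indicator (box a b) x * h x)))"
      using I by (intro integrable_max Bochner_Integration.integrable_minus; simp)+
    have "(LINT x|lborel. max 0 (indicator (box a b) x * h x)) -
        (LINT x|lborel. max 0 (- (indicator (box a b) x * h x))) =
        (LINT x|lborel. max 0 (indicator (box a b) x * h x) - max 0 (- (indicator (box a b) x * h x)))"
      using i1 i2 by simp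
    also have "\<dots> = (LINT x|lborel. indicator (box a b) x * h x)"
      by (intro Bochner_Integration.integral_cong) (auto simp: max_def)
    finally show ?thesis
      using P[of 1 a b] P[of "-1" a b] Z[of a b] by simp
  qed
  have "density lborel ?p = density lborel ?q"
  proof (rule measure_eqI_generator_eq[where E = "range (\<lambda>(a, b). box a b)" and \<Omega> = UNIV
        and A = "\<lambda>n. box (- (real n *\<^sub>R One)) (real n *\<^sub>R One)"])
    show "Int_stable (range (\<lambda>(a, b). box a b :: (real^'n) set))"
      by (auto simp: Int_stable_def box_Int_box)
    show "emeasure (density lborel ?p) X = emeasure (density lborel ?q) X"
      if "X \<in> range (\<lambda>(a, b). box a b)" for X
      using that E by auto
    show "sets (density lborel ?p) = sigma_sets UNIV (range (\<lambda>(a, b). box a b))"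
      "sets (density lborel ?q) = sigma_sets UNIV (range (\<lambda>(a, b). box a b))"
      by (simp_all add: borel_eq_box)
    show "(\<Union>n. box (- (real n *\<^sub>R One)) (real n *\<^sub>R One)) = (UNIV :: (real^'n) set)"
      by (rule UN_box_eq_UNIV)
    show "emeasure (density lborel ?p) (box (- (real n *\<^sub>R One)) (real n *\<^sub>R One)) \<noteq> \<infinity>" for n
      using P[of 1] by simp
  qed auto
  then have "AE x in lborel. ?p x = ?q x"
    by (intro sigma_finite_measure.density_unique[OF lborel.sigma_finite_measure_axioms]) auto
  then show ?thesis
    by eventually_elim (auto simp: max_def split: if_splits)
qed

lemma AE_zero_complex:
  fixes h :: "real^'n::finite \<Rightarrow> complex"
  assumes h: "square_integrable h"
    and z: "\<And>\<phi>. test_function \<phi> \<Longrightarrow> (LINT x|lborel. \<phi> x *\<^sub>R h x) = 0"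
  shows "AE x in lborel. h x = 0"
proof -
  note m[measurable] = square_integrableD(1)[OF h]
  have r: "square_integrable (\<lambda>x. Re (h x))" "square_integrable (\<lambda>x. Im (h x))"
    unfolding square_integrable_def
    by (auto intro!: Bochner_Integration.integrable_bound[OF square_integrableD(2)[OF h]]
          simp: cmod_def)
  have "(LINT x|lborel. \<phi> x * Re (h x)) = 0" "(LINT x|lborel. \<phi> x * Im (h x)) = 0"
    if t: "test_function \<phi>" for \<phi>
    using integral_Re[OF test_integrable(1)[OF t h]] integral_Im[OF test_integrable(1)[OF t h]] z[OF t]
    by auto
  then have "AE x in lborel. Re (h x) = 0" "AE x in lborel. Im (h x) = 0"
    using AE_zero_real r by blast+
  then show ?thesis by eventually_elim (simp add: complex_eq_iff)
qed

lemma weak_gradient_add: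
  assumes "square_integrable u" "square_integrable v" "square_integrable g" "square_integrable h"
    and "weak_gradient u g" "weak_gradient v h"
  shows "weak_gradient (\<lambda>x. u x + v x) (\<lambda>x. g x + h x)"
  unfolding weak_gradient_def
proof (intro allI impI)
  fix \<phi> :: "real^'a \<Rightarrow> real" and i assume t: "test_function \<phi>"
  note s = test_integrable[OF t]
  show "(LINT x|lborel. partial_deriv i \<phi> x *\<^sub>R (u x + v x)) = - (LINT x|lborel. \<phi> x *\<^sub>R ((g x + h x) $ i))"
    using assms(5,6) t
      s(2)[OF assms(1)] s(2)[OF assms(2)] s(1)[OF square_integrable_component[OF assms(3)]]
      s(1)[OF square_integrable_component[OF assms(4)]]
    by (simp add: weak_gradient_def scaleR_right_distrib)
qed

lemma weak_gradient_scaleR: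
  assumes "weak_gradient u g"
  shows "weak_gradient (\<lambda>x. c *\<^sub>R u x) (\<lambda>x. c *\<^sub>R g x)"
  unfolding weak_gradient_def
proof (intro allI impI)
  fix \<phi> :: "real^'a \<Rightarrow> real" and i assume t: "test_function \<phi>"
  have "(LINT x|lborel. partial_deriv i \<phi> x *\<^sub>R c *\<^sub>R u x) = c *\<^sub>R (LINT x|lborel. partial_deriv i \<phi> x *\<^sub>R u x)"
    by (subst scaleR_left_commute) (rule integral_scaleR_right)
  also have "\<dots> = - (c *\<^sub>R (LINT x|lborel. \<phi> x *\<^sub>R (g x $ i)))"
    using assms t by (simp only: weak_gradient_def scaleR_minus_right)
  also have "c *\<^sub>R (LINT x|lborel. \<phi> x *\<^sub>R (g x $ i)) = (LINT x|lborel. \<phi> x *\<^sub>R ((c *\<^sub>R g x) $ i))"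
    unfolding vector_scaleR_component
    by (subst integral_scaleR_right[symmetric], subst scaleR_left_commute) (rule refl)
  finally show "(LINT x|lborel. partial_deriv i \<phi> x *\<^sub>R c *\<^sub>R u x) =
      - (LINT x|lborel. \<phi> x *\<^sub>R ((c *\<^sub>R g x) $ i))" .
qed

lemma weak_gradient_cong:
  assumes "AE x in lborel. u x = v x" "square_integrable u" "square_integrable v"
  shows "weak_gradient u g \<longleftrightarrow> weak_gradient v g"
proof -
  have "(LINT x|lborel. partial_deriv i \<phi> x *\<^sub>R u x) = (LINT x|lborel. partial_deriv i \<phi> x *\<^sub>R v x)"
    if t: "test_function \<phi>" for i \<phi>
    using borel_measurable_integrable[OF test_integrable(2)[OF t assms(2)]]
      borel_measurable_integrable[OF test_integrable(2)[OF t assms(3)]]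
    by (rule integral_cong_AE) (use assms(1) in \<open>eventually_elim, simp\<close>)
  then show ?thesis by (auto simp: weak_gradient_def)
qed

lemma weak_gradient_unique:
  assumes "square_integrable g" "square_integrable h" "weak_gradient u g" "weak_gradient u h"
  shows "AE x in lborel. g x = h x"
proof -
  have "AE x in lborel. g x $ i - h x $ i = 0" for i
  proof (rule AE_zero_complex)
    have "square_integrable (\<lambda>x. g x $ i + (- 1) *\<^sub>R (h x $ i))"
      by (intro square_integrable_add square_integrable_scaleR square_integrable_component assms)
    then show "square_integrable (\<lambda>x. g x $ i - h x $ i)" by simp
    show "(LINT x|lborel. \<phi> x *\<^sub>R (g x $ i - h x $ i)) = 0" if t: "test_function \<phi>" for \<phi>
    proof -
      have "(LINT x|lborel. \<phi> x *\<^sub>R (g x $ i)) = (LINT x|lborel. \<phi> x *\<^sub>R (h x $ i))"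
        using assms(3)[unfolded weak_gradient_def, rule_format, OF t, of i]
          assms(4)[unfolded weak_gradient_def, rule_format, OF t, of i] by simp
      then show ?thesis
        using test_integrable(1)[OF t square_integrable_component[OF assms(1)]]
          test_integrable(1)[OF t square_integrable_component[OF assms(2)]]
        by (simp add: scaleR_right_diff_distrib)
    qed
  qed
  then have "AE x in lborel. \<forall>i\<in>UNIV. g x $ i - h x $ i = 0"
    by (intro AE_finite_allI) auto
  then show ?thesis by eventually_elim (simp add: vec_eq_iff)
qed

section \<open>The space $\Sigma(\mathbf{R}^N)$\<close>

text \<open>Functions that agree almost everywhere are identified. Every Lebesgue measurable function
  agrees almost everywhere with a Borel measurable one, so nothing is lost by working over
  \<^const>\<open>lborel\<close>. The dimension is \<open>N = CARD('n)\<close>.\<close>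

definition Sigma_rel :: "(real^'n::finite \<Rightarrow> complex) \<Rightarrow> (real^'n \<Rightarrow> complex) \<Rightarrow> bool" where
  "Sigma_rel u v \<longleftrightarrow> in_Sigma u \<and> in_Sigma v \<and> (AE x in lborel. u x = v x)"

lemma in_Sigma_zero: "in_Sigma (\<lambda>x. 0)"
  by (auto simp: in_Sigma_def H1_def weak_gradient_def square_integrable_zero intro!: exI[of _ "\<lambda>_. 0"])

lemma in_Sigma_add:
  assumes "in_Sigma u" "in_Sigma v"
  shows "in_Sigma (\<lambda>x. u x + v x)"
proof -
  obtain g h where *: "square_integrable g" "weak_gradient u g" "square_integrable h" "weak_gradient v h"
    using assms by (auto simp: in_Sigma_def H1_def)
  have **: "square_integrable u" "square_integrable v"
      "square_integrable (\<lambda>x. norm x *\<^sub>R u x)" "square_integrable (\<lambda>x. norm x *\<^sub>R v x)"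
    using assms by (auto simp: in_Sigma_def H1_def)
  have "square_integrable (\<lambda>x. u x + v x)" "square_integrable (\<lambda>x. norm x *\<^sub>R (u x + v x))"
    unfolding scaleR_right_distrib by (intro square_integrable_add **)+
  moreover have "square_integrable (\<lambda>x. g x + h x)"
    by (intro square_integrable_add *)
  moreover have "weak_gradient (\<lambda>x. u x + v x) (\<lambda>x. g x + h x)"
    by (intro weak_gradient_add * **)
  ultimately show ?thesis unfolding in_Sigma_def H1_def by (intro conjI exI)
qed

lemma in_Sigma_scaleR:
  assumes "in_Sigma u"
  shows "in_Sigma (\<lambda>x. c *\<^sub>R u x)"
proof -
  obtain g where *: "square_integrable g" "weak_gradient u g"
    using assms by (auto simp: in_Sigma_def H1_def)
  have **: "square_integrable u" "square_integrable (\<lambda>x. norm x *\<^sub>R u x)"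
    using assms by (auto simp: in_Sigma_def H1_def)
  have "(\<lambda>x. norm x *\<^sub>R c *\<^sub>R u x) = (\<lambda>x. c *\<^sub>R norm x *\<^sub>R u x)"
    by (simp add: fun_eq_iff mult.commute)
  then have "square_integrable (\<lambda>x. norm x *\<^sub>R c *\<^sub>R u x)"
    by (simp only: square_integrable_scaleR[OF **(2)])
  moreover have "square_integrable (\<lambda>x. c *\<^sub>R u x)" "square_integrable (\<lambda>x. c *\<^sub>R g x)"
    by (intro square_integrable_scaleR * **)+
  moreover have "weak_gradient (\<lambda>x. c *\<^sub>R u x) (\<lambda>x. c *\<^sub>R g x)"
    by (intro weak_gradient_scaleR *)
  ultimately show ?thesis unfolding in_Sigma_def H1_def by (intro conjI exI)
qed

quotient_type (overloaded) 'n Sigma_space =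
  "real^'n \<Rightarrow> complex" / partial: "Sigma_rel :: (real^'n::finite \<Rightarrow> complex) \<Rightarrow> _"
proof (rule part_equivpI)
  show "\<exists>u. Sigma_rel u u" using in_Sigma_zero by (auto simp: Sigma_rel_def)
  show "symp Sigma_rel" by (auto simp: Sigma_rel_def symp_def elim: eventually_mono)
  show "transp Sigma_rel" by (auto simp: Sigma_rel_def transp_def elim: eventually_elim2)
qed

text \<open>A representative of \<open>u\<close> and of its weak gradient, each determined almost everywhere.\<close>

definition sfun :: "'n::finite Sigma_space \<Rightarrow> real^'n \<Rightarrow> complex" where
  "sfun u = rep_Sigma_space u"

definition sgrad :: "'n::finite Sigma_space \<Rightarrow> real^'n \<Rightarrow> complex^'n" where
  "sgrad u = (SOME g. square_integrable g \<and> weak_gradient (sfun u) g)"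

lemma sfun_in_Sigma: "in_Sigma (sfun u)"
  using Quotient_rep_reflp[OF Quotient_Sigma_space] by (auto simp: sfun_def Sigma_rel_def)

lemma sfun_abs: "in_Sigma f \<Longrightarrow> AE x in lborel. sfun (abs_Sigma_space f) x = f x"
  using Quotient_rep_abs[OF Quotient_Sigma_space, of f] by (auto simp: sfun_def Sigma_rel_def)

lemma Sigma_space_eqI:
  assumes "AE x in lborel. sfun u x = sfun v x" shows "u = v"
  using Quotient_rel_rep[OF Quotient_Sigma_space, of u v] assms sfun_in_Sigma[of u] sfun_in_Sigma[of v]
  by (simp add: sfun_def Sigma_rel_def)

lemma sfun_square_integrable:
  "square_integrable (sfun u)" "square_integrable (\<lambda>x. norm x *\<^sub>R sfun u x)"
  using sfun_in_Sigma[of u] by (auto simp: in_Sigma_def H1_def)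

lemma sgrad: "square_integrable (sgrad u)" "weak_gradient (sfun u) (sgrad u)"
proof -
  have "\<exists>g. square_integrable g \<and> weak_gradient (sfun u) g"
    using sfun_in_Sigma[of u] by (auto simp: in_Sigma_def H1_def)
  from someI_ex[OF this] show "square_integrable (sgrad u)" "weak_gradient (sfun u) (sgrad u)"
    by (auto simp: sgrad_def)
qed

lemma sgrad_eqI:
  assumes "square_integrable f" "square_integrable g" "weak_gradient f g" "AE x in lborel. sfun u x = f x"
  shows "AE x in lborel. sgrad u x = g x"
proof (rule weak_gradient_unique)
  show "weak_gradient (sfun u) g"
    using weak_gradient_cong[OF assms(4) sfun_square_integrable(1) assms(1)] assms(3) by simp
qed (use assms sgrad in auto)

text \<open>The inner product below is the one inducing the norm of \<open>\<Sigma>\<close>; on \<^typ>\<open>complex\<close> and on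
  complex vectors, \<^const>\<open>inner\<close> is the real part of the Hermitian product.\<close>

instantiation Sigma_space :: (finite) real_inner
begin

definition zero_Sigma_space :: "'a Sigma_space" where
  "0 = abs_Sigma_space (\<lambda>x. 0)"

definition plus_Sigma_space :: "'a Sigma_space \<Rightarrow> 'a Sigma_space \<Rightarrow> 'a Sigma_space" where
  "u + v = abs_Sigma_space (\<lambda>x. sfun u x + sfun v x)"

definition scaleR_Sigma_space :: "real \<Rightarrow> 'a Sigma_space \<Rightarrow> 'a Sigma_space" where
  "c *\<^sub>R u = abs_Sigma_space (\<lambda>x. c *\<^sub>R sfun u x)"

definition uminus_Sigma_space :: "'a Sigma_space \<Rightarrow> 'a Sigma_space" where
  "- u = (- 1) *\<^sub>R u" for u :: "'a Sigma_space"

definition minus_Sigma_space :: "'a Sigma_space \<Rightarrow> 'a Sigma_space \<Rightarrow> 'a Sigma_space" where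
  "u - v = u + (- v)" for u v :: "'a Sigma_space"

definition norm_Sigma_space :: "'a Sigma_space \<Rightarrow> real" where
  "norm u = sqrt (LINT x|lborel. (norm (sgrad u x))\<^sup>2 + (norm x)\<^sup>2 * (cmod (sfun u x))\<^sup>2)"

definition inner_Sigma_space :: "'a Sigma_space \<Rightarrow> 'a Sigma_space \<Rightarrow> real" where
  "inner u v = (LINT x|lborel. inner (sgrad u x) (sgrad v x) + (norm x)\<^sup>2 * inner (sfun u x) (sfun v x))"

definition sgn_Sigma_space :: "'a Sigma_space \<Rightarrow> 'a Sigma_space" where
  "sgn u = inverse (norm u) *\<^sub>R u" for u :: "'a Sigma_space"

definition dist_Sigma_space :: "'a Sigma_space \<Rightarrow> 'a Sigma_space \<Rightarrow> real" where
  "dist u v = norm (u - v)" for u v :: "'a Sigma_space"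

definition uniformity_Sigma_space :: "('a Sigma_space \<times> 'a Sigma_space) filter" where
  "uniformity_Sigma_space = (INF e\<in>{0<..}. principal {(u, v). dist u v < e})"

definition open_Sigma_space :: "'a Sigma_space set \<Rightarrow> bool" where
  "open_Sigma_space U \<longleftrightarrow> (\<forall>u\<in>U. \<forall>\<^sub>F (u', v) in uniformity. u' = u \<longrightarrow> v \<in> U)"

lemma sfun_zero: "AE x in lborel. sfun (0 :: 'a Sigma_space) x = 0"
  unfolding zero_Sigma_space_def by (intro sfun_abs in_Sigma_zero)

lemma sfun_add: "AE x in lborel. sfun (u + v :: 'a Sigma_space) x = sfun u x + sfun v x"
  unfolding plus_Sigma_space_def by (intro sfun_abs in_Sigma_add sfun_in_Sigma)

lemma sfun_scaleR: "AE x in lborel. sfun (c *\<^sub>R u :: 'a Sigma_space) x = c *\<^sub>R sfun u x"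
  unfolding scaleR_Sigma_space_def by (intro sfun_abs in_Sigma_scaleR sfun_in_Sigma)

lemma sgrad_add: "AE x in lborel. sgrad (u + v :: 'a Sigma_space) x = sgrad u x + sgrad v x"
  by (rule sgrad_eqI[OF _ _ weak_gradient_add sfun_add])
     (intro square_integrable_add sfun_square_integrable sgrad)+

lemma sgrad_scaleR: "AE x in lborel. sgrad (c *\<^sub>R u :: 'a Sigma_space) x = c *\<^sub>R sgrad u x"
  by (rule sgrad_eqI[OF _ _ weak_gradient_scaleR sfun_scaleR])
     (intro square_integrable_scaleR sfun_square_integrable sgrad)+

lemma measurable_sfun [measurable]: "sfun (u :: 'a Sigma_space) \<in> borel_measurable borel"
  using square_integrableD(1)[OF sfun_square_integrable(1)[of u]] by simp

lemma measurable_sgrad [measurable]: "sgrad (u :: 'a Sigma_space) \<in> borel_measurable borel"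
  using square_integrableD(1)[OF sgrad(1)[of u]] by simp

lemma inner_Sigma_integrable:
  "integrable lborel (\<lambda>x. inner (sgrad u x) (sgrad v x) + (norm x)\<^sup>2 * inner (sfun u x) (sfun v x))"
  for u v :: "'a Sigma_space"
proof (rule Bochner_Integration.integrable_add)
  show "integrable lborel (\<lambda>x. inner (sgrad u x) (sgrad v x))"
    by (rule square_integrable_bilinear[OF sgrad(1)[of u] sgrad(1)[of v]])
       (auto simp: Cauchy_Schwarz_ineq2)
  show "integrable lborel (\<lambda>x. (norm x)\<^sup>2 * inner (sfun u x) (sfun v x))"
  proof (rule square_integrable_bilinear[OF sfun_square_integrable(2)[of u] sfun_square_integrable(2)[of v]])
    fix x :: "real^'a"
    have "norm ((norm x)\<^sup>2 * inner (sfun u x) (sfun v x)) = (norm x)\<^sup>2 * \<bar>inner (sfun u x) (sfun v x)\<bar>"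
      by (simp add: abs_mult)
    also have "\<dots> \<le> (norm x)\<^sup>2 * (norm (sfun u x) * norm (sfun v x))"
      by (intro mult_left_mono Cauchy_Schwarz_ineq2) auto
    finally show "norm ((norm x)\<^sup>2 * inner (sfun u x) (sfun v x))
        \<le> norm (norm x *\<^sub>R sfun u x) * norm (norm x *\<^sub>R sfun v x)"
      by (simp add: power2_eq_square mult_ac)
  qed measurable
qed

instance
proof
  fix u v w :: "'a Sigma_space" and a b :: real
  show "u - v = u + - v" by (simp add: minus_Sigma_space_def)
  show "u + v + w = u + (v + w)"
    by (rule Sigma_space_eqI)
       (use sfun_add[of "u + v" w] sfun_add[of u v] sfun_add[of u "v + w"] sfun_add[of v w] in
          \<open>eventually_elim, simp\<close>)
  show "u + v = v + u"
    by (rule Sigma_space_eqI) (use sfun_add[of u v] sfun_add[of v u] in \<open>eventually_elim, simp\<close>)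
  show "0 + u = u"
    by (rule Sigma_space_eqI) (use sfun_add[of 0 u] sfun_zero in \<open>eventually_elim, simp\<close>)
  show "- u + u = 0"
    unfolding uminus_Sigma_space_def
    by (rule Sigma_space_eqI)
       (use sfun_add[of "(- 1) *\<^sub>R u" u] sfun_scaleR[of "- 1" u] sfun_zero in \<open>eventually_elim, simp\<close>)
  show "a *\<^sub>R (u + v) = a *\<^sub>R u + a *\<^sub>R v"
    by (rule Sigma_space_eqI)
       (use sfun_scaleR[of a "u + v"] sfun_add[of u v] sfun_add[of "a *\<^sub>R u" "a *\<^sub>R v"]
          sfun_scaleR[of a u] sfun_scaleR[of a v] in \<open>eventually_elim, simp add: algebra_simps\<close>)
  show "(a + b) *\<^sub>R u = a *\<^sub>R u + b *\<^sub>R u"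
    by (rule Sigma_space_eqI)
       (use sfun_scaleR[of "a + b" u] sfun_add[of "a *\<^sub>R u" "b *\<^sub>R u"]
          sfun_scaleR[of a u] sfun_scaleR[of b u] in \<open>eventually_elim, simp add: algebra_simps\<close>)
  show "a *\<^sub>R b *\<^sub>R u = (a * b) *\<^sub>R u"
    by (rule Sigma_space_eqI)
       (use sfun_scaleR[of a "b *\<^sub>R u"] sfun_scaleR[of b u] sfun_scaleR[of "a * b" u] in
          \<open>eventually_elim, simp\<close>)
  show "1 *\<^sub>R u = u"
    by (rule Sigma_space_eqI) (use sfun_scaleR[of 1 u] in \<open>eventually_elim, simp\<close>)
  show "sgn u = inverse (norm u) *\<^sub>R u" by (rule sgn_Sigma_space_def)
  show "dist u v = norm (u - v)" by (rule dist_Sigma_space_def)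
  show "(uniformity :: ('a Sigma_space \<times> 'a Sigma_space) filter) =
      (INF e\<in>{0<..}. principal {(u, v). dist u v < e})"
    by (rule uniformity_Sigma_space_def)
  show "open U \<longleftrightarrow> (\<forall>u\<in>U. \<forall>\<^sub>F (u', v) in uniformity. u' = u \<longrightarrow> v \<in> U)" for U :: "'a Sigma_space set"
    by (rule open_Sigma_space_def)
  show "inner u v = inner v u"
    by (simp add: inner_Sigma_space_def inner_commute)
  show "inner (u + v) w = inner u w + inner v w"
  proof -
    have "inner (u + v) w = (LINT x|lborel.
        (inner (sgrad u x) (sgrad w x) + (norm x)\<^sup>2 * inner (sfun u x) (sfun w x)) +
        (inner (sgrad v x) (sgrad w x) + (norm x)\<^sup>2 * inner (sfun v x) (sfun w x)))"
      unfolding inner_Sigma_space_def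
      by (rule integral_cong_AE, measurable)
         (use sfun_add[of u v] sgrad_add[of u v] in \<open>eventually_elim, simp add: inner_add_left algebra_simps\<close>)
    then show ?thesis
      using inner_Sigma_integrable[of u w] inner_Sigma_integrable[of v w]
      by (simp add: inner_Sigma_space_def)
  qed
  show "inner (a *\<^sub>R u) v = a * inner u v"
  proof -
    have "inner (a *\<^sub>R u) v = (LINT x|lborel.
        a * (inner (sgrad u x) (sgrad v x) + (norm x)\<^sup>2 * inner (sfun u x) (sfun v x)))"
      unfolding inner_Sigma_space_def
      by (rule integral_cong_AE, measurable)
         (use sfun_scaleR[of a u] sgrad_scaleR[of a u] in \<open>eventually_elim, simp add: algebra_simps\<close>)
    then show ?thesis by (simp add: inner_Sigma_space_def)
  qed
  show nn: "0 \<le> inner u u"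
    unfolding inner_Sigma_space_def by (intro integral_nonneg_AE AE_I2) simp
  show "norm u = sqrt (inner u u)"
    by (simp add: norm_Sigma_space_def inner_Sigma_space_def power2_norm_eq_inner)
  show "inner u u = 0 \<longleftrightarrow> u = 0"
  proof
    assume "inner u u = 0"
    then have "AE x in lborel. inner (sgrad u x) (sgrad u x) + (norm x)\<^sup>2 * inner (sfun u x) (sfun u x) = 0"
      unfolding inner_Sigma_space_def
      by (subst (asm) integral_nonneg_eq_0_iff_AE[OF inner_Sigma_integrable]) auto
    moreover have "AE x in lborel. x \<noteq> (0 :: real^'a)"
      by (rule AE_lborel_singleton)
    ultimately have "AE x in lborel. sfun u x = 0"
      by eventually_elim (smt (verit) inner_ge_zero inner_eq_zero_iff mult_eq_0_iff
          norm_eq_zero power_eq_0_iff zero_le_mult_iff zero_le_power2)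
    with sfun_zero have "AE x in lborel. sfun u x = sfun 0 x"
      by eventually_elim simp
    then show "u = 0" by (rule Sigma_space_eqI)
  next
    assume "u = 0"
    then have z: "AE x in lborel. sfun u x = 0" using sfun_zero by simp
    moreover have "AE x in lborel. sgrad u x = 0"
      by (rule sgrad_eqI[OF square_integrable_zero square_integrable_zero _ z])
         (simp add: weak_gradient_def)
    ultimately have "AE x in lborel. inner (sgrad u x) (sgrad u x) + (norm x)\<^sup>2 * inner (sfun u x) (sfun u x) = 0"
      by eventually_elim simp
    then show "inner u u = 0"
      unfolding inner_Sigma_space_def by (rule integral_eq_zero_AE)
  qed
qed

end

section \<open>The energy functional\<close>

text \<open>Since \<^term>\<open>ln 0 = (0::real)\<close>, the conventions \<open>z Log |z|\<^sup>2 = 0\<close> and \<open>|z|\<^sup>2 Log |z|\<^sup>2 = 0\<close>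
  at \<open>z = 0\<close> hold automatically.\<close>

definition energy :: "real \<Rightarrow> 'n::finite Sigma_space \<Rightarrow> real" where
  "energy \<gamma> u =
     1 / 2 * (LINT x|lborel. (norm (sgrad u x))\<^sup>2)
     + \<gamma> * (\<gamma> - 1) / 2 * (LINT x|lborel. (norm x)\<^sup>2 * (cmod (sfun u x))\<^sup>2)
     - 1 / 2 * (LINT x|lborel. (cmod (sfun u x))\<^sup>2 * ln ((cmod (sfun u x))\<^sup>2))"

definition energy_deriv_integrand ::
    "real \<Rightarrow> 'n::finite Sigma_space \<Rightarrow> 'n Sigma_space \<Rightarrow> real^'n \<Rightarrow> complex" where
  "energy_deriv_integrand \<gamma> u v x =
     (\<Sum>i\<in>UNIV. sgrad u x $ i * cnj (sgrad v x $ i))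
     + of_real (\<gamma> * (\<gamma> - 1) * (norm x)\<^sup>2) * sfun u x * cnj (sfun v x)
     - sfun u x * of_real (ln ((cmod (sfun u x))\<^sup>2)) * cnj (sfun v x)
     - sfun u x * cnj (sfun v x)"

text \<open>The pairing of \<open>- \<Delta>u + \<gamma>(\<gamma> - 1)|x|\<^sup>2 u - u Log |u|\<^sup>2 - u\<close> with \<open>v\<close>.\<close>

definition energy_deriv_pairing :: "real \<Rightarrow> 'n::finite Sigma_space \<Rightarrow> 'n Sigma_space \<Rightarrow> real" where
  "energy_deriv_pairing \<gamma> u v = Re (LINT x|lborel. energy_deriv_integrand \<gamma> u v x)"

end

theory Submission
  imports Defs
begin

text \<open>The quadratic part of the energy is a bounded quadratic form, so everything rests on the
  logarithmic part. Its integrand has gradient \<open>f(z) = z Log |z|\<^sup>2 + z\<close>, for which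
  \<open>|f(a + w) - f(a)| \<le> C (|w|\<^sup>1\<^sup>-\<^sup>\<epsilon> + |w|\<^sup>1\<^sup>+\<^sup>\<epsilon> + |a|\<^sup>\<epsilon> |w|)\<close>. Multiplying by \<open>|v|\<close> and integrating,
  the first term is controlled by the weight \<open>|x|\<close>, the others by an \<open>L\<^sup>2\<^sup>+\<^sup>\<epsilon>\<close> bound on the unit ball of
  \<open>\<Sigma>\<close>; by homogeneity this gives a Taylor remainder of order \<open>\<parallel>w\<parallel>\<^sup>2\<^sup>-\<^sup>\<epsilon>\<close> and a locally Hoelder
  continuous derivative.

  Instead of the Sobolev embedding, the \<open>L\<^sup>2\<^sup>+\<^sup>\<epsilon>\<close> bound comes from the translation estimate
  \<open>\<parallel>u(\<cdot> + h) - u\<parallel> \<le> |h| \<parallel>\<nabla>u\<parallel>\<close>: averaging it over \<open>|h| < \<delta>\<close> bounds the mass of \<open>|u|\<^sup>2\<close> on a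
  set \<open>A\<close> by \<open>2 \<delta>\<^sup>2 \<parallel>\<nabla>u\<parallel>\<^sup>2 + 2 |A| / |B\<^sub>\<delta>| \<parallel>u\<parallel>\<^sup>2\<close>. Taking \<open>A\<close> to be a small ball shows that the norm of \<open>\<Sigma>\<close>
  controls the \<open>L\<^sup>2\<close> norm, and taking \<open>A = {|u| > \<lambda>}\<close> gives decay of the tails in \<open>\<lambda>\<close>. We use
  \<open>\<epsilon> = 1 / (2 N)\<close>.\<close>

section \<open>Translation estimate from the weak gradient\<close>

lemma partial_deriv_shift:
  fixes f :: "real^'n::finite \<Rightarrow> real"
  assumes "f differentiable_on UNIV"
  shows "partial_deriv i (\<lambda>x. f (x + h)) = (\<lambda>x. partial_deriv i f (x + h))"
proof
  fix x :: "real^'n"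
  have "((\<lambda>x. x + h) has_derivative (\<lambda>y. y)) (at x)"
    by (auto intro!: derivative_eq_intros)
  from has_derivative_compose[OF this differentiable_has_derivative[OF assms]]
  show "partial_deriv i (\<lambda>x. f (x + h)) x = partial_deriv i f (x + h)"
    unfolding partial_deriv_def[of i f] by (rule partial_derivI)
qed

lemma Ck_shift:
  fixes f :: "real^'n::finite \<Rightarrow> real"
  shows "Ck k f \<Longrightarrow> Ck k (\<lambda>x. f (x + h))"
proof (induction k arbitrary: f)
  case 0
  then show ?case
    by (auto intro!: continuous_intros continuous_on_compose2[of UNIV f])
next
  case (Suc k)
  then have d: "f differentiable_on UNIV" by simp
  have "(\<lambda>x. f (x + h)) differentiable_on UNIV"
    unfolding differentiable_on_def
  proof
    fix x :: "real^'n"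
    have "((\<lambda>x. x + h) has_derivative (\<lambda>y. y)) (at x)"
      by (auto intro!: derivative_eq_intros)
    from differentiableI[OF has_derivative_compose[OF this differentiable_has_derivative[OF d]]]
    show "(\<lambda>x. f (x + h)) differentiable at x" .
  qed
  with Suc show ?case by (simp add: partial_deriv_shift[OF d])
qed

lemma test_function_shift:
  fixes \<phi> :: "real^'n::finite \<Rightarrow> real"
  assumes "test_function \<phi>"
  shows "test_function (\<lambda>x. \<phi> (x + h))"
proof -
  have "{x. \<phi> (x + h) \<noteq> 0} = (\<lambda>x. - h + x) ` {x. \<phi> x \<noteq> 0}"
    by (force simp: image_iff)
  then show ?thesis
    using assms by (auto simp: test_function_def bounded_translation_minus intro: Ck_shift)
qed

lemma test_function_differentiable: "test_function \<phi> \<Longrightarrow> \<phi> differentiable_on UNIV"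
  unfolding test_function_def using Ck.simps(2) by blast

text \<open>Expands the differential in coordinate directions, the only ones that
  \<open>weak_gradient\<close> speaks about.\<close>

lemma test_function_has_derivative:
  fixes \<phi> :: "real^'n::finite \<Rightarrow> real"
  assumes "test_function \<phi>"
  shows "(\<phi> has_derivative (\<lambda>h. \<Sum>i\<in>UNIV. h $ i * partial_deriv i \<phi> x)) (at x)"
proof -
  note d = differentiable_has_derivative[OF test_function_differentiable[OF assms], of x]
  interpret linear "frechet_derivative \<phi> (at x)"
    using d by (rule has_derivative_linear)
  have "frechet_derivative \<phi> (at x) h = (\<Sum>i\<in>UNIV. h $ i * partial_deriv i \<phi> x)" for h
  proof -
    have "h = (\<Sum>i\<in>UNIV. h $ i *\<^sub>R axis i 1)"
      using basis_expansion[of h] by (simp add: scalar_mult_eq_scaleR)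
    then have "frechet_derivative \<phi> (at x) h = frechet_derivative \<phi> (at x) (\<Sum>i\<in>UNIV. h $ i *\<^sub>R axis i 1)"
      by simp
    also have "\<dots> = (\<Sum>i\<in>UNIV. h $ i * partial_deriv i \<phi> x)"
      by (simp add: sum scale partial_deriv_def del: vector_scaleR_component)
    finally show ?thesis .
  qed
  then have "frechet_derivative \<phi> (at x) = (\<lambda>h. \<Sum>i\<in>UNIV. h $ i * partial_deriv i \<phi> x)"
    by (rule ext)
  with d show ?thesis by (rule subst[rotated])
qed

text \<open>The defining identities of the weak gradient, combined with the coefficients of
  \<open>h\<close>; integrability of each product lets the finite sum pass through the
  integral.\<close>

lemma weak_gradient_directional:
  fixes u :: "real^'n::finite \<Rightarrow> complex"
  assumes "test_function \<phi>" "square_integrable u" "square_integrable g" "weak_gradient u g"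
  shows "(LINT x|lborel. (\<Sum>i\<in>UNIV. h $ i * partial_deriv i \<phi> x) *\<^sub>R u x)
    = - (LINT x|lborel. \<phi> x *\<^sub>R (\<Sum>i\<in>UNIV. h $ i *\<^sub>R (g x $ i)))"
proof -
  have "(LINT x|lborel. (\<Sum>i\<in>UNIV. h $ i * partial_deriv i \<phi> x) *\<^sub>R u x)
    = (LINT x|lborel. (\<Sum>i\<in>UNIV. h $ i *\<^sub>R (partial_deriv i \<phi> x *\<^sub>R u x)))"
    by (simp add: scaleR_left.sum)
  also have "\<dots> = (\<Sum>i\<in>UNIV. h $ i *\<^sub>R (LINT x|lborel. partial_deriv i \<phi> x *\<^sub>R u x))"
    using test_integrable(2)[OF assms(1,2)] 
    by (subst Bochner_Integration.integral_sum) (auto simp del: scaleR_scaleR)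
  also have "\<dots> = (\<Sum>i\<in>UNIV. h $ i *\<^sub>R (- (LINT x|lborel. \<phi> x *\<^sub>R (g x $ i))))"
    using assms(1,4) by (simp add: weak_gradient_def)
  also have "\<dots> = - (\<Sum>i\<in>UNIV. h $ i *\<^sub>R (LINT x|lborel. \<phi> x *\<^sub>R (g x $ i)))"
    by (simp add: sum_negf)
  also have "(\<Sum>i\<in>UNIV. h $ i *\<^sub>R (LINT x|lborel. \<phi> x *\<^sub>R (g x $ i)))
     = (LINT x|lborel. (\<Sum>i\<in>UNIV. h $ i *\<^sub>R (\<phi> x *\<^sub>R (g x $ i))))"
    using test_integrable(1)[OF assms(1) square_integrable_component[OF assms(3)]]
    by (subst Bochner_Integration.integral_sum) (auto simp del: scaleR_scaleR)
  also have "\<dots> = (LINT x|lborel. \<phi> x *\<^sub>R (\<Sum>i\<in>UNIV. h $ i *\<^sub>R (g x $ i)))"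
    by (simp add: scaleR_right.sum mult.commute)
  finally show ?thesis .
qed

lemma norm_directional_le:
  fixes h :: "real^'n::finite" and g :: "complex^'n"
  shows "norm (\<Sum>i\<in>UNIV. h $ i *\<^sub>R (g $ i)) \<le> norm h * norm g"
proof -
  have "norm (\<Sum>i\<in>UNIV. h $ i *\<^sub>R (g $ i)) \<le> (\<Sum>i\<in>UNIV. \<bar>h $ i\<bar> * \<bar>norm (g $ i)\<bar>)"
    by (rule order_trans[OF norm_sum]) simp
  also have "\<dots> \<le> L2_set (\<lambda>i. h $ i) UNIV * L2_set (\<lambda>i. norm (g $ i)) UNIV"
    by (rule L2_set_mult_ineq)
  finally show ?thesis by (simp add: norm_vec_def L2_set_def)
qed

section \<open>Translation invariance and averages along segments\<close>

lemma nn_integral_lborel_shift: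
  fixes f :: "'a::euclidean_space \<Rightarrow> ennreal"
  assumes [measurable]: "f \<in> borel_measurable borel"
  shows "(\<integral>\<^sup>+x. f (x + c) \<partial>lborel) = (\<integral>\<^sup>+x. f x \<partial>lborel)"
proof -
  have "(\<integral>\<^sup>+x. f x \<partial>lborel) = (\<integral>\<^sup>+x. f x \<partial>distr lborel borel ((+) c))"
    by (simp add: lborel_distr_plus)
  also have "\<dots> = (\<integral>\<^sup>+x. f (x + c) \<partial>lborel)"
    by (subst nn_integral_distr) (simp_all add: add.commute)
  finally show ?thesis by simp
qed

lemma lborel_integral_shift:
  fixes f :: "'a::euclidean_space \<Rightarrow> 'b::{banach,second_countable_topology}"
  assumes [measurable]: "f \<in> borel_measurable borel"
  shows "(LINT x|lborel. f (x + c)) = (LINT x|lborel. f x)"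
proof -
  have "(LINT x|lborel. f x) = (LINT x|distr lborel borel ((+) c). f x)"
    by (simp add: lborel_distr_plus)
  also have "\<dots> = (LINT x|lborel. f (x + c))"
    by (subst integral_distr) (simp_all add: add.commute)
  finally show ?thesis by simp
qed

lemma square_integrable_iff_nn_integral:
  fixes f :: "real^'n::finite \<Rightarrow> 'b::{banach,second_countable_topology}"
  shows "square_integrable f \<longleftrightarrow>
    f \<in> borel_measurable borel \<and> (\<integral>\<^sup>+x. ennreal ((norm (f x))\<^sup>2) \<partial>lborel) < \<infinity>"
  by (auto simp: square_integrable_def integrable_iff_bounded)

lemma square_integrable_shift:
  fixes f :: "real^'n::finite \<Rightarrow> 'b::{banach,second_countable_topology}"
  assumes "square_integrable f"
  shows "square_integrable (\<lambda>x. f (x + c))"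
proof -
  have [measurable]: "f \<in> borel_measurable borel" using assms by (simp add: square_integrable_def)
  show ?thesis
    using assms nn_integral_lborel_shift[of "\<lambda>x. ennreal ((norm (f x))\<^sup>2)" c]
    by (simp add: square_integrable_iff_nn_integral)
qed

text \<open>Supplies the hypothesis of Fubini's theorem when the segment parameter \<open>t\<close>
  is exchanged with the space variable. By Tonelli it suffices to integrate in \<open>x\<close>
  first, and translation invariance makes the resulting bound independent of \<open>t\<close> in the
  unit interval.\<close>

lemma integrable_pair_shift:
  fixes f :: "real^'n::finite \<Rightarrow> 'b::{banach,second_countable_topology}"
    and k :: "real^'n \<Rightarrow> 'c::{banach,second_countable_topology}"
    and p :: "real \<times> (real^'n) \<Rightarrow> 'd::{banach,second_countable_topology}"
  assumes f: "square_integrable f" and k: "square_integrable k"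
    and [measurable]: "p \<in> borel_measurable (lborel \<Otimes>\<^sub>M lborel)"
    and p: "\<And>t x. norm (p (t, x)) \<le> indicator {0..1} t * (norm (f (x + t *\<^sub>R h)) * norm (k x))"
  shows "integrable (lborel \<Otimes>\<^sub>M lborel) p"
proof (rule integrableI_bounded)
  have [measurable]: "f \<in> borel_measurable borel" "k \<in> borel_measurable borel"
    using f k by (simp_all add: square_integrable_def)
  let ?F = "\<integral>\<^sup>+x. ennreal ((norm (f x))\<^sup>2) \<partial>lborel" and ?K = "\<integral>\<^sup>+x. ennreal ((norm (k x))\<^sup>2) \<partial>lborel"
  have "(\<integral>\<^sup>+z. ennreal (norm (p z)) \<partial>(lborel \<Otimes>\<^sub>M lborel)) = (\<integral>\<^sup>+t. \<integral>\<^sup>+x. ennreal (norm (p (t, x))) \<partial>lborel \<partial>lborel)"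
    by (subst lborel.nn_integral_fst) simp_all
  also have "\<dots> \<le> (\<integral>\<^sup>+t. indicator {0..1} t * (?F + ?K) \<partial>(lborel :: real measure))"
  proof (rule nn_integral_mono)
    fix t :: real
    have "(\<integral>\<^sup>+x. ennreal (norm (p (t, x))) \<partial>lborel) \<le>
        (\<integral>\<^sup>+x. indicator {0..1} t * (ennreal ((norm (f (x + t *\<^sub>R h)))\<^sup>2) + ennreal ((norm (k x))\<^sup>2)) \<partial>lborel)"
    proof (rule nn_integral_mono)
      fix x
      have "norm (f (x + t *\<^sub>R h)) * norm (k x) \<le> (norm (f (x + t *\<^sub>R h)))\<^sup>2 + (norm (k x))\<^sup>2"
        using sum_squares_bound[of "norm (f (x + t *\<^sub>R h))" "norm (k x)"]
          mult_nonneg_nonneg[OF norm_ge_zero[of "f (x + t *\<^sub>R h)"] norm_ge_zero[of "k x"]]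
        by linarith
      then have "ennreal (norm (p (t, x))) \<le> ennreal (indicator {0..1} t * ((norm (f (x + t *\<^sub>R h)))\<^sup>2 + (norm (k x))\<^sup>2))"
        by (intro ennreal_leI order_trans[OF p] mult_left_mono) auto
      then show "ennreal (norm (p (t, x))) \<le> indicator {0..1} t * (ennreal ((norm (f (x + t *\<^sub>R h)))\<^sup>2) + ennreal ((norm (k x))\<^sup>2))"
        by (auto simp: indicator_def simp flip: ennreal_plus)
    qed
    also have "\<dots> = indicator {0..1} t * (?F + ?K)"
      using nn_integral_lborel_shift[of "\<lambda>x. ennreal ((norm (f x))\<^sup>2)" "t *\<^sub>R h"]
      by (simp add: nn_integral_cmult nn_integral_add)
    finally show "(\<integral>\<^sup>+x. ennreal (norm (p (t, x))) \<partial>lborel) \<le> indicator {0..1} t * (?F + ?K)" .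
  qed
  also have "\<dots> = ?F + ?K"
    by (simp add: nn_integral_multc)
  also have "\<dots> < \<infinity>"
    using f k by (simp add: square_integrable_iff_nn_integral)
  finally show "(\<integral>\<^sup>+z. ennreal (norm (p z)) \<partial>(lborel \<Otimes>\<^sub>M lborel)) < \<infinity>" .
qed simp

text \<open>Jensen's inequality for the square, obtained from Cauchy-Schwarz in \<open>t\<close>;
  then Tonelli and translation invariance remove the shift.\<close>

lemma nn_integral_segment_average_le:
  fixes d :: "real^'n::finite \<Rightarrow> 'b::{banach,second_countable_topology}"
  assumes [measurable]: "d \<in> borel_measurable borel"
  shows "(\<integral>\<^sup>+y. ennreal ((norm (LINT t|lborel. indicator {0..1} t *\<^sub>R d (y + t *\<^sub>R h)))\<^sup>2) \<partial>lborel)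
    \<le> (\<integral>\<^sup>+y. ennreal ((norm (d y))\<^sup>2) \<partial>lborel)"
proof -
  have "ennreal ((norm (LINT t|lborel. indicator {0..1} t *\<^sub>R d (y + t *\<^sub>R h)))\<^sup>2)
      \<le> (\<integral>\<^sup>+t. indicator {0..1} t * ennreal ((norm (d (y + t *\<^sub>R h)))\<^sup>2) \<partial>lborel)" for y
  proof (cases "integrable lborel (\<lambda>t. indicator {0..1} t *\<^sub>R d (y + t *\<^sub>R h))")
    case True
    have "ennreal (norm (LINT t|lborel. indicator {0..1} t *\<^sub>R d (y + t *\<^sub>R h)))
       \<le> (\<integral>\<^sup>+t. ennreal (norm (indicator {0..1} t *\<^sub>R d (y + t *\<^sub>R h))) \<partial>lborel)"
      by (rule integral_norm_bound_ennreal[OF True])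
    \<comment> \<open>The indicator is written twice so that Cauchy-Schwarz has a second factor; its
      square integrates to 1, the length of the interval.\<close>
    also have "\<dots> = (\<integral>\<^sup>+t. (indicator {0..1} t * ennreal (norm (d (y + t *\<^sub>R h)))) * indicator {0..1} t \<partial>lborel)"
      by (intro nn_integral_cong) (auto simp: indicator_def)
    finally have "(ennreal (norm (LINT t|lborel. indicator {0..1} t *\<^sub>R d (y + t *\<^sub>R h))))\<^sup>2
       \<le> (\<integral>\<^sup>+t. (indicator {0..1} t * ennreal (norm (d (y + t *\<^sub>R h)))) * indicator {0..1} t \<partial>lborel)\<^sup>2"
      by (rule power_mono) simp
    also have "\<dots> \<le> (\<integral>\<^sup>+t. (indicator {0..1} t * ennreal (norm (d (y + t *\<^sub>R h))))\<^sup>2 \<partial>lborel)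
         * (\<integral>\<^sup>+t. (indicator {0..1} t)\<^sup>2 \<partial>(lborel :: real measure))"
      by (rule Cauchy_Schwarz_nn_integral) measurable
    also have "(\<integral>\<^sup>+t. (indicator {0..1} t)\<^sup>2 \<partial>(lborel :: real measure)) = (\<integral>\<^sup>+t. indicator {0..1} t \<partial>(lborel :: real measure))"
      by (intro nn_integral_cong) (auto simp: indicator_def)
    also have "\<dots> = 1" by simp
    also have "(\<integral>\<^sup>+t. (indicator {0..1} t * ennreal (norm (d (y + t *\<^sub>R h))))\<^sup>2 \<partial>lborel)
       = (\<integral>\<^sup>+t. indicator {0..1} t * ennreal ((norm (d (y + t *\<^sub>R h)))\<^sup>2) \<partial>lborel)"
      by (intro nn_integral_cong) (auto simp: indicator_def ennreal_power)
    finally show ?thesis by (simp add: ennreal_power)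
  next
    \<comment> \<open>The Bochner integral is then 0 by convention, so the left-hand side
      vanishes.\<close>
    case False
    then show ?thesis by (simp add: not_integrable_integral_eq)
  qed
  then have "(\<integral>\<^sup>+y. ennreal ((norm (LINT t|lborel. indicator {0..1} t *\<^sub>R d (y + t *\<^sub>R h)))\<^sup>2) \<partial>lborel)
    \<le> (\<integral>\<^sup>+y. \<integral>\<^sup>+t. indicator {0..1} t * ennreal ((norm (d (y + t *\<^sub>R h)))\<^sup>2) \<partial>lborel \<partial>lborel)"
    by (intro nn_integral_mono)
  also have "\<dots> = (\<integral>\<^sup>+t. \<integral>\<^sup>+y. indicator {0..1} t * ennreal ((norm (d (y + t *\<^sub>R h)))\<^sup>2) \<partial>lborel \<partial>lborel)"
    by (rule lborel_pair.Fubini') measurable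
  also have "\<dots> = (\<integral>\<^sup>+t. indicator {0..1} t * (\<integral>\<^sup>+y. ennreal ((norm (d y))\<^sup>2) \<partial>lborel) \<partial>(lborel :: real measure))"
    using nn_integral_lborel_shift[of "\<lambda>x. ennreal ((norm (d x))\<^sup>2)"]
    by (simp add: nn_integral_cmult)
  also have "\<dots> = (\<integral>\<^sup>+y. ennreal ((norm (d y))\<^sup>2) \<partial>lborel)"
    by (simp add: nn_integral_multc)
  finally show ?thesis .
qed

text \<open>Fundamental theorem of calculus along the segment from \<open>x\<close> to
  \<open>x - h\<close>, with antiderivative \<open>- \<phi> (x - t *\<^sub>R h)\<close> in
  \<open>t\<close>.\<close>

lemma test_function_segment_integral:
  fixes \<phi> :: "real^'n::finite \<Rightarrow> real"
  assumes "test_function \<phi>"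
  shows "(LINT t|lborel. indicator {0..1} t *\<^sub>R (\<Sum>i\<in>UNIV. h $ i * partial_deriv i \<phi> (x - t *\<^sub>R h)))
    = \<phi> x - \<phi> (x - h)"
proof -
  have "(LINT t|lborel. indicator {0..1} t *\<^sub>R (\<Sum>i\<in>UNIV. h $ i * partial_deriv i \<phi> (x - t *\<^sub>R h)))
     = - \<phi> (x - 1 *\<^sub>R h) - (- \<phi> (x - 0 *\<^sub>R h))"
  proof (rule integral_FTC_Icc)
    fix t :: real
    have "((\<lambda>t. x - t *\<^sub>R h) has_derivative (\<lambda>s. - (s *\<^sub>R h))) (at t within {0..1})"
      by (auto intro!: derivative_eq_intros)
    from has_derivative_minus[OF has_derivative_compose[OF this test_function_has_derivative[OF assms]]]
    show "((\<lambda>t. - \<phi> (x - t *\<^sub>R h)) has_vector_derivative (\<Sum>i\<in>UNIV. h $ i * partial_deriv i \<phi> (x - t *\<^sub>R h))) (at t within {0..1})"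
      by (simp add: has_vector_derivative_def sum_negf sum_distrib_left mult_ac)
  next
    have "Ck (Suc 0) \<phi>" using assms unfolding test_function_def by blast
    then have c: "continuous_on UNIV (partial_deriv i \<phi>)" for i by simp
    show "continuous_on {0..1} (\<lambda>t. \<Sum>i\<in>UNIV. h $ i * partial_deriv i \<phi> (x - t *\<^sub>R h))"
      by (intro continuous_intros continuous_on_compose2[OF c]) auto
  qed simp
  then show ?thesis by simp
qed

text \<open>Tested against \<open>\<phi>\<close>, both sides agree by Fubini, because the segment average of the directional
  derivative of \<open>\<phi>\<close> is a difference of translates of \<open>\<phi>\<close>.\<close>

lemma translation_identity:
  fixes u :: "real^'n::finite \<Rightarrow> complex" and g :: "real^'n \<Rightarrow> complex^'n" and h :: "real^'n"
  defines "d \<equiv> \<lambda>y. \<Sum>i\<in>UNIV. h $ i *\<^sub>R (g y $ i)"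
  assumes u: "square_integrable u" and g: "square_integrable g" and ug: "weak_gradient u g"
  shows "AE y in lborel. u (y + h) - u y = (LINT t|lborel. indicator {0..1} t *\<^sub>R d (y + t *\<^sub>R h))"
proof -
  have [measurable]: "u \<in> borel_measurable borel" "g \<in> borel_measurable borel"
    using u g by (simp_all add: square_integrable_def)
  have "(\<lambda>y. g y $ i) \<in> borel_measurable borel" for i
    using square_integrableD(1)[OF square_integrable_component[OF g]] by simp
  then have dm[measurable]: "d \<in> borel_measurable borel"
    unfolding d_def by measurable
  have d: "square_integrable d"
  proof -
    have "integrable lborel (\<lambda>y. (norm (d y))\<^sup>2)"
    proof (rule Bochner_Integration.integrable_bound)
      show "integrable lborel (\<lambda>y. (norm h)\<^sup>2 * (norm (g y))\<^sup>2)"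
        using g by (simp add: square_integrable_def)
      show "AE y in lborel. norm ((norm (d y))\<^sup>2) \<le> norm ((norm h)\<^sup>2 * (norm (g y))\<^sup>2)"
        by (auto simp: d_def simp flip: power_mult_distrib intro!: power_mono norm_directional_le)
    qed measurable
    then show ?thesis by (simp add: square_integrable_def)
  qed
  define D where "D y = (LINT t|lborel. indicator {0..1} t *\<^sub>R d (y + t *\<^sub>R h))" for y
  have [measurable]: "D \<in> borel_measurable borel" unfolding D_def by measurable
  have D: "square_integrable D"
    using d nn_integral_segment_average_le[OF dm, of h]
    by (auto simp: square_integrable_iff_nn_integral D_def intro: le_less_trans)
  have uh: "square_integrable (\<lambda>y. u (y + h))" by (rule square_integrable_shift[OF u])
  have "AE y in lborel. u (y + h) + (- 1) *\<^sub>R u y + (- 1) *\<^sub>R D y = 0"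
  proof (rule AE_zero_complex)
    show "square_integrable (\<lambda>y. u (y + h) + (- 1) *\<^sub>R u y + (- 1) *\<^sub>R D y)"
      by (intro square_integrable_add square_integrable_scaleR D u uh)
    fix \<phi> :: "real^'n \<Rightarrow> real" assume t: "test_function \<phi>"
    note s = test_function_square_integrable[OF t]
    have [measurable]: "\<phi> \<in> borel_measurable borel" "partial_deriv i \<phi> \<in> borel_measurable borel" for i
      using s(1) s(2)[of i] by (simp_all add: square_integrable_def)
    have "Ck (Suc 0) \<phi>" using t unfolding test_function_def by blast
    then have c: "continuous_on UNIV (partial_deriv i \<phi>)" for i by simp
    define \<psi> where "\<psi> x = (\<Sum>i\<in>UNIV. h $ i * partial_deriv i \<phi> x)" for x
    have [measurable]: "\<psi> \<in> borel_measurable borel" unfolding \<psi>_def by measurable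
    have \<psi>: "square_integrable \<psi>"
    proof -
      have "square_integrable (\<lambda>x. \<Sum>i\<in>I. h $ i *\<^sub>R partial_deriv i \<phi> x)" if "finite I" for I
        using that
        by (induction I rule: finite_induct)
           (auto intro!: square_integrable_zero square_integrable_add square_integrable_scaleR s simp del: real_scaleR_def)
      then show ?thesis unfolding \<psi>_def by simp
    qed
    have "(LINT y|lborel. \<phi> y *\<^sub>R D y) =
        (LINT y|lborel. LINT t|lborel. indicator {0..1} t *\<^sub>R \<phi> y *\<^sub>R d (y + t *\<^sub>R h))"
      unfolding D_def by (subst integral_scaleR_right[symmetric]) (simp add: mult.commute)
    also have "\<dots> = (LINT t|lborel. LINT y|lborel. indicator {0..1} t *\<^sub>R \<phi> y *\<^sub>R d (y + t *\<^sub>R h))"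
      by (rule lborel_pair.Fubini_integral, rule integrable_pair_shift[OF d s(1), where h = h])
         (auto simp: abs_mult mult_ac)
    also have "\<dots> = (LINT t|lborel. LINT x|lborel. indicator {0..1} t *\<^sub>R (- \<psi> (x - t *\<^sub>R h)) *\<^sub>R u x)"
    proof (rule Bochner_Integration.integral_cong[OF refl])
      fix t :: real
      \<comment> \<open>Moving the translation onto \<open>\<phi>\<close> keeps it a test function,
        so for each fixed \<open>t\<close> the directional derivative can be shifted from
        \<open>u\<close> to the translate of \<open>\<phi>\<close>.\<close>
      have "(LINT y|lborel. \<phi> y *\<^sub>R d (y + t *\<^sub>R h)) = (LINT x|lborel. \<phi> (x + (- t *\<^sub>R h)) *\<^sub>R d x)"
        using lborel_integral_shift[of "\<lambda>x. \<phi> (x + (- t *\<^sub>R h)) *\<^sub>R d x" "t *\<^sub>R h"] by simp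
      also have "\<dots> = - (LINT x|lborel. (\<Sum>i\<in>UNIV. h $ i * partial_deriv i (\<lambda>x. \<phi> (x + (- t *\<^sub>R h))) x) *\<^sub>R u x)"
        using weak_gradient_directional[OF test_function_shift[OF t, of "- t *\<^sub>R h"] u g ug, of h]
        unfolding d_def by simp
      also have "\<dots> = (LINT x|lborel. (- \<psi> (x - t *\<^sub>R h)) *\<^sub>R u x)"
        unfolding partial_deriv_shift[OF test_function_differentiable[OF t]] \<psi>_def by simp
      finally show "(LINT y|lborel. indicator {0..1} t *\<^sub>R \<phi> y *\<^sub>R d (y + t *\<^sub>R h)) =
         (LINT x|lborel. indicator {0..1} t *\<^sub>R (- \<psi> (x - t *\<^sub>R h)) *\<^sub>R u x)"
        by (cases "t \<in> {0..1}") simp_all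
    qed
    also have "\<dots> = (LINT x|lborel. LINT t|lborel. indicator {0..1} t *\<^sub>R (- \<psi> (x - t *\<^sub>R h)) *\<^sub>R u x)"
      by (rule lborel_pair.Fubini_integral[symmetric], rule integrable_pair_shift[OF \<psi> u, where h = "- h"])
         (auto simp: abs_mult mult_ac)
    also have "\<dots> = (LINT x|lborel. \<phi> (x - h) *\<^sub>R u x - \<phi> x *\<^sub>R u x)"
    proof (rule Bochner_Integration.integral_cong[OF refl])
      fix x
      have seg: "integrable lborel (\<lambda>t. indicator {0..1} t *\<^sub>R \<psi> (x - t *\<^sub>R h))"
        unfolding \<psi>_def
        by (intro borel_integrable_compact continuous_intros continuous_on_compose2[OF c]) auto
      have "(LINT t|lborel. indicator {0..1} t *\<^sub>R (- \<psi> (x - t *\<^sub>R h)) *\<^sub>R u x) =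
          - (LINT t|lborel. indicator {0..1} t *\<^sub>R \<psi> (x - t *\<^sub>R h)) *\<^sub>R u x"
        using seg by (subst Bochner_Integration.integral_minus[symmetric], subst integral_scaleR_left[symmetric]) simp_all
      also have "\<dots> = \<phi> (x - h) *\<^sub>R u x - \<phi> x *\<^sub>R u x"
        using test_function_segment_integral[OF t, of h x] by (simp add: \<psi>_def scaleR_left_diff_distrib)
      finally show "(LINT t|lborel. indicator {0..1} t *\<^sub>R (- \<psi> (x - t *\<^sub>R h)) *\<^sub>R u x) =
          \<phi> (x - h) *\<^sub>R u x - \<phi> x *\<^sub>R u x" .
    qed
    also have "\<dots> = (LINT x|lborel. \<phi> (x - h) *\<^sub>R u x) - (LINT x|lborel. \<phi> x *\<^sub>R u x)"
      using test_integrable(1)[OF test_function_shift[OF t, of "- h"] u] test_integrable(1)[OF t u] by simp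
    also have "(LINT x|lborel. \<phi> (x - h) *\<^sub>R u x) = (LINT y|lborel. \<phi> y *\<^sub>R u (y + h))"
      using lborel_integral_shift[of "\<lambda>x. \<phi> (x - h) *\<^sub>R u x" h] by simp
    finally show "(LINT y|lborel. \<phi> y *\<^sub>R (u (y + h) + (- 1) *\<^sub>R u y + (- 1) *\<^sub>R D y)) = 0"
      using test_integrable(1)[OF t u] test_integrable(1)[OF t uh] test_integrable(1)[OF t D]
      by (simp add: scaleR_right_distrib scaleR_right_diff_distrib)
  qed
  then show ?thesis by eventually_elim (simp add: D_def algebra_simps)
qed

text \<open>Takes squared norms in \<open>translation_identity\<close>: averaging along the segment
  does not increase the integral, and Cauchy-Schwarz bounds the directional derivative by the full
  gradient.\<close>

lemma nn_integral_translation_le: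
  fixes u :: "real^'n::finite \<Rightarrow> complex"
  assumes u: "square_integrable u" and g: "square_integrable g" and ug: "weak_gradient u g"
  shows "(\<integral>\<^sup>+y. ennreal ((norm (u (y + h) - u y))\<^sup>2) \<partial>lborel)
    \<le> ennreal ((norm h)\<^sup>2) * (\<integral>\<^sup>+y. ennreal ((norm (g y))\<^sup>2) \<partial>lborel)"
proof -
  let ?d = "\<lambda>y. \<Sum>i\<in>UNIV. h $ i *\<^sub>R (g y $ i)"
  have [measurable]: "g \<in> borel_measurable borel" using g by (simp add: square_integrable_def)
  have "(\<lambda>y. g y $ i) \<in> borel_measurable borel" for i
    using square_integrableD(1)[OF square_integrable_component[OF g]] by simp
  then have dm: "?d \<in> borel_measurable borel" by measurable
  have "(\<integral>\<^sup>+y. ennreal ((norm (u (y + h) - u y))\<^sup>2) \<partial>lborel) =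
     (\<integral>\<^sup>+y. ennreal ((norm (LINT t|lborel. indicator {0..1} t *\<^sub>R ?d (y + t *\<^sub>R h)))\<^sup>2) \<partial>lborel)"
    by (rule nn_integral_cong_AE) (use translation_identity[OF u g ug, of h] in \<open>eventually_elim, simp\<close>)
  also have "\<dots> \<le> (\<integral>\<^sup>+y. ennreal ((norm (?d y))\<^sup>2) \<partial>lborel)"
    by (rule nn_integral_segment_average_le[OF dm])
  also have "\<dots> \<le> (\<integral>\<^sup>+y. ennreal ((norm h)\<^sup>2) * ennreal ((norm (g y))\<^sup>2) \<partial>lborel)"
    by (intro nn_integral_mono)
       (auto simp flip: ennreal_mult power_mult_distrib intro!: ennreal_leI power_mono norm_directional_le)
  also have "\<dots> = ennreal ((norm h)\<^sup>2) * (\<integral>\<^sup>+y. ennreal ((norm (g y))\<^sup>2) \<partial>lborel)"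
    by (rule nn_integral_cmult) measurable
  finally show ?thesis .
qed

section \<open>Concentration and higher integrability\<close>

text \<open>For every \<open>h\<close> in \<open>B\<close>, |u(y)|^2 is at most 2 |u(y + h) -
  u(y)|^2 + 2 |u(y + h)|^2. This is integrated over \<open>h\<close> in \<open>B\<close> and
  \<open>y\<close> in \<open>A\<close>. The first term falls under the translation estimate with |h|
  < \<delta>; in the second, integrating in \<open>h\<close> for fixed \<open>y\<close> gives at
  most the whole mass of \<open>u\<close>, and \<open>y\<close> then contributes the measure of
  \<open>A\<close>. Keeping the measure of \<open>B\<close> as a factor avoids division in
  \<open>ennreal\<close>.\<close>

lemma nn_integral_concentration_le:
  fixes u :: "real^'n::finite \<Rightarrow> complex"
  assumes u: "square_integrable u" and g: "square_integrable g" and ug: "weak_gradient u g"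
    and [measurable]: "A \<in> sets borel" and \<delta>: "\<delta> \<ge> 0"
  defines "B \<equiv> ball (0 :: real^'n) \<delta>"
  shows "emeasure lborel B * (\<integral>\<^sup>+y. indicator A y * ennreal ((norm (u y))\<^sup>2) \<partial>lborel)
    \<le> 2 * ennreal (\<delta>\<^sup>2) * emeasure lborel B * (\<integral>\<^sup>+y. ennreal ((norm (g y))\<^sup>2) \<partial>lborel)
      + 2 * emeasure lborel A * (\<integral>\<^sup>+y. ennreal ((norm (u y))\<^sup>2) \<partial>lborel)"
proof -
  have [measurable]: "u \<in> borel_measurable borel" "g \<in> borel_measurable borel"
    using u g by (simp_all add: square_integrable_def)
  have [measurable]: "B \<in> sets borel" by (simp add: B_def)
  let ?U = "\<integral>\<^sup>+y. ennreal ((norm (u y))\<^sup>2) \<partial>lborel" and ?G = "\<integral>\<^sup>+y. ennreal ((norm (g y))\<^sup>2) \<partial>lborel"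
  let ?I = "\<integral>\<^sup>+y. indicator A y * ennreal ((norm (u y))\<^sup>2) \<partial>lborel"
  have split: "ennreal ((norm (u y))\<^sup>2) \<le> 2 * ennreal ((norm (u (y + h) - u y))\<^sup>2) + 2 * ennreal ((norm (u (y + h)))\<^sup>2)" for y h
  proof -
    have "norm (u y) \<le> norm (u (y + h) - u y) + norm (u (y + h))"
      using norm_triangle_ineq4[of "u (y + h)" "u (y + h) - u y"] by (simp add: add.commute)
    then have "(norm (u y))\<^sup>2 \<le> (norm (u (y + h) - u y) + norm (u (y + h)))\<^sup>2"
      by (rule power_mono) simp
    also have "\<dots> \<le> 2 * (norm (u (y + h) - u y))\<^sup>2 + 2 * (norm (u (y + h)))\<^sup>2"
      using sum_squares_bound[of "norm (u (y + h) - u y)" "norm (u (y + h))"]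
      by (simp add: power2_sum)
    finally have "ennreal ((norm (u y))\<^sup>2) \<le> ennreal (2 * (norm (u (y + h) - u y))\<^sup>2 + 2 * (norm (u (y + h)))\<^sup>2)"
      by (rule ennreal_leI)
    then show ?thesis by (simp add: ennreal_mult)
  qed
  have "emeasure lborel B * ?I = (\<integral>\<^sup>+h. indicator B h * ?I \<partial>lborel)"
    by (simp add: nn_integral_multc)
  also have "\<dots> \<le> (\<integral>\<^sup>+h. indicator B h * (2 * ennreal (\<delta>\<^sup>2) * ?G)
      + 2 * (\<integral>\<^sup>+y. indicator A y * (indicator B h * ennreal ((norm (u (y + h)))\<^sup>2)) \<partial>lborel) \<partial>lborel)"
  proof (rule nn_integral_mono)
    fix h :: "real^'n"
    show "indicator B h * ?I \<le> indicator B h * (2 * ennreal (\<delta>\<^sup>2) * ?G)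
      + 2 * (\<integral>\<^sup>+y. indicator A y * (indicator B h * ennreal ((norm (u (y + h)))\<^sup>2)) \<partial>lborel)"
    proof (cases "h \<in> B")
      case True
      \<comment> \<open>The restriction to \<open>A\<close> is dropped on the difference, whose
        bound is global, and kept on the translate, where it produces the measure of
        \<open>A\<close>.\<close>
      have "?I \<le> (\<integral>\<^sup>+y. 2 * ennreal ((norm (u (y + h) - u y))\<^sup>2)
          + 2 * (indicator A y * ennreal ((norm (u (y + h)))\<^sup>2)) \<partial>lborel)"
        by (intro nn_integral_mono) (use split[of _ h] in \<open>auto simp: indicator_def\<close>)
      also have "\<dots> = 2 * (\<integral>\<^sup>+y. ennreal ((norm (u (y + h) - u y))\<^sup>2) \<partial>lborel)
          + 2 * (\<integral>\<^sup>+y. indicator A y * ennreal ((norm (u (y + h)))\<^sup>2) \<partial>lborel)"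
        by (simp add: nn_integral_add nn_integral_cmult)
      also have "(\<integral>\<^sup>+y. ennreal ((norm (u (y + h) - u y))\<^sup>2) \<partial>lborel) \<le> ennreal ((norm h)\<^sup>2) * ?G"
        by (rule nn_integral_translation_le[OF u g ug])
      also have "ennreal ((norm h)\<^sup>2) * ?G \<le> ennreal (\<delta>\<^sup>2) * ?G"
        using True \<delta> by (intro mult_right_mono ennreal_leI power_mono) (auto simp: B_def)
      finally show ?thesis using True by (simp add: mult.assoc mult_left_mono add_right_mono)
    qed simp
  qed
  also have "\<dots> = 2 * ennreal (\<delta>\<^sup>2) * emeasure lborel B * ?G
      + 2 * (\<integral>\<^sup>+h. \<integral>\<^sup>+y. indicator A y * (indicator B h * ennreal ((norm (u (y + h)))\<^sup>2)) \<partial>lborel \<partial>lborel)"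
    by (subst nn_integral_add) (auto simp: nn_integral_multc nn_integral_cmult mult_ac)
  also have "(\<integral>\<^sup>+h. \<integral>\<^sup>+y. indicator A y * (indicator B h * ennreal ((norm (u (y + h)))\<^sup>2)) \<partial>lborel \<partial>lborel)
      = (\<integral>\<^sup>+y. \<integral>\<^sup>+h. indicator A y * (indicator B h * ennreal ((norm (u (y + h)))\<^sup>2)) \<partial>lborel \<partial>lborel)"
    by (rule lborel_pair.Fubini') measurable
  also have "\<dots> \<le> (\<integral>\<^sup>+y. indicator A y * ?U \<partial>lborel)"
  proof (rule nn_integral_mono)
    fix y
    have "(\<integral>\<^sup>+h. indicator A y * (indicator B h * ennreal ((norm (u (y + h)))\<^sup>2)) \<partial>lborel)
        \<le> (\<integral>\<^sup>+h. indicator A y * ennreal ((norm (u (h + y)))\<^sup>2) \<partial>lborel)"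
      by (intro nn_integral_mono) (auto simp: indicator_def add.commute)
    also have "\<dots> = indicator A y * ?U"
      using nn_integral_lborel_shift[of "\<lambda>x. ennreal ((norm (u x))\<^sup>2)" y]
      by (simp add: nn_integral_cmult)
    finally show "(\<integral>\<^sup>+h. indicator A y * (indicator B h * ennreal ((norm (u (y + h)))\<^sup>2)) \<partial>lborel) \<le> indicator A y * ?U" .
  qed
  also have "\<dots> = emeasure lborel A * ?U"
    by (simp add: nn_integral_multc)
  finally show ?thesis by (simp add: mult.assoc add_left_mono mult_left_mono)
qed

text \<open>The previous estimate over the reals, divided by the volume of the ball. On a set of
  infinite measure \<open>measure\<close> would be 0 by convention, hence the finiteness condition
  on \<open>A\<close>.\<close>

lemma concentration_le:
  fixes u :: "'n::finite Sigma_space"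
  assumes [measurable]: "A \<in> sets borel" and A: "emeasure lborel A < \<infinity>" and \<delta>: "\<delta> > 0"
  shows "(LINT x|lborel. indicator A x * (cmod (sfun u x))\<^sup>2)
    \<le> 2 * \<delta>\<^sup>2 * (LINT x|lborel. (norm (sgrad u x))\<^sup>2)
      + 2 * measure lborel A / (unit_ball_vol (real CARD('n)) * \<delta> ^ CARD('n)) * (LINT x|lborel. (cmod (sfun u x))\<^sup>2)"
proof -
  define b where "b = unit_ball_vol (real CARD('n)) * \<delta> ^ CARD('n)"
  have b: "b > 0" using \<delta> by (simp add: b_def)
  have i: "integrable lborel (\<lambda>x. (cmod (sfun u x))\<^sup>2)" "integrable lborel (\<lambda>x. (norm (sgrad u x))\<^sup>2)"
    using sfun_square_integrable(1)[of u] sgrad(1)[of u] by (auto simp: square_integrable_def)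
  have iA: "integrable lborel (\<lambda>x. indicator A x * (cmod (sfun u x))\<^sup>2)"
    using integrable_mult_indicator[OF _ i(1), of A] by simp
  have "emeasure lborel (ball (0::real^'n) \<delta>) = ennreal b"
    using \<delta> by (simp add: emeasure_ball b_def)
  moreover have "(\<integral>\<^sup>+x. indicator A x * ennreal ((cmod (sfun u x))\<^sup>2) \<partial>lborel)
     = ennreal (LINT x|lborel. indicator A x * (cmod (sfun u x))\<^sup>2)"
    by (subst nn_integral_eq_integral[OF iA, symmetric]) (auto simp: indicator_def intro!: nn_integral_cong)
  moreover have "emeasure lborel A = ennreal (measure lborel A)"
    using A by (simp add: emeasure_eq_ennreal_measure)
  moreover have "(\<integral>\<^sup>+x. ennreal ((cmod (sfun u x))\<^sup>2) \<partial>lborel) = ennreal (LINT x|lborel. (cmod (sfun u x))\<^sup>2)"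
      "(\<integral>\<^sup>+x. ennreal ((norm (sgrad u x))\<^sup>2) \<partial>lborel) = ennreal (LINT x|lborel. (norm (sgrad u x))\<^sup>2)"
    using i by (simp_all add: nn_integral_eq_integral)
  ultimately have "ennreal b * ennreal (LINT x|lborel. indicator A x * (cmod (sfun u x))\<^sup>2)
     \<le> ennreal 2 * ennreal (\<delta>\<^sup>2) * ennreal b * ennreal (LINT x|lborel. (norm (sgrad u x))\<^sup>2)
      + ennreal 2 * ennreal (measure lborel A) * ennreal (LINT x|lborel. (cmod (sfun u x))\<^sup>2)"
    using nn_integral_concentration_le[OF sfun_square_integrable(1) sgrad, of A \<delta> u] \<delta> by simp
  then have "ennreal (b * (LINT x|lborel. indicator A x * (cmod (sfun u x))\<^sup>2))
     \<le> ennreal (2 * \<delta>\<^sup>2 * b * (LINT x|lborel. (norm (sgrad u x))\<^sup>2)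
      + 2 * measure lborel A * (LINT x|lborel. (cmod (sfun u x))\<^sup>2))"
    using b by (simp add: ennreal_mult del: ennreal_numeral)
  then have "b * (LINT x|lborel. indicator A x * (cmod (sfun u x))\<^sup>2)
     \<le> 2 * \<delta>\<^sup>2 * b * (LINT x|lborel. (norm (sgrad u x))\<^sup>2)
      + 2 * measure lborel A * (LINT x|lborel. (cmod (sfun u x))\<^sup>2)"
    by (subst (asm) ennreal_le_iff) (use b in \<open>auto intro!: add_nonneg_nonneg mult_nonneg_nonneg\<close>)
  then show ?thesis using b unfolding b_def[symmetric] by (simp add: field_simps)
qed

section \<open>Mass, tails and higher integrability in \<open>\<Sigma>\<close>\<close>

lemma Sigma_integrable:
  fixes u :: "'n::finite Sigma_space"
  shows "integrable lborel (\<lambda>x. (norm (sgrad u x))\<^sup>2)"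
    and "integrable lborel (\<lambda>x. (norm x)\<^sup>2 * (cmod (sfun u x))\<^sup>2)"
    and "integrable lborel (\<lambda>x. (cmod (sfun u x))\<^sup>2)"
  using sfun_square_integrable[of u] sgrad(1)[of u]
  by (auto simp: square_integrable_def power_mult_distrib)

lemma Sigma_norm_sq:
  fixes u :: "'n::finite Sigma_space"
  shows "(norm u)\<^sup>2 = (LINT x|lborel. (norm (sgrad u x))\<^sup>2) + (LINT x|lborel. (norm x)\<^sup>2 * (cmod (sfun u x))\<^sup>2)"
proof -
  have "(norm u)\<^sup>2 = (LINT x|lborel. (norm (sgrad u x))\<^sup>2 + (norm x)\<^sup>2 * (cmod (sfun u x))\<^sup>2)"
    by (simp add: norm_Sigma_space_def)
  then show ?thesis using Sigma_integrable[of u] by simp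
qed

text \<open>The norm contains no unweighted mass. Outside the ball of radius 1/4 the weight |x|^2 is
  at least 1/16. Inside, \<open>concentration_le\<close> with \<delta> = 1 bounds the mass by the
  gradient plus 2 (1/4)^N times the total mass; as N is at least 1, this factor is at most 1/2 and
  the term is absorbed on the left.\<close>

lemma Sigma_L2_le:
  fixes u :: "'n::finite Sigma_space"
  shows "(LINT x|lborel. (cmod (sfun u x))\<^sup>2) \<le> 32 * (norm u)\<^sup>2"
proof -
  let ?B = "ball (0::real^'n) (1/4)" and ?U = "LINT x|lborel. (cmod (sfun u x))\<^sup>2"
    and ?G = "LINT x|lborel. (norm (sgrad u x))\<^sup>2" and ?X = "LINT x|lborel. (norm x)\<^sup>2 * (cmod (sfun u x))\<^sup>2"
  note i = Sigma_integrable[of u]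
  have iB: "integrable lborel (\<lambda>x. indicator ?B x * (cmod (sfun u x))\<^sup>2)"
    using integrable_mult_indicator[OF _ i(3), of ?B] by simp
  have "?U \<le> (LINT x|lborel. indicator ?B x * (cmod (sfun u x))\<^sup>2 + 16 * ((norm x)\<^sup>2 * (cmod (sfun u x))\<^sup>2))"
  proof (intro integral_mono Bochner_Integration.integrable_add integrable_mult_right i iB)
    fix x :: "real^'n"
    have "1 \<le> indicator ?B x + 16 * (norm x)\<^sup>2"
    proof (cases "x \<in> ?B")
      case False
      then have "(1/4)\<^sup>2 \<le> (norm x)\<^sup>2" by (intro power_mono) auto
      then show ?thesis using False by (simp add: power2_eq_square)
    qed simp
    from mult_right_mono[OF this, of "(cmod (sfun u x))\<^sup>2"]
    show "(cmod (sfun u x))\<^sup>2 \<le> indicator ?B x * (cmod (sfun u x))\<^sup>2 + 16 * ((norm x)\<^sup>2 * (cmod (sfun u x))\<^sup>2)"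
      by (simp add: algebra_simps)
  qed
  also have "\<dots> = (LINT x|lborel. indicator ?B x * (cmod (sfun u x))\<^sup>2) + 16 * ?X"
    using iB i by simp
  also have "(LINT x|lborel. indicator ?B x * (cmod (sfun u x))\<^sup>2)
      \<le> 2 * 1\<^sup>2 * ?G + 2 * measure lborel ?B / (unit_ball_vol (real CARD('n)) * 1 ^ CARD('n)) * ?U"
    by (rule concentration_le) (auto simp: emeasure_ball)
  also have "2 * measure lborel ?B / (unit_ball_vol (real CARD('n)) * 1 ^ CARD('n)) = 2 * (1/4) ^ CARD('n)"
    using unit_ball_vol_pos[of "real CARD('n)", THEN less_imp_neq] by (simp add: content_ball)
  also have "2 * (1/4) ^ CARD('n) * ?U \<le> 1/2 * ?U"
  proof (rule mult_right_mono)
    have "(1/4::real) ^ CARD('n) \<le> (1/4) ^ 1" by (rule power_decreasing) auto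
    then show "2 * (1/4::real) ^ CARD('n) \<le> 1/2" by simp
  qed simp
  finally have "1/2 * ?U \<le> 2 * ?G + 16 * ?X" by simp
  moreover have "?G \<ge> 0" by simp
  moreover have "U \<le> 32 * (G + X)" if "1/2 * U \<le> 2 * G + 16 * X" "0 \<le> G" for U G X :: real
    using that by (simp add: distrib_left)
  ultimately show ?thesis unfolding Sigma_norm_sq by blast
qed

text \<open>A bootstrap: the tail mass \<open>?I\<close> bounds the measure of its own set
  \<open>A\<close>, so in \<open>concentration_le\<close> it reappears on the right with a factor at
  most 1/2. What remains is \<open>?I\<close> at most 4 \<delta>^2, and \<delta> decays like 16^-j
  because \<delta>^N times the squared level is kept constant in \<open>j\<close>.\<close>

lemma Sigma_tail_le:
  fixes u :: "'n::finite Sigma_space"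
  assumes "norm u \<le> 1"
  shows "(LINT x|lborel. indicator {x. cmod (sfun u x) > 2 ^ (2 * CARD('n) * j)} x * (cmod (sfun u x))\<^sup>2)
    \<le> 4 * (1 + 128 / unit_ball_vol (real CARD('n)))\<^sup>2 * (1 / 256) ^ j"
proof -
  let ?N = "CARD('n)" and ?\<omega> = "unit_ball_vol (real CARD('n))"
  \<comment> \<open>\<open>\<delta>\<close> is chosen so that the mass term of \<open>concentration_le\<close>, with Chebyshev's bound for the measure
    of \<open>A\<close>, is at most half of the left-hand side.\<close>
  define L \<kappa> \<delta> where "L = (2::real) ^ (2 * ?N * j)" and "\<kappa> = 1 + 128 / ?\<omega>" and "\<delta> = \<kappa> * (1/16) ^ j"
  define A where "A = {x. cmod (sfun u x) > L}"
  have \<omega>: "?\<omega> > 0" "?\<omega> \<noteq> 0" using unit_ball_vol_pos[of "real CARD('n)"] by (simp, linarith)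
  have \<kappa>: "\<kappa> \<ge> 1" "\<kappa> * ?\<omega> \<ge> 128" and L: "L > 0" and \<delta>: "\<delta> > 0"
    using \<omega> by (auto simp: \<kappa>_def L_def \<delta>_def algebra_simps intro!: add_pos_pos)
  have [measurable]: "A \<in> sets borel" unfolding A_def by measurable
  note i = Sigma_integrable[of u]
  have iA: "integrable lborel (\<lambda>x. indicator A x * (cmod (sfun u x))\<^sup>2)"
    using integrable_mult_indicator[OF _ i(3), of A] by simp
  let ?I = "LINT x|lborel. indicator A x * (cmod (sfun u x))\<^sup>2"
  \<comment> \<open>Chebyshev's inequality, which also shows that \<open>A\<close> has finite
    measure.\<close>
  have "emeasure lborel A = (\<integral>\<^sup>+x. indicator A x \<partial>lborel)" by simp
  also have "\<dots> \<le> (\<integral>\<^sup>+x. ennreal (indicator A x * (cmod (sfun u x))\<^sup>2 / L\<^sup>2) \<partial>lborel)"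
    using L by (intro nn_integral_mono) (auto simp: indicator_def A_def intro!: power_mono)
  also have "\<dots> = ennreal (?I / L\<^sup>2)"
    using iA by (subst nn_integral_eq_integral) auto
  finally have eA: "emeasure lborel A \<le> ennreal (?I / L\<^sup>2)" .
  then have A: "emeasure lborel A < \<infinity>"
    by (rule le_less_trans) simp
  have mA: "measure lborel A \<le> ?I / L\<^sup>2"
    using eA by (subst (asm) emeasure_eq_ennreal_measure) (use A in auto)
  have "\<delta> ^ ?N * L\<^sup>2 = \<kappa> ^ ?N"
  proof -
    have "L\<^sup>2 = ((2 ^ 4) ^ j) ^ ?N"
      by (simp only: L_def power_mult[symmetric]) (simp add: mult_ac)
    then have "\<delta> ^ ?N * L\<^sup>2 = \<kappa> ^ ?N * ((1/16) ^ j * 16 ^ j) ^ ?N"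
      by (simp add: \<delta>_def power_mult_distrib)
    also have "(1/16::real) ^ j * 16 ^ j = 1" by (simp flip: power_mult_distrib)
    finally show ?thesis by simp
  qed
  then have dL: "?I / L\<^sup>2 / (?\<omega> * \<delta> ^ ?N) = ?I / (?\<omega> * \<kappa> ^ ?N)"
    by (simp add: mult_ac)
  have "?I \<le> 2 * \<delta>\<^sup>2 * (LINT x|lborel. (norm (sgrad u x))\<^sup>2)
      + 2 * measure lborel A / (?\<omega> * \<delta> ^ ?N) * (LINT x|lborel. (cmod (sfun u x))\<^sup>2)"
    by (rule concentration_le) (use A \<delta> in auto)
  also have "\<dots> \<le> 2 * \<delta>\<^sup>2 * 1 + 2 * (?I / L\<^sup>2) / (?\<omega> * \<delta> ^ ?N) * 32"
  proof (rule add_mono)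
    have u1: "(norm u)\<^sup>2 \<le> 1" using assms by (simp add: power_le_one)
    have "0 \<le> (LINT x|lborel. (norm x)\<^sup>2 * (cmod (sfun u x))\<^sup>2)" by simp
    with u1 have "(LINT x|lborel. (norm (sgrad u x))\<^sup>2) \<le> 1" unfolding Sigma_norm_sq by linarith
    then show "2 * \<delta>\<^sup>2 * (LINT x|lborel. (norm (sgrad u x))\<^sup>2) \<le> 2 * \<delta>\<^sup>2 * 1"
      by (intro mult_left_mono) auto
    show "2 * measure lborel A / (?\<omega> * \<delta> ^ ?N) * (LINT x|lborel. (cmod (sfun u x))\<^sup>2)
        \<le> 2 * (?I / L\<^sup>2) / (?\<omega> * \<delta> ^ ?N) * 32"
      using mA Sigma_L2_le[of u] u1 \<delta> \<omega> by (intro mult_mono divide_right_mono) auto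
  qed
  also have "\<dots> = 2 * \<delta>\<^sup>2 + 64 / (?\<omega> * \<kappa> ^ ?N) * ?I"
    using arg_cong[OF dL, of "\<lambda>r. 64 * r"] by simp
  also have "64 / (?\<omega> * \<kappa> ^ ?N) * ?I \<le> 1/2 * ?I"
  proof (rule mult_right_mono)
    have "\<kappa> \<le> \<kappa> ^ ?N" using \<kappa>(1) by (intro self_le_power) auto
    then have "\<kappa> * ?\<omega> \<le> \<kappa> ^ ?N * ?\<omega>"
      by (rule mult_right_mono) (use \<omega> in linarith)
    with \<kappa>(2) have "128 \<le> ?\<omega> * \<kappa> ^ ?N" by (simp only: mult.commute)
    then show "64 / (?\<omega> * \<kappa> ^ ?N) \<le> 1/2" by (simp add: divide_le_eq)
  qed simp
  finally have "?I \<le> 4 * \<delta>\<^sup>2" by simp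
  also have "\<delta>\<^sup>2 = \<kappa>\<^sup>2 * (1/256) ^ j"
    by (simp add: \<delta>_def power_mult_distrib power2_eq_square flip: power_mult_distrib)
  finally show ?thesis by (simp add: A_def L_def \<kappa>_def)
qed

text \<open>Let y = s^(1/(2N)). For s > 1 the least \<open>j\<close> with y \<le> 2^(j+1) satisfies
  s > 2^(2Nj), by minimality or, for j = 0, because s > 1. Hence the single term with index
  \<open>j\<close> already dominates y. The summand 1 takes care of s \<le> 1.\<close>

lemma powr_le_dyadic_suminf:
  fixes s :: real
  assumes s: "s \<ge> 0" and N: "N > 0"
  shows "ennreal (s powr (1 / (2 * real N))) \<le> 1 + (\<Sum>j. 2 ^ Suc j * indicator {2 ^ (2 * N * j)<..} s)"
proof (cases "s \<le> 1")
  case True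
  then have "s powr (1 / (2 * real N)) \<le> 1"
    using s powr_mono2[of "1 / (2 * real N)" s 1] by simp
  then have "ennreal (s powr (1 / (2 * real N))) \<le> 1" by (simp add: ennreal_le_1)
  then show ?thesis by (rule order_trans) simp
next
  case False
  define y where "y = s powr (1 / (2 * real N))"
  have y0: "y > 0" using False by (simp add: y_def)
  have "y ^ (2 * N) = y powr (2 * real N)"
    using y0 by (simp flip: powr_realpow)
  also have "\<dots> = s" using False N by (simp add: y_def powr_powr)
  finally have yN: "y ^ (2 * N) = s" .
  obtain n where "y < 2 ^ n" using real_arch_pow[of 2 y] by auto
  then have ex: "\<exists>j. y \<le> 2 ^ Suc j" by (intro exI[of _ n]) (simp add: less_imp_le, smt (verit) zero_less_power)
  define j where "j = (LEAST j. y \<le> 2 ^ Suc j)"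
  have y1: "y \<le> 2 ^ Suc j" unfolding j_def using ex by (rule LeastI_ex)
  have "2 ^ (2 * N * j) < s"
  proof (cases j)
    case 0
    then show ?thesis using False by simp
  next
    case (Suc i)
    then have "\<not> y \<le> 2 ^ Suc i" using not_less_Least[of i "\<lambda>j. y \<le> 2 ^ Suc j"] unfolding j_def by simp
    then have "(2 ^ j) ^ (2 * N) < y ^ (2 * N)"
      using Suc N by (intro power_strict_mono) auto
    then show ?thesis unfolding yN power_mult[symmetric] by (simp add: mult_ac)
  qed
  then have "ennreal y \<le> 2 ^ Suc j * indicator {2 ^ (2 * N * j)<..} s"
    using ennreal_leI[OF y1] by (simp add: ennreal_mult ennreal_power[symmetric])
  also have "\<dots> \<le> (\<Sum>j. 2 ^ Suc j * indicator {2 ^ (2 * N * j)<..} s)"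
  proof -
    define f :: "nat \<Rightarrow> ennreal" where "f = (\<lambda>j. 2 ^ Suc j * indicator {2 ^ (2 * N * j)<..} s)"
    have "sum f {j} \<le> suminf f" by (rule sum_le_suminf) auto
    then show ?thesis by (simp only: f_def sum.insert sum.empty finite.emptyI empty_iff not_False_eq_True add_0_right)
  qed
  also have "\<dots> \<le> 1 + \<dots>" by simp
  finally show ?thesis by (simp add: y_def)
qed

text \<open>Multiplies the dyadic bound by |u|^2 and integrates. The tail mass at level
  \<open>j\<close> is of order 256^-j and carries the weight 2^(j+1), so the series is geometric
  with ratio 1/128. The remaining summand is the mass itself, at most 32 on the unit ball.\<close>

lemma Sigma_higher_integrability:
  "\<exists>C. \<forall>u :: 'n::finite Sigma_space. norm u \<le> 1 \<longrightarrow>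
     integrable lborel (\<lambda>x. cmod (sfun u x) powr (1 / (2 * real CARD('n))) * (cmod (sfun u x))\<^sup>2) \<and>
     (LINT x|lborel. cmod (sfun u x) powr (1 / (2 * real CARD('n))) * (cmod (sfun u x))\<^sup>2) \<le> C"
proof -
  let ?N = "CARD('n)"
  define K where "K = 4 * (1 + 128 / unit_ball_vol (real ?N))\<^sup>2"
  have K: "K \<ge> 0" by (simp add: K_def)
  define C where "C = 32 + (\<Sum>j. 2 * K * (1 / 128) ^ j)"
  have sm: "summable (\<lambda>j. 2 * K * (1 / 128 :: real) ^ j)" by (intro summable_mult summable_geometric) auto
  have C: "C \<ge> 0" unfolding C_def using K by (intro add_nonneg_nonneg suminf_nonneg sm) auto
  have "integrable lborel (\<lambda>x. cmod (sfun u x) powr (1 / (2 * real ?N)) * (cmod (sfun u x))\<^sup>2) \<and>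
     (LINT x|lborel. cmod (sfun u x) powr (1 / (2 * real ?N)) * (cmod (sfun u x))\<^sup>2) \<le> C"
    if u: "norm u \<le> 1" for u :: "'n Sigma_space"
  proof -
    note i = Sigma_integrable(3)[of u]
    define A where "A j = {x. cmod (sfun u x) > 2 ^ (2 * ?N * j)}" for j
    have [measurable]: "A j \<in> sets borel" for j unfolding A_def by measurable
    have tail: "(\<integral>\<^sup>+x. 2 ^ Suc j * (indicator (A j) x * ennreal ((cmod (sfun u x))\<^sup>2)) \<partial>lborel)
        \<le> ennreal (2 * K * (1 / 128) ^ j)" for j
    proof -
      have iA: "integrable lborel (\<lambda>x. indicator (A j) x * (cmod (sfun u x))\<^sup>2)"
        using integrable_mult_indicator[OF _ i, of "A j"] by simp
      have "(\<integral>\<^sup>+x. indicator (A j) x * ennreal ((cmod (sfun u x))\<^sup>2) \<partial>lborel)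
          = (\<integral>\<^sup>+x. ennreal (indicator (A j) x * (cmod (sfun u x))\<^sup>2) \<partial>lborel)"
        by (intro nn_integral_cong) (auto simp: indicator_def)
      also have "\<dots> = ennreal (LINT x|lborel. indicator (A j) x * (cmod (sfun u x))\<^sup>2)"
        using iA by (intro nn_integral_eq_integral) auto
      also have "\<dots> \<le> ennreal (K * (1/256) ^ j)"
        using Sigma_tail_le[OF u, of j] by (intro ennreal_leI) (simp add: K_def A_def)
      finally have "(\<integral>\<^sup>+x. 2 ^ Suc j * (indicator (A j) x * ennreal ((cmod (sfun u x))\<^sup>2)) \<partial>lborel)
          \<le> 2 ^ Suc j * ennreal (K * (1/256) ^ j)"
        by (subst nn_integral_cmult) (auto intro: mult_left_mono)
      also have "\<dots> = ennreal (2 ^ Suc j * (K * (1/256) ^ j))"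
        using K by (simp add: ennreal_mult ennreal_power[symmetric] del: power_Suc)
      also have "2 ^ Suc j * (K * (1/256) ^ j) = 2 * K * (1 / 128) ^ j"
      proof -
        have "(2::real) ^ j * (1/256) ^ j = (1/128) ^ j" by (simp flip: power_mult_distrib)
        then show ?thesis by simp
      qed
      finally show ?thesis .
    qed
    have "(\<integral>\<^sup>+x. ennreal (cmod (sfun u x) powr (1 / (2 * real ?N)) * (cmod (sfun u x))\<^sup>2) \<partial>lborel)
        \<le> (\<integral>\<^sup>+x. ennreal ((cmod (sfun u x))\<^sup>2) +
             (\<Sum>j. 2 ^ Suc j * (indicator (A j) x * ennreal ((cmod (sfun u x))\<^sup>2))) \<partial>lborel)"
    proof (rule nn_integral_mono)
      fix x
      have "ennreal (cmod (sfun u x) powr (1 / (2 * real ?N)) * (cmod (sfun u x))\<^sup>2)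
         = ennreal (cmod (sfun u x) powr (1 / (2 * real ?N))) * ennreal ((cmod (sfun u x))\<^sup>2)"
        by (rule ennreal_mult) auto
      also have "\<dots> \<le> (1 + (\<Sum>j. 2 ^ Suc j * indicator {2 ^ (2 * ?N * j)<..} (cmod (sfun u x)))) * ennreal ((cmod (sfun u x))\<^sup>2)"
        by (intro mult_right_mono powr_le_dyadic_suminf) auto
      also have "\<dots> = ennreal ((cmod (sfun u x))\<^sup>2) +
             (\<Sum>j. 2 ^ Suc j * (indicator (A j) x * ennreal ((cmod (sfun u x))\<^sup>2)))"
        by (simp add: distrib_right ennreal_suminf_multc[symmetric] A_def indicator_def mult.assoc del: power_Suc)
      finally show "ennreal (cmod (sfun u x) powr (1 / (2 * real ?N)) * (cmod (sfun u x))\<^sup>2)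
          \<le> ennreal ((cmod (sfun u x))\<^sup>2) +
             (\<Sum>j. 2 ^ Suc j * (indicator (A j) x * ennreal ((cmod (sfun u x))\<^sup>2)))" .
    qed
    also have "\<dots> = (\<integral>\<^sup>+x. ennreal ((cmod (sfun u x))\<^sup>2) \<partial>lborel) +
        (\<Sum>j. \<integral>\<^sup>+x. 2 ^ Suc j * (indicator (A j) x * ennreal ((cmod (sfun u x))\<^sup>2)) \<partial>lborel)"
      by (subst nn_integral_add, measurable, subst nn_integral_suminf, measurable)
    also have "\<dots> \<le> ennreal 32 + (\<Sum>j. ennreal (2 * K * (1 / 128) ^ j))"
    proof (intro add_mono suminf_le tail summableI)
      have "(norm u)\<^sup>2 \<le> 1" using u by (simp add: power_le_one)
      then have "(LINT x|lborel. (cmod (sfun u x))\<^sup>2) \<le> 32" using Sigma_L2_le[of u] by linarith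
      then show "(\<integral>\<^sup>+x. ennreal ((cmod (sfun u x))\<^sup>2) \<partial>lborel) \<le> ennreal 32"
        using i by (subst nn_integral_eq_integral) (auto intro: ennreal_leI simp del: ennreal_numeral)
    qed
    also have "\<dots> = ennreal C"
      unfolding C_def using K sm
      by (subst suminf_ennreal2, simp, simp, subst ennreal_plus) (auto intro!: suminf_nonneg)
    finally have le: "(\<integral>\<^sup>+x. ennreal (cmod (sfun u x) powr (1 / (2 * real ?N)) * (cmod (sfun u x))\<^sup>2) \<partial>lborel) \<le> ennreal C" .
    have int: "integrable lborel (\<lambda>x. cmod (sfun u x) powr (1 / (2 * real ?N)) * (cmod (sfun u x))\<^sup>2)"
      by (rule integrableI_nonneg) (use le in \<open>auto intro: le_less_trans\<close>)
    then have "ennreal (LINT x|lborel. cmod (sfun u x) powr (1 / (2 * real ?N)) * (cmod (sfun u x))\<^sup>2) \<le> ennreal C"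
      using le by (subst nn_integral_eq_integral[symmetric]) auto
    with int show ?thesis using C by simp
  qed
  then show ?thesis by blast
qed

section \<open>The logarithmic nonlinearity\<close>

text \<open>The factor 1/2 makes \<open>log_gradient\<close> the gradient of this function for the
  real inner product on the complex plane.\<close>

definition log_potential :: "complex \<Rightarrow> real" where
  "log_potential z = 1 / 2 * ((cmod z)\<^sup>2 * ln ((cmod z)\<^sup>2))"

definition log_gradient :: "complex \<Rightarrow> complex" where
  "log_gradient z = (ln ((cmod z)\<^sup>2) + 1) *\<^sub>R z"

text \<open>A modulus of continuity for \<open>log_gradient\<close> at a point of modulus
  \<open>s\<close>, up to a constant, for an increment of modulus \<open>t\<close>. The power 1 - e
  accounts for the logarithmic singularity at 0, the other two terms for growth at infinity.\<close>

definition log_modulus :: "real \<Rightarrow> real \<Rightarrow> real \<Rightarrow> real" where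
  "log_modulus e s t = t powr (1 - e) + t powr (1 + e) + s powr e * t"

section \<open>Hoelder estimates for the logarithmic nonlinearity\<close>

lemma log_modulus_nonneg: "t \<ge> 0 \<Longrightarrow> log_modulus e s t \<ge> 0"
  by (simp add: log_modulus_def)

lemma log_modulus_mono:
  assumes "0 < e" "e < 1" "0 \<le> t" "t \<le> t'"
  shows "log_modulus e s t \<le> log_modulus e s t'"
  unfolding log_modulus_def using assms by (intro add_mono powr_mono2 mult_left_mono) auto

text \<open>For r \<ge> 1 the logarithm is bounded by r^e / e. For r < 1 it is bounded in absolute
  value by r^(-e) / e, and r \<ge> t/2 turns this into a negative power of \<open>t\<close> at the
  cost of 2^e \<le> 2.\<close>

lemma abs_ln_square_le:
  fixes r t :: real
  assumes e: "0 < e" "e < 1" and r: "r > 0" and t: "0 \<le> t" "t \<le> 2 * r"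
  shows "\<bar>ln (r\<^sup>2)\<bar> * t \<le> 2 / e * (r powr e * t + 2 * t powr (1 - e))"
proof (cases "t = 0")
  case False
  then have t0: "t > 0" using t by simp
  have lnr: "ln (r\<^sup>2) = 2 * ln r" using r by (simp add: ln_realpow)
  show ?thesis
  proof (cases "r \<ge> 1")
    case True
    then have "\<bar>ln (r\<^sup>2)\<bar> \<le> 2 / e * r powr e"
      using ln_powr_bound[OF True e(1)] lnr by (simp add: field_simps)
    then have "\<bar>ln (r\<^sup>2)\<bar> * t \<le> 2 / e * r powr e * t" using t by (intro mult_right_mono)
    moreover have "0 \<le> 2 / e * (2 * t powr (1 - e))" using e by simp
    ultimately show ?thesis by (simp add: distrib_left mult.assoc)
  next
    case False
    have "ln (1 / r) \<le> (1 / r) powr e / e" using False r e by (intro ln_powr_bound) auto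
    moreover have "\<bar>ln (r\<^sup>2)\<bar> = 2 * ln (1 / r)" using False r lnr by (simp add: ln_div)
    ultimately have "\<bar>ln (r\<^sup>2)\<bar> \<le> 2 / e * (1 / r) powr e" by simp
    moreover have "(1 / r) powr e \<le> 2 * t powr (- e)"
    proof -
      have "(1 / r) powr e \<le> (2 / t) powr e"
        using t0 r t e by (intro powr_mono2) (auto simp: field_simps)
      also have "\<dots> = 2 powr e * t powr (- e)"
        using t0 by (simp add: powr_divide powr_minus_divide)
      also have "\<dots> \<le> 2 * t powr (- e)"
        using e powr_mono[of e 1 "2::real"] by (intro mult_right_mono) auto
      finally show ?thesis .
    qed
    ultimately have "\<bar>ln (r\<^sup>2)\<bar> \<le> 2 / e * (2 * t powr (- e))"
      using e by (meson divide_nonneg_pos mult_left_mono order_trans zero_le_numeral)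
    then have "\<bar>ln (r\<^sup>2)\<bar> * t \<le> 2 / e * (2 * t powr (- e)) * t" using t by (intro mult_right_mono)
    also have "\<dots> = 2 / e * (2 * (t powr (- e) * t powr 1))" using t0 by simp
    also have "t powr (- e) * t powr 1 = t powr (1 - e)" using powr_add[of t "- e" 1] by simp
    finally have "\<bar>ln (r\<^sup>2)\<bar> * t \<le> 2 / e * (2 * t powr (1 - e))" .
    moreover have "0 \<le> 2 / e * (r powr e * t)" using e t by simp
    ultimately show ?thesis by (simp add: distrib_left)
  qed
qed simp

text \<open>With the larger point as reference, the increment is at most twice its modulus, which is
  what \<open>abs_ln_square_le\<close> asks for. The coefficient 3 is 1 from the linear term and 2
  from the difference of logarithms.\<close>

lemma log_gradient_diff_ordered:
  fixes x y :: complex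
  assumes e: "0 < e" "e < 1" and xy: "cmod y \<le> cmod x"
  shows "cmod (log_gradient x - log_gradient y)
    \<le> 2 / e * (cmod x powr e * cmod (x - y) + 2 * cmod (x - y) powr (1 - e)) + 3 * cmod (x - y)"
proof (cases "x = 0")
  case False
  have w: "cmod (x - y) \<le> 2 * cmod x" using norm_triangle_ineq4[of x y] xy by simp
  \<comment> \<open>The logarithm of the larger point multiplies \<open>x - y\<close>; the difference of the logarithms costs only
    \<open>cmod (x - y)\<close> after multiplication by the smaller point.\<close>
  have "log_gradient x - log_gradient y
    = ln ((cmod x)\<^sup>2) *\<^sub>R (x - y) + (ln ((cmod x)\<^sup>2) - ln ((cmod y)\<^sup>2)) *\<^sub>R y + (x - y)"
    by (simp add: log_gradient_def algebra_simps)
  then have "cmod (log_gradient x - log_gradient y)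
    \<le> \<bar>ln ((cmod x)\<^sup>2)\<bar> * cmod (x - y) + \<bar>ln ((cmod x)\<^sup>2) - ln ((cmod y)\<^sup>2)\<bar> * cmod y + cmod (x - y)"
    by (auto intro!: order_trans[OF norm_triangle_ineq] add_mono)
  moreover have "\<bar>ln ((cmod x)\<^sup>2)\<bar> * cmod (x - y) \<le> 2 / e * (cmod x powr e * cmod (x - y) + 2 * cmod (x - y) powr (1 - e))"
    using False w by (intro abs_ln_square_le e) auto
  moreover have "\<bar>ln ((cmod x)\<^sup>2) - ln ((cmod y)\<^sup>2)\<bar> * cmod y \<le> 2 * cmod (x - y)"
  proof (cases "y = 0")
    case y: False
    \<comment> \<open>By ln q \<le> q - 1 for the quotient q of the moduli; multiplication by |y|
      then leaves |x| - |y|.\<close>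
    have "ln (cmod x) - ln (cmod y) = ln (cmod x / cmod y)" using False y by (simp add: ln_div)
    also have "\<dots> \<le> cmod x / cmod y - 1" using False y by (intro ln_le_minus_one) simp
    finally have "(ln (cmod x) - ln (cmod y)) * cmod y \<le> (cmod x / cmod y - 1) * cmod y"
      by (intro mult_right_mono) auto
    also have "\<dots> = cmod x - cmod y" using y by (simp add: field_simps)
    also have "\<dots> \<le> cmod (x - y)" by (rule norm_triangle_ineq2)
    finally have "(ln (cmod x) - ln (cmod y)) * cmod y \<le> cmod (x - y)" .
    moreover have "ln (cmod y) \<le> ln (cmod x)" using xy y False by simp
    moreover have "ln ((cmod x)\<^sup>2) = 2 * ln (cmod x)" "ln ((cmod y)\<^sup>2) = 2 * ln (cmod y)"
      using False y by (simp_all add: ln_realpow)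
    ultimately show ?thesis by (simp add: left_diff_distrib)
  qed simp
  ultimately show ?thesis by linarith
qed (use xy in \<open>simp add: log_gradient_def\<close>)

text \<open>Removes the ordering of the two points. The larger modulus is at most s + t, so its
  power \<open>e\<close> is at most 2 s^e + 2 t^e; the summand t^e, multiplied by \<open>t\<close>,
  is the reason for the power 1 + e in the modulus. The linear term is absorbed because
  \<open>t\<close> is at most t^(1-e) + t^(1+e).\<close>

lemma log_gradient_diff_le:
  fixes a b :: complex
  assumes e: "0 < e" "e < 1"
  shows "cmod (log_gradient b - log_gradient a) \<le> (4 / e + 3) * log_modulus e (cmod a) (cmod (b - a))"
proof -
  define s t where "s = cmod a" and "t = cmod (b - a)"
  have st: "s \<ge> 0" "t \<ge> 0" by (simp_all add: s_def t_def)
  have t: "t \<le> t powr (1 - e) + t powr (1 + e)"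
  proof (cases "t \<le> 1")
    case True
    then have "t powr 1 \<le> t powr (1 - e)" using st e by (intro powr_mono') auto
    then show ?thesis using st by (simp add: add_increasing2)
  next
    case False
    then have "t powr 1 \<le> t powr (1 + e)" using st e by (intro powr_mono) auto
    then show ?thesis using st by (simp add: add_increasing)
  qed
  have key: "cmod (log_gradient b - log_gradient a)
    \<le> 2 / e * ((2 * s powr e + 2 * t powr e) * t + 2 * t powr (1 - e)) + 3 * t"
  proof (cases "cmod a \<le> cmod b")
    case True
    have "cmod b \<le> s + t" using norm_triangle_ineq[of a "b - a"] by (simp add: s_def t_def)
    then have "cmod b powr e \<le> (s + t) powr e" using e by (intro powr_mono2) auto
    also have "\<dots> \<le> (2 * max s t) powr e" using e st by (intro powr_mono2) auto
    also have "\<dots> = 2 powr e * max s t powr e" using st by (simp add: powr_mult)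
    also have "\<dots> \<le> 2 * max s t powr e" using e powr_mono[of e 1 "2::real"] by (intro mult_right_mono) auto
    also have "\<dots> \<le> 2 * s powr e + 2 * t powr e" by (simp add: max_def)
    finally have "2 / e * (cmod b powr e * t + 2 * t powr (1 - e)) + 3 * t
       \<le> 2 / e * ((2 * s powr e + 2 * t powr e) * t + 2 * t powr (1 - e)) + 3 * t"
      using e st by (intro add_mono mult_left_mono mult_right_mono order_refl) auto
    with log_gradient_diff_ordered[OF e True] show ?thesis by (simp add: t_def)
  next
    case False
    have "2 / e * (s powr e * t + 2 * t powr (1 - e)) + 3 * t
       \<le> 2 / e * ((2 * s powr e + 2 * t powr e) * t + 2 * t powr (1 - e)) + 3 * t"
      using e st by (intro add_mono mult_left_mono mult_right_mono order_refl) (auto simp: add_increasing2)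
    with log_gradient_diff_ordered[OF e, of b a] False show ?thesis
      by (simp add: s_def t_def norm_minus_commute)
  qed
  also have "(2 * s powr e + 2 * t powr e) * t + 2 * t powr (1 - e) = 2 * log_modulus e s t"
  proof -
    have "t powr e * t = t powr (1 + e)"
      using st powr_add[of t e 1] by (simp add: add.commute)
    then show ?thesis by (simp add: log_modulus_def algebra_simps)
  qed
  also have "3 * t \<le> 3 * log_modulus e s t"
    using t st by (simp add: log_modulus_def add_increasing2)
  finally show ?thesis by (simp add: s_def t_def algebra_simps)
qed

text \<open>Away from 0 this is the product and chain rule for the squared modulus. At 0 the
  difference quotient equals half of |f(y) - y|, with f the function \<open>log_gradient\<close>,
  and is controlled by the Hoelder estimate with e = 1/2, where 4/e + 3 = 11.\<close>

lemma log_potential_has_derivative: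
  "(log_potential has_derivative (\<lambda>h. inner (log_gradient z) h)) (at z)"
proof (cases "z = 0")
  case False
  have *: "log_potential = (\<lambda>z. 1 / 2 * (inner z z * ln (inner z z)))"
    by (simp add: log_potential_def fun_eq_iff power2_norm_eq_inner)
  have "inner z z > 0" using False by simp
  then show ?thesis
    unfolding * log_gradient_def
    by (auto intro!: derivative_eq_intros simp: fun_eq_iff power2_norm_eq_inner inner_commute algebra_simps)
next
  case True
  have "(log_potential has_derivative (\<lambda>h. 0)) (at 0)"
  proof (rule has_derivativeI_sandwich[of 1])
    show "norm (log_potential y - log_potential 0 - 0) / norm (y - 0)
        \<le> 11 * log_modulus (1 / 2) 0 (cmod y) + cmod y" if "y \<noteq> 0" for y
    proof -
      have "norm (log_potential y - log_potential 0 - 0) / norm (y - 0) = 1/2 * cmod (log_gradient y - y)"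
        using that by (simp add: log_potential_def log_gradient_def algebra_simps power2_eq_square abs_mult)
      also have "\<dots> \<le> cmod (log_gradient y - y)" by simp
      also have "\<dots> \<le> cmod (log_gradient y - log_gradient 0) + cmod y"
        using norm_triangle_ineq4[of "log_gradient y" y] by (simp add: log_gradient_def)
      also have "\<dots> \<le> 11 * log_modulus (1 / 2) 0 (cmod y) + cmod y"
        using log_gradient_diff_le[of "1/2" y 0] by simp
      finally show ?thesis .
    qed
    have "((\<lambda>y::complex. 11 * log_modulus (1 / 2) 0 (cmod y) + cmod y) \<longlongrightarrow>
       11 * (0 + 0 + 0 powr (1/2) * 0) + 0) (at 0)"
      unfolding log_modulus_def
      by (intro tendsto_intros tendsto_zero_powrI[where b = "1/2"] tendsto_zero_powrI[where b = "3/2"] tendsto_norm_zero) auto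
    then show "((\<lambda>y::complex. 11 * log_modulus (1 / 2) 0 (cmod y) + cmod y) \<longlongrightarrow> 0) (at 0)" by simp
  qed auto
  with True show ?thesis by (simp add: log_gradient_def)
qed

text \<open>Mean value inequality on the segment from \<open>a\<close> to \<open>a + w\<close>:
  there the derivative differs from the one at \<open>a\<close> by at most the modulus at |w|, which
  is monotone in the increment.\<close>

lemma log_potential_taylor:
  fixes a w :: complex
  assumes e: "0 < e" "e < 1"
  shows "\<bar>log_potential (a + w) - log_potential a - inner (log_gradient a) w\<bar>
    \<le> (4 / e + 3) * log_modulus e (cmod a) (cmod w) * cmod w"
proof -
  have "norm (log_potential (a + w) - log_potential a - inner (log_gradient a) (a + w - a))
    \<le> norm (a + w - a) * ((4 / e + 3) * log_modulus e (cmod a) (cmod w))"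
  proof (rule differentiable_bound_linearization[where S = "closed_segment a (a + w)"
        and f' = "\<lambda>x. inner (log_gradient x)"])
    show "a + t *\<^sub>R (a + w - a) \<in> closed_segment a (a + w)" if "t \<in> {0..1}" for t
      using that by (auto simp: in_segment intro!: exI[of _ t]) (simp add: algebra_simps)
    show "(log_potential has_derivative (\<lambda>h. inner (log_gradient x) h)) (at x within closed_segment a (a + w))" for x
      by (rule has_derivative_at_withinI[OF log_potential_has_derivative])
    show "onorm (\<lambda>h. (inner (log_gradient x) - inner (log_gradient a)) h) \<le> (4 / e + 3) * log_modulus e (cmod a) (cmod w)"
      if x: "x \<in> closed_segment a (a + w)" for x
    proof -
      have "onorm (\<lambda>h. (inner (log_gradient x) - inner (log_gradient a)) h) \<le> cmod (log_gradient x - log_gradient a)"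
        by (intro onorm_le) (auto simp: inner_diff_left[symmetric] Cauchy_Schwarz_ineq2)
      also have "\<dots> \<le> (4 / e + 3) * log_modulus e (cmod a) (cmod (x - a))"
        by (rule log_gradient_diff_le[OF e])
      also have "\<dots> \<le> (4 / e + 3) * log_modulus e (cmod a) (cmod w)"
        using e segment_bound1[OF x] by (intro mult_left_mono log_modulus_mono) auto
      finally show ?thesis .
    qed
  qed simp
  then show ?thesis by (simp add: mult.commute)
qed

section \<open>Integral bounds\<close>

lemma nn_integral_inverse_1_plus_square:
  "(\<integral>\<^sup>+x. ennreal (1 / (1 + x\<^sup>2)) \<partial>(lborel :: real measure)) < \<infinity>"
proof -
  have h: "(\<integral>\<^sup>+x. ennreal (1 / (1 + x\<^sup>2)) * indicator {0..} x \<partial>lborel) = ennreal (pi / 2 - arctan 0)"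
    by (rule nn_integral_FTC_atLeast)
       (auto intro!: derivative_eq_intros tendsto_arctan_at_top simp: inverse_eq_divide add_nonneg_eq_0_iff)
  have "(\<integral>\<^sup>+x. ennreal (1 / (1 + x\<^sup>2)) \<partial>(lborel :: real measure))
     \<le> (\<integral>\<^sup>+x. ennreal (1 / (1 + x\<^sup>2)) * indicator {0..} x + ennreal (1 / (1 + x\<^sup>2)) * indicator {0..} (- x) \<partial>lborel)"
    by (intro nn_integral_mono) (auto simp: indicator_def)
  also have "\<dots> = (\<integral>\<^sup>+x. ennreal (1 / (1 + x\<^sup>2)) * indicator {0..} x \<partial>lborel)
     + (\<integral>\<^sup>+x. ennreal (1 / (1 + x\<^sup>2)) * indicator {0..} (- x) \<partial>lborel)"
    by (rule nn_integral_add) measurable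
  also have "(\<integral>\<^sup>+x. ennreal (1 / (1 + x\<^sup>2)) * indicator {0..} (- x) \<partial>lborel)
     = (\<integral>\<^sup>+x. ennreal (1 / (1 + x\<^sup>2)) * indicator {0..} x \<partial>lborel)"
    using nn_integral_real_affine[of "\<lambda>x. ennreal (1 / (1 + x\<^sup>2)) * indicator {0..} x" "-1" 0] by simp
  finally show ?thesis unfolding h by (rule le_less_trans) simp
qed

text \<open>Each of the N coordinates satisfies 1 + x_b^2 \<le> (1 + |x|)^2, so the exponent 2N
  allows comparison with a product of one-dimensional functions, whose integral factorises.\<close>

lemma integrable_inverse_norm_power:
  "integrable lborel (\<lambda>x :: real^'n::finite. (1 / (1 + norm x)) ^ (2 * CARD('n)))"
proof (rule integrableI_bounded)
  have "(1 / (1 + norm x)) ^ (2 * CARD('n)) \<le> (\<Prod>b\<in>Basis. 1 / (1 + (x \<bullet> b)\<^sup>2))" for x :: "real^'n"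
  proof -
    have "(1 / (1 + norm x)) ^ (2 * CARD('n)) = (\<Prod>b\<in>(Basis :: (real^'n) set). (1 / (1 + norm x))\<^sup>2)"
      by (simp add: power_mult)
    also have "\<dots> \<le> (\<Prod>b\<in>Basis. 1 / (1 + (x \<bullet> b)\<^sup>2))"
    proof (rule prod_mono)
      fix b :: "real^'n" assume b: "b \<in> Basis"
      have "(x \<bullet> b)\<^sup>2 \<le> (norm x)\<^sup>2" using Basis_le_norm[OF b, of x] by (simp add: abs_le_square_iff[symmetric])
      then have "1 + (x \<bullet> b)\<^sup>2 \<le> (1 + norm x)\<^sup>2" by (simp add: power2_sum add_increasing2)
      then have "1 / (1 + norm x)\<^sup>2 \<le> 1 / (1 + (x \<bullet> b)\<^sup>2)"
        by (intro divide_left_mono mult_pos_pos zero_less_power) (auto intro: add_pos_nonneg)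
      then show "0 \<le> (1 / (1 + norm x))\<^sup>2 \<and> (1 / (1 + norm x))\<^sup>2 \<le> 1 / (1 + (x \<bullet> b)\<^sup>2)"
        by (simp add: power_divide)
    qed
    finally show ?thesis .
  qed
  then have "(\<integral>\<^sup>+x. ennreal (norm ((1 / (1 + norm (x::real^'n))) ^ (2 * CARD('n)))) \<partial>lborel)
     \<le> (\<integral>\<^sup>+x. (\<Prod>b\<in>(Basis :: (real^'n) set). ennreal (1 / (1 + (x \<bullet> b)\<^sup>2))) \<partial>lborel)"
    by (intro nn_integral_mono) (simp add: prod_ennreal ennreal_leI)
  also have "\<dots> = (\<Prod>b\<in>(Basis :: (real^'n) set). \<integral>\<^sup>+x. ennreal (1 / (1 + x\<^sup>2)) \<partial>lborel)"
    by (rule nn_integral_lborel_prod) auto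
  also have "\<dots> < \<infinity>"
    using nn_integral_inverse_1_plus_square by (simp add: power_less_top_ennreal)
  finally show "(\<integral>\<^sup>+x. ennreal (norm ((1 / (1 + norm (x::real^'n))) ^ (2 * CARD('n)))) \<partial>lborel) < \<infinity>" .
qed measurable

text \<open>A pointwise substitute for Hoelder's inequality with the weight \<open>1 + |x|\<close>.\<close>

lemma powr_le_weighted:
  fixes t X :: real
  assumes "t \<ge> 0" "X \<ge> 0" "N > 0"
  shows "t powr (1 - 1 / (2 * real N)) \<le> (1 + X) * t + (1 / (1 + X)) ^ N"
proof (cases "t = 0")
  case False
  define e where "e = 1 / (2 * real N)"
  define y where "y = t powr e"
  define q where "q = 1 / (1 + X)"
  have t: "t > 0" using assms False by simp
  have y: "y > 0" using t by (simp add: y_def)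
  have q: "0 < q" "q \<le> 1" using assms by (auto simp: q_def)
  have split: "t powr (1 - e) * y = t"
    using t by (simp add: y_def flip: powr_add)
  \<comment> \<open>If y = t^e is at least q, then (1 + X) y \<ge> 1 supplies the missing power of
    \<open>t\<close>. Otherwise 1 - e = (2N - 1) e gives t^(1-e) = y^(2N-1), which is below q^(2N-1)
    and hence at most q^N.\<close>
  have "t powr (1 - e) \<le> (1 + X) * t + q ^ N"
  proof (cases "q \<le> y")
    case True
    then have "1 \<le> (1 + X) * y" using assms by (simp add: q_def field_simps)
    then have "t powr (1 - e) * 1 \<le> t powr (1 - e) * ((1 + X) * y)"
      by (intro mult_left_mono) auto
    also have "\<dots> = (1 + X) * t" using split by (simp add: mult_ac)
    finally show ?thesis using q by (simp add: add_increasing2)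
  next
    case False
    have "t powr (1 - e) = y powr (real (2 * N - 1))"
      using assms(3) t by (simp add: y_def powr_powr e_def field_simps of_nat_diff)
    also have "\<dots> = y ^ (2 * N - 1)" using y by (rule powr_realpow)
    also have "\<dots> \<le> q ^ (2 * N - 1)" using False y by (intro power_mono) auto
    also have "\<dots> \<le> q ^ N" using q assms(3) by (intro power_decreasing) auto
    finally show ?thesis using t assms by (simp add: add_increasing)
  qed
  then show ?thesis by (simp add: e_def q_def)
qed (use assms in simp)

section \<open>Bounds for integrals of the modulus\<close>

lemma exponent_bounds:
  "0 < 1 / (2 * real CARD('n::finite))" "1 / (2 * real CARD('n)) < 1"
proof -
  have "1 \<le> CARD('n)" by (simp add: Suc_leI)
  then have "1 \<le> real CARD('n)" by linarith
  then show "0 < 1 / (2 * real CARD('n))" "1 / (2 * real CARD('n)) < 1"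
    by (simp_all only: zero_less_divide_1_iff divide_less_eq_1) linarith+
qed

text \<open>Here \<open>X\<close> stands for |x| and \<open>s\<close> for |u(x)|. The summands are
  the densities whose integrals the norm of \<open>\<Sigma>\<close> controls: plain mass, weighted
  mass and the power 2 + 1/(2N).\<close>

definition weight_density :: "nat \<Rightarrow> real \<Rightarrow> real \<Rightarrow> real" where
  "weight_density N X s = (1 + X\<^sup>2) * s\<^sup>2 + s powr (1 / (2 * real N)) * s\<^sup>2"

lemma weight_density_nonneg: "weight_density N X s \<ge> 0"
  by (simp add: weight_density_def)

text \<open>The singular power t^(1-e) goes through \<open>powr_le_weighted\<close> and then 2ab
  \<le> a^2 + b^2; its additive remainder, squared, is the integrable weight. In the two other
  products all three moduli are replaced by their maximum, whose power 2 + e is at most the sum of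
  the three powers.\<close>

lemma log_modulus_mult_le:
  fixes s t r X :: real
  assumes "s \<ge> 0" "t \<ge> 0" "r \<ge> 0" "X \<ge> 0" "N > 0"
  shows "log_modulus (1 / (2 * real N)) s t * r \<le> (1 / (1 + X)) ^ (2 * N)
    + 3 * (weight_density N X s + weight_density N X t + weight_density N X r)"
proof -
  define e where "e = 1 / (2 * real N)"
  define q where "q = (1 / (1 + X)) ^ N"
  define P where "P z = z powr e * z\<^sup>2" for z :: real
  have e: "e > 0" using assms by (simp add: e_def)
  have P0: "P z \<ge> 0" for z by (simp add: P_def)
  have prod: "a powr e * b * c \<le> P a + P b + P c" if "a \<ge> 0" "b \<ge> 0" "c \<ge> 0" for a b c
  proof -
    define m where "m = max a (max b c)"
    have "a powr e * b * c \<le> m powr e * m * m"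
      using that e by (intro mult_mono powr_mono2) (auto simp: m_def)
    also have "\<dots> = P m" by (simp add: P_def power2_eq_square)
    also have "\<dots> \<le> P a + P b + P c"
      using P0[of a] P0[of b] P0[of c] by (auto simp: m_def max_def)
    finally show ?thesis .
  qed
  have 1: "t powr (1 - e) * r \<le> 2 * ((1 + X\<^sup>2) * t\<^sup>2) + q\<^sup>2 + r\<^sup>2"
  proof -
    have "t powr (1 - e) * r \<le> ((1 + X) * t + q) * r"
      using powr_le_weighted[of t X N] assms by (intro mult_right_mono) (auto simp: e_def q_def)
    also have "\<dots> \<le> ((1 + X) * t)\<^sup>2 + q\<^sup>2 + r\<^sup>2"
    proof -
      have "(a + q) * r \<le> a\<^sup>2 + q\<^sup>2 + r\<^sup>2" for a
        using sum_squares_bound[of a r] sum_squares_bound[of q r] zero_le_power2[of a] zero_le_power2[of q]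
        unfolding distrib_right by linarith
      then show ?thesis .
    qed
    also have "((1 + X) * t)\<^sup>2 \<le> 2 * ((1 + X\<^sup>2) * t\<^sup>2)"
    proof -
      have "(1 + X)\<^sup>2 \<le> 2 * (1 + X\<^sup>2)" using sum_squares_bound[of 1 X] by (simp add: power2_sum)
      then show ?thesis unfolding power_mult_distrib mult.assoc[symmetric] by (rule mult_right_mono) simp
    qed
    finally show ?thesis by simp
  qed
  have 2: "t powr (1 + e) * r \<le> P t + P t + P r"
    using prod[of t t r] assms by (simp add: powr_add mult_ac)
  have 3: "s powr e * t * r \<le> P s + P t + P r"
    using prod assms by simp
  have q: "q\<^sup>2 = (1 / (1 + X)) ^ (2 * N)"
    by (simp add: q_def mult.commute flip: power_mult)
  have r: "r\<^sup>2 \<le> 2 * ((1 + X\<^sup>2) * r\<^sup>2)"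
    using mult_right_mono[of 1 "2 * (1 + X\<^sup>2)" "r\<^sup>2"] by (simp add: algebra_simps)
  have w: "weight_density N X z = (1 + X\<^sup>2) * z\<^sup>2 + P z" for z
    by (simp add: weight_density_def P_def e_def)
  have nn: "0 \<le> (1 + X\<^sup>2) * z\<^sup>2" for z by simp
  have "log_modulus e s t * r = t powr (1 - e) * r + t powr (1 + e) * r + s powr e * t * r"
    by (simp add: log_modulus_def distrib_right)
  \<comment> \<open>\<open>P t\<close> occurs three times, whence the factor 3.\<close>
  also have "\<dots> \<le> 2 * ((1 + X\<^sup>2) * t\<^sup>2) + q\<^sup>2 + 2 * ((1 + X\<^sup>2) * r\<^sup>2) + P t + P t + P r + P s + P t + P r"
    using 1 2 3 r by linarith
  also have "\<dots> \<le> q\<^sup>2 + 3 * (weight_density N X s + weight_density N X t + weight_density N X r)"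
  proof -
    have "2 * b + q\<^sup>2 + 2 * c + P t + P t + P r + P s + P t + P r \<le> q\<^sup>2 + 3 * (a + P s + (b + P t) + (c + P r))"
      if "0 \<le> a" "0 \<le> b" "0 \<le> c" for a b c
      using that P0[of s] P0[of r] by simp
    from this[OF nn nn nn] show ?thesis unfolding w .
  qed
  finally show ?thesis by (simp add: e_def q)
qed

lemma cmod_sfun_scaleR:
  "AE x in lborel. cmod (sfun (c *\<^sub>R u) x) = \<bar>c\<bar> * cmod (sfun u x)" for u :: "'n::finite Sigma_space"
  using sfun_scaleR[of c u] by eventually_elim simp

lemma norm_sgn_Sigma_le: "norm (sgn u) \<le> 1" for u :: "'n::finite Sigma_space"
  by (simp add: norm_sgn)

lemma norm_scaleR_sgn_Sigma: "norm u *\<^sub>R sgn u = u" for u :: "'n::finite Sigma_space"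
  by (cases "u = 0") (auto simp: sgn_div_norm)

text \<open>Higher integrability is available on the unit ball; homogeneity carries it from
  \<open>sgn u\<close> to \<open>u\<close>.\<close>

lemma integrable_weight_density:
  "integrable lborel (\<lambda>x. weight_density CARD('n) (norm x) (cmod (sfun u x)))" for u :: "'n::finite Sigma_space"
proof -
  let ?e = "1 / (2 * real CARD('n))"
  have "integrable lborel (\<lambda>x. cmod (sfun (sgn u) x) powr ?e * (cmod (sfun (sgn u) x))\<^sup>2)"
    using Sigma_higher_integrability[where 'n = 'n] norm_sgn_Sigma_le[of u] by blast
  then have "integrable lborel (\<lambda>x. (norm u powr ?e * (norm u)\<^sup>2) * (cmod (sfun (sgn u) x) powr ?e * (cmod (sfun (sgn u) x))\<^sup>2))"
    by simp
  also have "?this \<longleftrightarrow> integrable lborel (\<lambda>x. cmod (sfun u x) powr ?e * (cmod (sfun u x))\<^sup>2)"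
    by (rule integrable_cong_AE, measurable)
       (use cmod_sfun_scaleR[of "norm u" "sgn u"] in \<open>eventually_elim, simp add: norm_scaleR_sgn_Sigma powr_mult power_mult_distrib\<close>)
  finally show ?thesis
    unfolding weight_density_def distrib_right using Sigma_integrable(2,3)[of u] by simp
qed

lemma integral_weight_density_bounded:
  "\<exists>C\<ge>0. \<forall>u :: 'n::finite Sigma_space. norm u \<le> 1 \<longrightarrow>
    (LINT x|lborel. weight_density CARD('n) (norm x) (cmod (sfun u x))) \<le> C"
proof -
  let ?e = "1 / (2 * real CARD('n))"
  obtain C where C: "\<And>u :: 'n Sigma_space. norm u \<le> 1 \<Longrightarrow>
     integrable lborel (\<lambda>x. cmod (sfun u x) powr ?e * (cmod (sfun u x))\<^sup>2) \<and>
     (LINT x|lborel. cmod (sfun u x) powr ?e * (cmod (sfun u x))\<^sup>2) \<le> C"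
    using Sigma_higher_integrability[where 'n = 'n] by blast
  \<comment> \<open>The 33 is 32 from \<open>Sigma_L2_le\<close> plus 1 from the weighted part of
    the norm.\<close>
  have "(LINT x|lborel. weight_density CARD('n) (norm x) (cmod (sfun u x))) \<le> 33 + \<bar>C\<bar>"
    if u: "norm u \<le> 1" for u :: "'n Sigma_space"
  proof -
    have "(LINT x|lborel. weight_density CARD('n) (norm x) (cmod (sfun u x)))
       = (LINT x|lborel. (cmod (sfun u x))\<^sup>2) + (LINT x|lborel. (norm x)\<^sup>2 * (cmod (sfun u x))\<^sup>2)
         + (LINT x|lborel. cmod (sfun u x) powr ?e * (cmod (sfun u x))\<^sup>2)"
      unfolding weight_density_def distrib_right using Sigma_integrable(2,3)[of u] C[OF u] by simp
    moreover have u1: "(norm u)\<^sup>2 \<le> 1" using u by (simp add: power_le_one)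
    moreover have "0 \<le> (LINT x|lborel. (norm (sgrad u x))\<^sup>2)" by simp
    ultimately show ?thesis
      using Sigma_L2_le[of u] C[OF u] Sigma_norm_sq[of u] by linarith
  qed
  then show ?thesis by (intro exI[of _ "33 + \<bar>C\<bar>"]) auto
qed

lemma integrable_log_modulus:
  fixes u w v :: "'n::finite Sigma_space"
  defines "e \<equiv> 1 / (2 * real CARD('n))"
  shows "integrable lborel (\<lambda>x. log_modulus e (cmod (sfun u x)) (cmod (sfun w x)) * cmod (sfun v x))" (is ?int)
    and "(LINT x|lborel. log_modulus e (cmod (sfun u x)) (cmod (sfun w x)) * cmod (sfun v x))
      \<le> (LINT x|lborel. (1 / (1 + norm (x :: real^'n))) ^ (2 * CARD('n)))
        + 3 * ((LINT x|lborel. weight_density CARD('n) (norm x) (cmod (sfun u x)))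
        + (LINT x|lborel. weight_density CARD('n) (norm x) (cmod (sfun w x)))
        + (LINT x|lborel. weight_density CARD('n) (norm x) (cmod (sfun v x))))" (is "_ \<le> ?R")
proof -
  let ?W = "\<lambda>u x. weight_density CARD('n) (norm x) (cmod (sfun u x))"
  let ?B = "\<lambda>x. (1 / (1 + norm (x :: real^'n))) ^ (2 * CARD('n)) + 3 * (?W u x + ?W w x + ?W v x)"
  note i = integrable_weight_density[of u] integrable_weight_density[of w] integrable_weight_density[of v]
    integrable_inverse_norm_power[where 'n = 'n]
  have B: "integrable lborel ?B"
    by (intro Bochner_Integration.integrable_add integrable_mult_right i)
  have le: "log_modulus e (cmod (sfun u x)) (cmod (sfun w x)) * cmod (sfun v x) \<le> ?B x" for x
    unfolding e_def by (rule log_modulus_mult_le) auto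
  show ?int
  proof (rule Bochner_Integration.integrable_bound[OF B])
    show "AE x in lborel. norm (log_modulus e (cmod (sfun u x)) (cmod (sfun w x)) * cmod (sfun v x)) \<le> norm (?B x)"
    proof (rule AE_I2)
      fix x
      have "0 \<le> log_modulus e (cmod (sfun u x)) (cmod (sfun w x)) * cmod (sfun v x)"
        by (intro mult_nonneg_nonneg log_modulus_nonneg) auto
      with le[of x] show "norm (log_modulus e (cmod (sfun u x)) (cmod (sfun w x)) * cmod (sfun v x)) \<le> norm (?B x)"
        unfolding real_norm_def by linarith
    qed
  qed (simp add: log_modulus_def)
  then have "(LINT x|lborel. log_modulus e (cmod (sfun u x)) (cmod (sfun w x)) * cmod (sfun v x)) \<le> integral\<^sup>L lborel ?B"
    by (intro integral_mono B le)
  also have "\<dots> = ?R" using i by simp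
  finally show "(LINT x|lborel. log_modulus e (cmod (sfun u x)) (cmod (sfun w x)) * cmod (sfun v x)) \<le> ?R" .
qed

text \<open>The integral is homogeneous of degree one in \<open>v\<close>, so the inhomogeneous
  bound is applied to \<open>sgn v\<close>. The increment \<open>w\<close> may have any size, and
  the constant depends on it.\<close>

lemma integral_log_modulus_bound:
  fixes u w :: "'n::finite Sigma_space"
  defines "e \<equiv> 1 / (2 * real CARD('n))"
  shows "\<exists>K\<ge>0. \<forall>v :: 'n Sigma_space.
    (LINT x|lborel. log_modulus e (cmod (sfun u x)) (cmod (sfun w x)) * cmod (sfun v x)) \<le> K * norm v"
proof -
  let ?W = "\<lambda>u :: 'n Sigma_space. LINT x|lborel. weight_density CARD('n) (norm x) (cmod (sfun u x))"
  let ?D = "LINT x|lborel. (1 / (1 + norm (x :: real^'n))) ^ (2 * CARD('n))"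
  obtain C where C: "C \<ge> 0" "\<And>u :: 'n Sigma_space. norm u \<le> 1 \<Longrightarrow> ?W u \<le> C"
    using integral_weight_density_bounded[where 'n = 'n] by blast
  have "?D \<ge> 0" "?W u \<ge> 0" for u by (auto intro!: Bochner_Integration.integral_nonneg weight_density_nonneg)
  then have "?D + 3 * (?W u + ?W w + C) \<ge> 0" using C(1) by (auto intro!: add_nonneg_nonneg)
  moreover have "(LINT x|lborel. log_modulus e (cmod (sfun u x)) (cmod (sfun w x)) * cmod (sfun v x))
      \<le> (?D + 3 * (?W u + ?W w + C)) * norm v" for v :: "'n Sigma_space"
  proof -
    have "(LINT x|lborel. log_modulus e (cmod (sfun u x)) (cmod (sfun w x)) * cmod (sfun v x))
      = (LINT x|lborel. norm v * (log_modulus e (cmod (sfun u x)) (cmod (sfun w x)) * cmod (sfun (sgn v) x)))"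
      by (rule integral_cong_AE, simp add: log_modulus_def, simp add: log_modulus_def)
         (use cmod_sfun_scaleR[of "norm v" "sgn v"] in \<open>eventually_elim, simp add: norm_scaleR_sgn_Sigma\<close>)
    also have "\<dots> = norm v * (LINT x|lborel. log_modulus e (cmod (sfun u x)) (cmod (sfun w x)) * cmod (sfun (sgn v) x))"
      by simp
    also have "\<dots> \<le> norm v * (?D + 3 * (?W u + ?W w + C))"
      using integrable_log_modulus(2)[of u w "sgn v"] C(2)[OF norm_sgn_Sigma_le[of v]]
      unfolding e_def by (intro mult_left_mono) auto
    finally show ?thesis by (simp add: mult.commute)
  qed
  ultimately show ?thesis by blast
qed

text \<open>Of the powers 1 - e, 1 and 1 + e of a number \<open>c\<close> in the unit interval, the
  first is the largest.\<close>

lemma log_modulus_scale_le: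
  assumes "0 < e" "e < 1" "0 \<le> c" "c \<le> 1" "0 \<le> t"
  shows "log_modulus e s (c * t) \<le> c powr (1 - e) * log_modulus e s t"
proof -
  have "c powr (1 + e) \<le> c powr (1 - e)" "c powr 1 \<le> c powr (1 - e)"
    using assms powr_mono'[of "1 - e" "1 + e" c] powr_mono'[of "1 - e" 1 c] by simp_all
  then have "c powr (1 + e) * t powr (1 + e) \<le> c powr (1 - e) * t powr (1 + e)"
    "c * (s powr e * t) \<le> c powr (1 - e) * (s powr e * t)"
    using assms by (auto intro!: mult_right_mono)
  then show ?thesis
    using assms by (simp add: log_modulus_def powr_mult distrib_left mult_ac)
qed

text \<open>Both \<open>w\<close> and \<open>v\<close> are normalised; the scaling of the modulus
  yields the rate \<open>norm w powr (1 - e)\<close>, and the constant depends on \<open>u\<close>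
  alone. This rate gives both differentiability and continuity of the derivative.\<close>

lemma integral_log_modulus_small:
  fixes u :: "'n::finite Sigma_space"
  defines "e \<equiv> 1 / (2 * real CARD('n))"
  shows "\<exists>K\<ge>0. \<forall>w v :: 'n Sigma_space. norm w \<le> 1 \<longrightarrow>
    (LINT x|lborel. log_modulus e (cmod (sfun u x)) (cmod (sfun w x)) * cmod (sfun v x)) \<le> K * norm w powr (1 - e) * norm v"
proof -
  note e = exponent_bounds[where 'n = 'n, folded e_def]
  let ?W = "\<lambda>u :: 'n Sigma_space. LINT x|lborel. weight_density CARD('n) (norm x) (cmod (sfun u x))"
  let ?D = "LINT x|lborel. (1 / (1 + norm (x :: real^'n))) ^ (2 * CARD('n))"
  obtain C where C: "C \<ge> 0" "\<And>u :: 'n Sigma_space. norm u \<le> 1 \<Longrightarrow> ?W u \<le> C"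
    using integral_weight_density_bounded[where 'n = 'n] by blast
  have "?D \<ge> 0" "?W u \<ge> 0" by (auto intro!: Bochner_Integration.integral_nonneg weight_density_nonneg)
  then have "?D + 3 * (?W u + C + C) \<ge> 0" using C(1) by (auto intro!: add_nonneg_nonneg)
  moreover have "(LINT x|lborel. log_modulus e (cmod (sfun u x)) (cmod (sfun w x)) * cmod (sfun v x))
      \<le> (?D + 3 * (?W u + C + C)) * norm w powr (1 - e) * norm v" if w: "norm w \<le> 1" for v w :: "'n Sigma_space"
  proof -
    let ?c = "norm w powr (1 - e) * norm v"
    have "(LINT x|lborel. log_modulus e (cmod (sfun u x)) (cmod (sfun w x)) * cmod (sfun v x))
      \<le> (LINT x|lborel. ?c * (log_modulus e (cmod (sfun u x)) (cmod (sfun (sgn w) x)) * cmod (sfun (sgn v) x)))"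
    proof (rule integral_mono_AE)
      show "AE x in lborel. log_modulus e (cmod (sfun u x)) (cmod (sfun w x)) * cmod (sfun v x)
        \<le> ?c * (log_modulus e (cmod (sfun u x)) (cmod (sfun (sgn w) x)) * cmod (sfun (sgn v) x))"
        using cmod_sfun_scaleR[of "norm v" "sgn v"] cmod_sfun_scaleR[of "norm w" "sgn w"]
      proof eventually_elim
        case (elim x)
        then have *: "cmod (sfun v x) = norm v * cmod (sfun (sgn v) x)" "cmod (sfun w x) = norm w * cmod (sfun (sgn w) x)"
          by (simp_all add: norm_scaleR_sgn_Sigma)
        have "log_modulus e (cmod (sfun u x)) (cmod (sfun w x)) * cmod (sfun v x)
            \<le> (norm w powr (1 - e) * log_modulus e (cmod (sfun u x)) (cmod (sfun (sgn w) x))) * (norm v * cmod (sfun (sgn v) x))"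
          unfolding * using w by (intro mult_right_mono log_modulus_scale_le e) auto
        then show ?case by (simp add: mult_ac)
      qed
    qed (use integrable_log_modulus(1)[of u] in \<open>auto simp: e_def\<close>)
    also have "\<dots> = ?c * (LINT x|lborel. log_modulus e (cmod (sfun u x)) (cmod (sfun (sgn w) x)) * cmod (sfun (sgn v) x))"
      by simp
    also have "\<dots> \<le> ?c * (?D + 3 * (?W u + C + C))"
      using integrable_log_modulus(2)[of u "sgn w" "sgn v"] C(2)[OF norm_sgn_Sigma_le[of v]] C(2)[OF norm_sgn_Sigma_le[of w]]
      unfolding e_def by (intro mult_left_mono) auto
    finally show ?thesis by (simp add: mult_ac)
  qed
  ultimately show ?thesis by blast
qed

section \<open>Differentiability of the energy\<close>

definition gradient_form :: "'n::finite Sigma_space \<Rightarrow> 'n Sigma_space \<Rightarrow> real" where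
  "gradient_form u v = (LINT x|lborel. inner (sgrad u x) (sgrad v x))"

text \<open>The difference of the inner product and the gradient form is the part weighted by |x|^2.
  Written this way, bilinearity and boundedness are inherited from those two forms.\<close>

definition quadratic_form :: "real \<Rightarrow> 'n::finite Sigma_space \<Rightarrow> 'n Sigma_space \<Rightarrow> real" where
  "quadratic_form c u v = gradient_form u v + c * (inner u v - gradient_form u v)"

definition log_energy :: "'n::finite Sigma_space \<Rightarrow> real" where
  "log_energy u = (LINT x|lborel. log_potential (sfun u x))"

definition log_pairing :: "'n::finite Sigma_space \<Rightarrow> 'n Sigma_space \<Rightarrow> real" where
  "log_pairing u v = (LINT x|lborel. inner (log_gradient (sfun u x)) (sfun v x))"

lemma integrable_inner_sgrad:
  "integrable lborel (\<lambda>x. inner (sgrad u x) (sgrad v x))" for u v :: "'n::finite Sigma_space"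
  by (rule square_integrable_bilinear[OF sgrad(1)[of u] sgrad(1)[of v]]) (auto simp: Cauchy_Schwarz_ineq2)

lemma inner_Sigma_eq:
  fixes u v :: "'n::finite Sigma_space"
  shows "integrable lborel (\<lambda>x. (norm x)\<^sup>2 * inner (sfun u x) (sfun v x))" (is ?int)
    and "inner u v = gradient_form u v + (LINT x|lborel. (norm x)\<^sup>2 * inner (sfun u x) (sfun v x))"
proof -
  show ?int
    using Bochner_Integration.integrable_diff[OF inner_Sigma_integrable[of u v] integrable_inner_sgrad[of u v]] by simp
  then show "inner u v = gradient_form u v + (LINT x|lborel. (norm x)\<^sup>2 * inner (sfun u x) (sfun v x))"
    unfolding inner_Sigma_space_def gradient_form_def using integrable_inner_sgrad[of u v] by simp
qed

lemma gradient_form_commute: "gradient_form u v = gradient_form v u"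
  by (simp add: gradient_form_def inner_commute)

lemma gradient_form_add_left: "gradient_form (u + v) w = gradient_form u w + gradient_form v w"
  for u v w :: "'n::finite Sigma_space"
proof -
  have "gradient_form (u + v) w = (LINT x|lborel. inner (sgrad u x) (sgrad w x) + inner (sgrad v x) (sgrad w x))"
    unfolding gradient_form_def
    by (rule integral_cong_AE, measurable) (use sgrad_add[of u v] in \<open>eventually_elim, simp add: inner_add_left\<close>)
  then show ?thesis
    using integrable_inner_sgrad[of u w] integrable_inner_sgrad[of v w] by (simp add: gradient_form_def)
qed

lemma gradient_form_scaleR_left: "gradient_form (c *\<^sub>R u) v = c * gradient_form u v"
  for u v :: "'n::finite Sigma_space"
proof -
  have "gradient_form (c *\<^sub>R u) v = (LINT x|lborel. c * inner (sgrad u x) (sgrad v x))"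
    unfolding gradient_form_def
    by (rule integral_cong_AE, measurable) (use sgrad_scaleR[of c u] in \<open>eventually_elim, simp\<close>)
  then show ?thesis by (simp add: gradient_form_def)
qed

text \<open>On the unit ball the pointwise bound by half the sum of squares gives 1; bilinearity
  applied to \<open>sgn u\<close> and \<open>sgn v\<close> gives the general case.\<close>

lemma abs_gradient_form_le: "\<bar>gradient_form u v\<bar> \<le> norm u * norm v" for u v :: "'n::finite Sigma_space"
proof -
  have "\<bar>gradient_form u v\<bar> \<le> 1" if "norm u \<le> 1" "norm v \<le> 1" for u v :: "'n Sigma_space"
  proof -
    have G: "(LINT x|lborel. (norm (sgrad w x))\<^sup>2) \<le> (norm w)\<^sup>2" for w :: "'n Sigma_space"
      unfolding Sigma_norm_sq by simp
    have "\<bar>gradient_form u v\<bar> \<le> (LINT x|lborel. \<bar>inner (sgrad u x) (sgrad v x)\<bar>)"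
      unfolding gradient_form_def by (rule integral_abs_bound)
    also have "\<dots> \<le> (LINT x|lborel. 1/2 * (norm (sgrad u x))\<^sup>2 + 1/2 * (norm (sgrad v x))\<^sup>2)"
    proof (intro integral_mono integrable_abs integrable_inner_sgrad Bochner_Integration.integrable_add integrable_mult_right Sigma_integrable)
      fix x
      show "\<bar>inner (sgrad u x) (sgrad v x)\<bar> \<le> 1/2 * (norm (sgrad u x))\<^sup>2 + 1/2 * (norm (sgrad v x))\<^sup>2"
        using Cauchy_Schwarz_ineq2[of "sgrad u x" "sgrad v x"] sum_squares_bound[of "norm (sgrad u x)" "norm (sgrad v x)"]
        by linarith
    qed
    also have "\<dots> = 1/2 * (LINT x|lborel. (norm (sgrad u x))\<^sup>2) + 1/2 * (LINT x|lborel. (norm (sgrad v x))\<^sup>2)"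
      using Sigma_integrable(1)[of u] Sigma_integrable(1)[of v] by simp
    also have "\<dots> \<le> 1/2 * (norm u)\<^sup>2 + 1/2 * (norm v)\<^sup>2"
      by (intro add_mono mult_left_mono G) auto
    also have "\<dots> \<le> 1"
      using power_le_one[OF norm_ge_zero that(1), of 2] power_le_one[OF norm_ge_zero that(2), of 2] by linarith
    finally show ?thesis .
  qed
  then have 1: "\<bar>gradient_form (sgn u) (sgn v)\<bar> \<le> 1" by (simp add: norm_sgn_Sigma_le)
  have "gradient_form u v = gradient_form (norm u *\<^sub>R sgn u) (norm v *\<^sub>R sgn v)"
    by (simp only: norm_scaleR_sgn_Sigma)
  also have "\<dots> = norm u * (norm v * gradient_form (sgn u) (sgn v))"
    by (simp only: gradient_form_scaleR_left gradient_form_commute[of "sgn u"])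
  finally show ?thesis
    using mult_left_mono[OF 1, of "norm u * norm v"] by (simp add: abs_mult mult.assoc)
qed

lemma bounded_bilinear_gradient_form: "bounded_bilinear (gradient_form :: 'n::finite Sigma_space \<Rightarrow> _)"
proof
  fix a b c :: "'n Sigma_space" and r :: real
  show "gradient_form (a + b) c = gradient_form a c + gradient_form b c" by (rule gradient_form_add_left)
  show "gradient_form a (b + c) = gradient_form a b + gradient_form a c"
    by (simp add: gradient_form_commute[of a] gradient_form_add_left)
  show "gradient_form (r *\<^sub>R a) b = r *\<^sub>R gradient_form a b" by (simp add: gradient_form_scaleR_left)
  show "gradient_form a (r *\<^sub>R b) = r *\<^sub>R gradient_form a b"
    by (simp add: gradient_form_commute[of a] gradient_form_scaleR_left)
  show "\<exists>K. \<forall>a b :: 'n Sigma_space. norm (gradient_form a b) \<le> norm a * norm b * K"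
    by (rule exI[of _ 1]) (simp add: abs_gradient_form_le)
qed

lemma bounded_bilinear_quadratic_form: "bounded_bilinear (quadratic_form c :: 'n::finite Sigma_space \<Rightarrow> _)"
proof -
  interpret g: bounded_bilinear "gradient_form :: 'n Sigma_space \<Rightarrow> _" by (rule bounded_bilinear_gradient_form)
  show ?thesis
  proof
    fix u v w :: "'n Sigma_space" and r :: real
    show "quadratic_form c (u + v) w = quadratic_form c u w + quadratic_form c v w"
      "quadratic_form c u (v + w) = quadratic_form c u v + quadratic_form c u w"
      "quadratic_form c (r *\<^sub>R u) v = r *\<^sub>R quadratic_form c u v"
      "quadratic_form c u (r *\<^sub>R v) = r *\<^sub>R quadratic_form c u v"
      by (simp_all add: quadratic_form_def g.add_left g.add_right g.scaleR_left g.scaleR_right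
          inner_add_left inner_add_right algebra_simps)
    show "\<exists>K. \<forall>u v :: 'n Sigma_space. norm (quadratic_form c u v) \<le> norm u * norm v * K"
    proof (intro exI allI)
      fix u v :: "'n Sigma_space"
      have "norm (quadratic_form c u v) \<le> \<bar>gradient_form u v\<bar> + \<bar>c\<bar> * (\<bar>inner u v\<bar> + \<bar>gradient_form u v\<bar>)"
        unfolding quadratic_form_def real_norm_def
        by (intro order_trans[OF abs_triangle_ineq] add_mono order_refl)
           (simp add: abs_mult mult_left_mono abs_triangle_ineq4)
      also have "\<dots> \<le> norm u * norm v + \<bar>c\<bar> * (norm u * norm v + norm u * norm v)"
        by (intro add_mono mult_left_mono abs_gradient_form_le Cauchy_Schwarz_ineq2) auto
      also have "\<dots> = norm u * norm v * (1 + 2 * \<bar>c\<bar>)" by (simp add: algebra_simps)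
      finally show "norm (quadratic_form c u v) \<le> norm u * norm v * (1 + 2 * \<bar>c\<bar>)" .
    qed
  qed
qed

lemma quadratic_form_commute: "quadratic_form c u v = quadratic_form c v u"
  by (simp add: quadratic_form_def gradient_form_commute inner_commute)

section \<open>The logarithmic part of the energy\<close>

lemma measurable_log_gradient [measurable]: "log_gradient \<in> borel_measurable borel"
  unfolding log_gradient_def by measurable

lemma measurable_log_potential [measurable]: "log_potential \<in> borel_measurable borel"
  unfolding log_potential_def by measurable

lemma log_modulus_zero_le: "0 \<le> t \<Longrightarrow> log_modulus e 0 t \<le> log_modulus e s t"
  by (simp add: log_modulus_def)

lemma integrable_log_pairing:
  "integrable lborel (\<lambda>x. cmod (log_gradient (sfun u x)) * cmod (sfun v x))"
  "integrable lborel (\<lambda>x. inner (log_gradient (sfun u x)) (sfun v x))"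
  for u v :: "'n::finite Sigma_space"
proof -
  let ?e = "1 / (2 * real CARD('n))"
  note e = exponent_bounds[where 'n = 'n]
  have B: "integrable lborel (\<lambda>x. (4 / ?e + 3) * (log_modulus ?e (cmod (sfun u x)) (cmod (sfun u x)) * cmod (sfun v x)))"
    by (intro integrable_mult_right integrable_log_modulus)
  have le: "cmod (log_gradient (sfun u x)) * cmod (sfun v x)
      \<le> (4 / ?e + 3) * (log_modulus ?e (cmod (sfun u x)) (cmod (sfun u x)) * cmod (sfun v x))" for x
  proof -
    have "cmod (log_gradient (sfun u x)) \<le> (4 / ?e + 3) * log_modulus ?e 0 (cmod (sfun u x))"
      using log_gradient_diff_le[OF e, of "sfun u x" 0] by (simp add: log_gradient_def)
    \<comment> \<open>The first argument is raised from 0 to |u(x)|, so that both arguments are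
      moduli of representatives, as in \<open>integrable_log_modulus\<close>.\<close>
    also have "\<dots> \<le> (4 / ?e + 3) * log_modulus ?e (cmod (sfun u x)) (cmod (sfun u x))"
      using e by (intro mult_left_mono log_modulus_zero_le) auto
    finally show ?thesis unfolding mult.assoc[symmetric] by (rule mult_right_mono) simp
  qed
  show i: "integrable lborel (\<lambda>x. cmod (log_gradient (sfun u x)) * cmod (sfun v x))"
  proof (rule Bochner_Integration.integrable_bound[OF B])
    show "AE x in lborel. norm (cmod (log_gradient (sfun u x)) * cmod (sfun v x))
      \<le> norm ((4 / ?e + 3) * (log_modulus ?e (cmod (sfun u x)) (cmod (sfun u x)) * cmod (sfun v x)))"
    proof (rule AE_I2)
      fix x
      have "0 \<le> cmod (log_gradient (sfun u x)) * cmod (sfun v x)" by simp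
      with le[of x] show "norm (cmod (log_gradient (sfun u x)) * cmod (sfun v x))
        \<le> norm ((4 / ?e + 3) * (log_modulus ?e (cmod (sfun u x)) (cmod (sfun u x)) * cmod (sfun v x)))"
        unfolding real_norm_def by linarith
    qed
  qed measurable
  show "integrable lborel (\<lambda>x. inner (log_gradient (sfun u x)) (sfun v x))"
    by (rule Bochner_Integration.integrable_bound[OF i]) (auto simp: Cauchy_Schwarz_ineq2)
qed

text \<open>Up to the mass, the potential is half the integrand of
  \<open>log_pairing u u\<close>.\<close>

lemma integrable_log_potential: "integrable lborel (\<lambda>x. log_potential (sfun u x))"
  for u :: "'n::finite Sigma_space"
proof -
  have eq: "log_potential z = 1/2 * (inner (log_gradient z) z - (cmod z)\<^sup>2)" for z
    by (simp add: log_potential_def log_gradient_def power2_norm_eq_inner algebra_simps)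
  show ?thesis unfolding eq
    by (intro integrable_mult_right Bochner_Integration.integrable_diff integrable_log_pairing(2) Sigma_integrable(3))
qed

lemma log_pairing_increment:
  fixes u :: "'n::finite Sigma_space"
  defines "e \<equiv> 1 / (2 * real CARD('n))"
  shows "\<bar>log_pairing (u + w) v - log_pairing u v\<bar> \<le>
    (4 / e + 3) * (LINT x|lborel. log_modulus e (cmod (sfun u x)) (cmod (sfun w x)) * cmod (sfun v x))"
proof -
  note e = exponent_bounds[where 'n = 'n, folded e_def]
  have "\<bar>log_pairing (u + w) v - log_pairing u v\<bar>
     = \<bar>LINT x|lborel. inner (log_gradient (sfun (u + w) x)) (sfun v x) - inner (log_gradient (sfun u x)) (sfun v x)\<bar>"
    unfolding log_pairing_def using integrable_log_pairing(2)[of _ v] by simp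
  also have "\<dots> \<le> (LINT x|lborel. \<bar>inner (log_gradient (sfun (u + w) x)) (sfun v x) - inner (log_gradient (sfun u x)) (sfun v x)\<bar>)"
    by (rule integral_abs_bound)
  also have "\<dots> \<le> (LINT x|lborel. (4 / e + 3) * (log_modulus e (cmod (sfun u x)) (cmod (sfun w x)) * cmod (sfun v x)))"
  proof (rule integral_mono_AE)
    show "AE x in lborel. \<bar>inner (log_gradient (sfun (u + w) x)) (sfun v x) - inner (log_gradient (sfun u x)) (sfun v x)\<bar>
      \<le> (4 / e + 3) * (log_modulus e (cmod (sfun u x)) (cmod (sfun w x)) * cmod (sfun v x))"
      using sfun_add[of u w]
    proof eventually_elim
      case (elim x)
      have "\<bar>inner (log_gradient (sfun (u + w) x)) (sfun v x) - inner (log_gradient (sfun u x)) (sfun v x)\<bar>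
         \<le> cmod (log_gradient (sfun (u + w) x) - log_gradient (sfun u x)) * cmod (sfun v x)"
        unfolding inner_diff_left[symmetric] by (rule Cauchy_Schwarz_ineq2)
      also have "\<dots> \<le> ((4 / e + 3) * log_modulus e (cmod (sfun u x)) (cmod (sfun w x))) * cmod (sfun v x)"
        using log_gradient_diff_le[OF e, of "sfun u x + sfun w x" "sfun u x"] elim by (intro mult_right_mono) auto
      finally show ?case by (simp only: mult.assoc)
    qed
  qed (auto simp: e_def intro!: integrable_mult_right integrable_log_modulus Bochner_Integration.integrable_diff integrable_log_pairing)
  finally show ?thesis by simp
qed

lemma log_energy_increment:
  fixes u :: "'n::finite Sigma_space"
  defines "e \<equiv> 1 / (2 * real CARD('n))"
  shows "\<bar>log_energy (u + w) - log_energy u - log_pairing u w\<bar> \<le>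
    (4 / e + 3) * (LINT x|lborel. log_modulus e (cmod (sfun u x)) (cmod (sfun w x)) * cmod (sfun w x))"
proof -
  note e = exponent_bounds[where 'n = 'n, folded e_def]
  have "\<bar>log_energy (u + w) - log_energy u - log_pairing u w\<bar>
     = \<bar>LINT x|lborel. log_potential (sfun (u + w) x) - log_potential (sfun u x) - inner (log_gradient (sfun u x)) (sfun w x)\<bar>"
    unfolding log_pairing_def log_energy_def using integrable_log_pairing(2)[of u w] integrable_log_potential[of u] integrable_log_potential[of "u + w"] by simp
  also have "\<dots> \<le> (LINT x|lborel. \<bar>log_potential (sfun (u + w) x) - log_potential (sfun u x) - inner (log_gradient (sfun u x)) (sfun w x)\<bar>)"
    by (rule integral_abs_bound)
  also have "\<dots> \<le> (LINT x|lborel. (4 / e + 3) * (log_modulus e (cmod (sfun u x)) (cmod (sfun w x)) * cmod (sfun w x)))"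
  proof (rule integral_mono_AE)
    show "AE x in lborel. \<bar>log_potential (sfun (u + w) x) - log_potential (sfun u x) - inner (log_gradient (sfun u x)) (sfun w x)\<bar>
      \<le> (4 / e + 3) * (log_modulus e (cmod (sfun u x)) (cmod (sfun w x)) * cmod (sfun w x))"
      using sfun_add[of u w]
      by eventually_elim (use log_potential_taylor[OF e] in \<open>simp add: mult.assoc\<close>)
  qed (auto simp: e_def intro!: integrable_mult_right integrable_log_modulus Bochner_Integration.integrable_diff
        integrable_log_pairing integrable_log_potential)
  finally show ?thesis by simp
qed

lemma bounded_linear_log_pairing: "bounded_linear (log_pairing u)" for u :: "'n::finite Sigma_space"
proof -
  let ?e = "1 / (2 * real CARD('n))"
  note e = exponent_bounds[where 'n = 'n]
  obtain K where K: "\<And>v :: 'n Sigma_space.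
    (LINT x|lborel. log_modulus ?e (cmod (sfun 0 x)) (cmod (sfun u x)) * cmod (sfun v x)) \<le> K * norm v"
    using integral_log_modulus_bound[of 0 u] by blast
  have z: "log_pairing 0 v = 0" for v :: "'n Sigma_space"
    unfolding log_pairing_def
    by (rule integral_eq_zero_AE) (use sfun_zero in \<open>eventually_elim, simp add: log_gradient_def\<close>)
  show ?thesis
  proof (rule bounded_linear_intro)
    fix v w :: "'n Sigma_space" and c :: real
    have "log_pairing u (v + w) = (LINT x|lborel. inner (log_gradient (sfun u x)) (sfun v x) + inner (log_gradient (sfun u x)) (sfun w x))"
      unfolding log_pairing_def
      by (rule integral_cong_AE, measurable) (use sfun_add[of v w] in \<open>eventually_elim, simp add: inner_add_right\<close>)
    then show "log_pairing u (v + w) = log_pairing u v + log_pairing u w"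
      unfolding log_pairing_def using integrable_log_pairing(2)[of u v] integrable_log_pairing(2)[of u w] by simp
    have "log_pairing u (c *\<^sub>R v) = (LINT x|lborel. c * inner (log_gradient (sfun u x)) (sfun v x))"
      unfolding log_pairing_def
      by (rule integral_cong_AE, measurable) (use sfun_scaleR[of c v] in \<open>eventually_elim, simp\<close>)
    then show "log_pairing u (c *\<^sub>R v) = c *\<^sub>R log_pairing u v"
      by (simp add: log_pairing_def)
    \<comment> \<open>Boundedness is the increment estimate from base point 0 with increment
      \<open>u\<close>, whose norm is arbitrary.\<close>
    have "norm (log_pairing u v) = \<bar>log_pairing (0 + u) v - log_pairing 0 v\<bar>"
      by (simp add: z)
    also have "\<dots> \<le> (4 / ?e + 3) * (LINT x|lborel. log_modulus ?e (cmod (sfun 0 x)) (cmod (sfun u x)) * cmod (sfun v x))"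
      by (rule log_pairing_increment)
    also have "\<dots> \<le> (4 / ?e + 3) * (K * norm v)"
      using e by (intro mult_left_mono K) auto
    also have "\<dots> = norm v * ((4 / ?e + 3) * K)" by (simp only: mult_ac)
    finally show "norm (log_pairing u v) \<le> norm v * ((4 / ?e + 3) * K)" .
  qed
qed

text \<open>One constant for both estimates: the first is Hoelder continuity of order 1 - e of the
  derivative at \<open>u\<close>, uniformly over \<open>v\<close> in the unit ball; the second is a
  Taylor remainder of order 2 - e.\<close>

lemma log_pairing_small:
  fixes u :: "'n::finite Sigma_space"
  defines "e \<equiv> 1 / (2 * real CARD('n))"
  obtains K where "K \<ge> 0"
    and "\<And>w v. norm w \<le> 1 \<Longrightarrow> \<bar>log_pairing (u + w) v - log_pairing u v\<bar> \<le> K * norm w powr (1 - e) * norm v"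
    and "\<And>w. norm w \<le> 1 \<Longrightarrow> \<bar>log_energy (u + w) - log_energy u - log_pairing u w\<bar> \<le> K * norm w powr (1 - e) * norm w"
proof -
  note e = exponent_bounds[where 'n = 'n, folded e_def]
  have ce: "4 / e + 3 \<ge> 0" using e by simp
  obtain K where K: "K \<ge> 0" "\<And>w v :: 'n Sigma_space. norm w \<le> 1 \<Longrightarrow>
    (LINT x|lborel. log_modulus e (cmod (sfun u x)) (cmod (sfun w x)) * cmod (sfun v x)) \<le> K * norm w powr (1 - e) * norm v"
    using integral_log_modulus_small[of u] unfolding e_def by blast
  show thesis
  proof (rule that[of "(4 / e + 3) * K"])
    show "0 \<le> (4 / e + 3) * K" using ce K(1) by (rule mult_nonneg_nonneg)
    fix w v :: "'n Sigma_space" assume w: "norm w \<le> 1"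
    show "\<bar>log_pairing (u + w) v - log_pairing u v\<bar> \<le> (4 / e + 3) * K * norm w powr (1 - e) * norm v"
      using log_pairing_increment[of u w v] mult_left_mono[OF K(2)[OF w, of v] ce] unfolding e_def mult.assoc by linarith
  next
    fix w :: "'n Sigma_space" assume w: "norm w \<le> 1"
    show "\<bar>log_energy (u + w) - log_energy u - log_pairing u w\<bar> \<le> (4 / e + 3) * K * norm w powr (1 - e) * norm w"
      using log_energy_increment[of u w] mult_left_mono[OF K(2)[OF w, of w] ce] unfolding e_def mult.assoc by linarith
  qed
qed

lemma tendsto_norm_diff_powr:
  fixes u :: "'a::real_normed_vector"
  assumes "0 < p"
  shows "((\<lambda>y. K * norm (y - u) powr p) \<longlongrightarrow> 0) (at u)"
proof -
  have "((\<lambda>y. norm (y - u)) \<longlongrightarrow> 0) (at u)"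
    by (intro tendsto_norm_zero) (simp add: LIM_zero)
  then have "((\<lambda>y. norm (y - u) powr p) \<longlongrightarrow> 0) (at u)"
    by (rule tendsto_zero_powrI[OF _ tendsto_const]) (use assms in auto)
  then show ?thesis by (rule tendsto_mult_right_zero)
qed

lemma log_energy_has_derivative:
  "(log_energy has_derivative log_pairing u) (at u)" for u :: "'n::finite Sigma_space"
proof -
  let ?e = "1 / (2 * real CARD('n))"
  obtain K where K: "\<And>w. norm w \<le> 1 \<Longrightarrow>
      \<bar>log_energy (u + w) - log_energy u - log_pairing u w\<bar> \<le> K * norm w powr (1 - ?e) * norm w"
    by (rule log_pairing_small[of u]) blast
  show ?thesis
  proof (rule has_derivativeI_sandwich[of 1])
    show "bounded_linear (log_pairing u)" by (rule bounded_linear_log_pairing)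
    show "norm (log_energy y - log_energy u - log_pairing u (y - u)) / norm (y - u) \<le> K * norm (y - u) powr (1 - ?e)"
      if "y \<noteq> u" "dist y u < 1" for y
      using K[of "y - u"] that by (simp add: dist_norm divide_le_eq)
    show "((\<lambda>y. K * norm (y - u) powr (1 - ?e)) \<longlongrightarrow> 0) (at u)"
      using exponent_bounds[where 'n = 'n] by (intro tendsto_norm_diff_powr) simp
  qed simp
qed

section \<open>The derivative of the full energy\<close>

lemma energy_eq: "energy \<gamma> u = 1 / 2 * quadratic_form (\<gamma> * (\<gamma> - 1)) u u - log_energy u"
  for u :: "'n::finite Sigma_space"
proof -
  have 1: "log_energy u = 1 / 2 * (LINT x|lborel. (cmod (sfun u x))\<^sup>2 * ln ((cmod (sfun u x))\<^sup>2))"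
    unfolding log_energy_def log_potential_def by simp
  have 2: "gradient_form u u = (LINT x|lborel. (norm (sgrad u x))\<^sup>2)"
    by (simp add: gradient_form_def power2_norm_eq_inner)
  have 3: "inner u u - gradient_form u u = (LINT x|lborel. (norm x)\<^sup>2 * (cmod (sfun u x))\<^sup>2)"
    by (simp add: inner_Sigma_eq(2) power2_norm_eq_inner)
  show ?thesis unfolding energy_def quadratic_form_def 1 3 unfolding 2 by (simp add: distrib_left)
qed

lemma integrable_energy_deriv_integrand:
  "integrable lborel (energy_deriv_integrand \<gamma> u v)" for u v :: "'n::finite Sigma_space"
proof -
  have [measurable]: "cnj \<in> borel_measurable borel"
    by (intro borel_measurable_continuous_onI continuous_intros)
  have 1: "integrable lborel (\<lambda>x. \<Sum>i\<in>UNIV. sgrad u x $ i * cnj (sgrad v x $ i))"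
  proof (rule Bochner_Integration.integrable_sum)
    fix i
    note s = square_integrable_component[OF sgrad(1)[of u], of i] square_integrable_component[OF sgrad(1)[of v], of i]
    have [measurable]: "(\<lambda>x. sgrad u x $ i) \<in> borel_measurable borel" "(\<lambda>x. sgrad v x $ i) \<in> borel_measurable borel"
      using s by (simp_all add: square_integrable_def)
    show "integrable lborel (\<lambda>x. sgrad u x $ i * cnj (sgrad v x $ i))"
      by (rule square_integrable_bilinear[OF s], measurable) (simp add: norm_mult)
  qed
  have 2: "integrable lborel (\<lambda>x. of_real (\<gamma> * (\<gamma> - 1) * (norm x)\<^sup>2) * sfun u x * cnj (sfun v x))"
  proof -
    \<comment> \<open>The weight |x|^2 is shared between the two factors, each of which is then
      square integrable.\<close>
    have "integrable lborel (\<lambda>x. of_real (\<gamma> * (\<gamma> - 1)) * (of_real ((norm x)\<^sup>2) * sfun u x * cnj (sfun v x)))"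
      by (intro integrable_mult_right square_integrable_bilinear[OF sfun_square_integrable(2)[of u] sfun_square_integrable(2)[of v]])
         (auto simp: norm_mult power2_eq_square)
    then show ?thesis by (simp add: mult_ac)
  qed
  have 3: "integrable lborel (\<lambda>x. log_gradient (sfun u x) * cnj (sfun v x))"
    by (rule Bochner_Integration.integrable_bound[OF integrable_log_pairing(1)[of u v]]) (auto simp: norm_mult)
  have "energy_deriv_integrand \<gamma> u v = (\<lambda>x. (\<Sum>i\<in>UNIV. sgrad u x $ i * cnj (sgrad v x $ i))
     + of_real (\<gamma> * (\<gamma> - 1) * (norm x)\<^sup>2) * sfun u x * cnj (sfun v x)
     - log_gradient (sfun u x) * cnj (sfun v x))"
    by (rule ext) (simp add: energy_deriv_integrand_def log_gradient_def scaleR_conv_of_real algebra_simps)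
  then show ?thesis using 1 2 3 by simp
qed

text \<open>The real part of \<open>a * cnj b\<close> is the real inner product; the two terms
  without derivatives or weight combine into \<open>log_gradient\<close>.\<close>

lemma energy_deriv_pairing_eq:
  "energy_deriv_pairing \<gamma> u v = quadratic_form (\<gamma> * (\<gamma> - 1)) u v - log_pairing u v"
  for u v :: "'n::finite Sigma_space"
proof -
  have re: "Re (a * cnj b) = inner a b" for a b by (simp add: inner_complex_def)
  have "energy_deriv_pairing \<gamma> u v = (LINT x|lborel. Re (energy_deriv_integrand \<gamma> u v x))"
    unfolding energy_deriv_pairing_def by (rule integral_Re[OF integrable_energy_deriv_integrand, symmetric])
  also have "\<dots> = (LINT x|lborel. inner (sgrad u x) (sgrad v x)
      + \<gamma> * (\<gamma> - 1) * ((norm x)\<^sup>2 * inner (sfun u x) (sfun v x)) - inner (log_gradient (sfun u x)) (sfun v x))"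
  proof (rule Bochner_Integration.integral_cong[OF refl])
    fix x
    have "energy_deriv_integrand \<gamma> u v x = (\<Sum>i\<in>UNIV. sgrad u x $ i * cnj (sgrad v x $ i))
     + (\<gamma> * (\<gamma> - 1) * (norm x)\<^sup>2) *\<^sub>R (sfun u x * cnj (sfun v x))
     - log_gradient (sfun u x) * cnj (sfun v x)"
      by (simp add: energy_deriv_integrand_def log_gradient_def scaleR_conv_of_real algebra_simps)
    then show "Re (energy_deriv_integrand \<gamma> u v x) = inner (sgrad u x) (sgrad v x)
      + \<gamma> * (\<gamma> - 1) * ((norm x)\<^sup>2 * inner (sfun u x) (sfun v x)) - inner (log_gradient (sfun u x)) (sfun v x)"
      by (simp only: minus_complex.sel plus_complex.sel Re_sum scaleR_complex.sel re inner_vec_def mult.assoc)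
  qed
  also have "\<dots> = gradient_form u v + \<gamma> * (\<gamma> - 1) * (LINT x|lborel. (norm x)\<^sup>2 * inner (sfun u x) (sfun v x)) - log_pairing u v"
    unfolding gradient_form_def log_pairing_def
    using integrable_inner_sgrad[of u v] inner_Sigma_eq(1)[of u v] integrable_log_pairing(2)[of u v]
    by simp
  finally show ?thesis by (simp add: quadratic_form_def inner_Sigma_eq(2)[of u v])
qed

text \<open>The product rule yields the quadratic form twice, by symmetry, and the factor 1/2
  cancels this.\<close>

lemma energy_has_derivative:
  "(energy \<gamma> has_derivative energy_deriv_pairing \<gamma> u) (at u)" for u :: "'n::finite Sigma_space"
proof -
  let ?Q = "quadratic_form (\<gamma> * (\<gamma> - 1)) :: 'n Sigma_space \<Rightarrow> _"
  have "((\<lambda>u. 1 / 2 * ?Q u u - log_energy u) has_derivative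
      (\<lambda>h. 1 / 2 * (?Q u h + ?Q h u) - log_pairing u h)) (at u)"
    by (intro has_derivative_diff has_derivative_mult_right log_energy_has_derivative
        bounded_bilinear.FDERIV[OF bounded_bilinear_quadratic_form] has_derivative_ident)
  moreover have "energy_deriv_pairing \<gamma> u = (\<lambda>h. 1 / 2 * (?Q u h + ?Q h u) - log_pairing u h)"
    by (rule ext) (simp add: energy_deriv_pairing_eq quadratic_form_commute[of _ _ u])
  moreover have "energy \<gamma> = (\<lambda>u. 1 / 2 * ?Q u u - log_energy u)"
    by (rule ext) (rule energy_eq)
  ultimately show ?thesis by simp
qed

text \<open>In operator norm the quadratic part is Lipschitz and the logarithmic part is Hoelder of
  order 1 - e at each point.\<close>

lemma continuous_energy_deriv:
  fixes E' :: "'n::finite Sigma_space \<Rightarrow> ('n Sigma_space \<Rightarrow>\<^sub>L real)"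
  assumes E': "\<And>u v. blinfun_apply (E' u) v = energy_deriv_pairing \<gamma> u v"
  shows "continuous_on UNIV E'"
proof -
  let ?e = "1 / (2 * real CARD('n))" and ?Q = "quadratic_form (\<gamma> * (\<gamma> - 1)) :: 'n Sigma_space \<Rightarrow> _"
  interpret Q: bounded_bilinear ?Q by (rule bounded_bilinear_quadratic_form)
  obtain L where L: "L \<ge> 0" "\<And>u v. norm (?Q u v) \<le> norm u * norm v * L"
    using Q.nonneg_bounded by blast
  have "isCont E' u" for u
  proof -
    obtain K where K: "K \<ge> 0" "\<And>w v. norm w \<le> 1 \<Longrightarrow>
        \<bar>log_pairing (u + w) v - log_pairing u v\<bar> \<le> K * norm w powr (1 - ?e) * norm v"
      by (rule log_pairing_small[of u]) blast
    \<comment> \<open>The power 1 is written out so that \<open>tendsto_norm_diff_powr\<close>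
      applies to both summands.\<close>
    have "norm (E' y - E' u) \<le> L * norm (y - u) powr 1 + K * norm (y - u) powr (1 - ?e)"
      if "dist y u < 1" for y
    proof (rule norm_blinfun_bound)
      show "0 \<le> L * norm (y - u) powr 1 + K * norm (y - u) powr (1 - ?e)"
        using L K by simp
      fix v
      have "blinfun_apply (E' y - E' u) v = ?Q (y - u) v - (log_pairing y v - log_pairing u v)"
        by (simp add: blinfun.diff_left E' energy_deriv_pairing_eq Q.diff_left)
      then have "norm (blinfun_apply (E' y - E' u) v) \<le> norm (?Q (y - u) v) + \<bar>log_pairing y v - log_pairing u v\<bar>"
        using abs_triangle_ineq4[of "?Q (y - u) v" "log_pairing y v - log_pairing u v"] by simp
      also have "\<dots> \<le> norm (y - u) * norm v * L + K * norm (y - u) powr (1 - ?e) * norm v"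
        using L(2)[of "y - u" v] K(2)[of "y - u" v] that by (simp add: dist_norm)
      finally show "norm (blinfun_apply (E' y - E' u) v)
          \<le> (L * norm (y - u) powr 1 + K * norm (y - u) powr (1 - ?e)) * norm v"
        by (simp add: algebra_simps)
    qed
    then have ev: "\<forall>\<^sub>F y in at u. norm (E' y - E' u) \<le> L * norm (y - u) powr 1 + K * norm (y - u) powr (1 - ?e)"
      unfolding eventually_at by (intro exI[of _ 1]) auto
    have "((\<lambda>y. L * norm (y - u) powr 1 + K * norm (y - u) powr (1 - ?e)) \<longlongrightarrow> 0) (at u)"
      using exponent_bounds[where 'n = 'n] by (intro tendsto_add_zero tendsto_norm_diff_powr) auto
    then have "((\<lambda>y. E' y - E' u) \<longlongrightarrow> 0) (at u)"
      by (rule Lim_null_comparison[OF ev])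
    then show ?thesis by (simp add: isCont_def LIM_zero_iff)
  qed
  then show ?thesis by (simp add: continuous_on_eq_continuous_at)
qed

text \<open>Integrals of non-integrable functions are 0 by convention, so integrability is asserted
  along with the formulas. Continuity into the space of bounded linear functionals with the operator
  norm expresses class C^1.\<close>

theorem proposition2p1:
  fixes \<gamma> :: real
  assumes "\<gamma> > 1"
  shows "(\<forall>u :: 'n::finite Sigma_space.
            integrable lborel (\<lambda>x. (norm (sgrad u x))\<^sup>2) \<and>
            integrable lborel (\<lambda>x. (norm x)\<^sup>2 * (cmod (sfun u x))\<^sup>2) \<and>
            integrable lborel (\<lambda>x. (cmod (sfun u x))\<^sup>2 * ln ((cmod (sfun u x))\<^sup>2))) \<and>
         (\<forall>u v :: 'n Sigma_space. integrable lborel (energy_deriv_integrand \<gamma> u v)) \<and>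
         (\<exists>E' :: 'n Sigma_space \<Rightarrow> ('n Sigma_space \<Rightarrow>\<^sub>L real).
            (\<forall>u. (energy \<gamma> has_derivative blinfun_apply (E' u)) (at u)) \<and>
            (\<forall>u v. blinfun_apply (E' u) v = energy_deriv_pairing \<gamma> u v) \<and>
            continuous_on UNIV E')"
proof (intro conjI allI)
  fix u :: "'n Sigma_space"
  show "integrable lborel (\<lambda>x. (norm (sgrad u x))\<^sup>2)"
    "integrable lborel (\<lambda>x. (norm x)\<^sup>2 * (cmod (sfun u x))\<^sup>2)"
    by (rule Sigma_integrable)+
  have "integrable lborel (\<lambda>x. 2 * log_potential (sfun u x))"
    by (intro integrable_mult_right integrable_log_potential)
  then show "integrable lborel (\<lambda>x. (cmod (sfun u x))\<^sup>2 * ln ((cmod (sfun u x))\<^sup>2))"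
    by (simp add: log_potential_def)
next
  fix u v :: "'n Sigma_space"
  show "integrable lborel (energy_deriv_integrand \<gamma> u v)" by (rule integrable_energy_deriv_integrand)
next
  define E' :: "'n Sigma_space \<Rightarrow> ('n Sigma_space \<Rightarrow>\<^sub>L real)" where "E' u = Blinfun (energy_deriv_pairing \<gamma> u)" for u
  \<comment> \<open>\<open>Blinfun\<close> is faithful only on bounded linear maps; the pairing is
    one because it is a Frechet derivative.\<close>
  have E': "blinfun_apply (E' u) = energy_deriv_pairing \<gamma> u" for u
    unfolding E'_def by (rule bounded_linear_Blinfun_apply[OF has_derivative_bounded_linear[OF energy_has_derivative]])
  show "\<exists>E' :: 'n Sigma_space \<Rightarrow> ('n Sigma_space \<Rightarrow>\<^sub>L real).
            (\<forall>u. (energy \<gamma> has_derivative blinfun_apply (E' u)) (at u)) \<and>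
            (\<forall>u v. blinfun_apply (E' u) v = energy_deriv_pairing \<gamma> u v) \<and>
            continuous_on UNIV E'"
    by (intro exI[of _ E'] conjI allI continuous_energy_deriv[of E' \<gamma>]) (simp_all add: E' energy_has_derivative)
qed

end
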